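(* Let $p>3$ be a prime and let $L_1$ be a Lamé operator with dihedral projective monodromy group of order $2p$. Let $K$ be its field of moduli, $\mathfrak p$ a prime of $K$ above $p$, $e_{\mathfrak p}$ its absolute ramification index, and $s$ the signature of the tree associated to $L_1$. Set $$e=\frac{p+1-s}{\gcd(p+1-s,\,4(3-s))}.$$ Then $e$ divides $e_{\mathfrak p}$.
   Context: For $g_2,g_3,B\in\mathbf C$ with $g_2^3-27g_3^2\ne0$ and $f(x)=4x^3-g_2x-g_3$, $L_1=L_{1,g_2,g_3,B}=D^2+\frac{f'}{2f}D-\frac{2x+B}{f}$, $D=d/dx$. Equivalence: $g_2'=u^2g_2$, $g_3'=u^3g_3$, $B'=uB$, $u\in\mathbf C^*$. The field of moduli is the intersection of the fields $\mathbf Q(g_2',g_3',B')$ over all operators equivalent to $L_1$ (a number field). Projective monodromy = image of monodromy in $\mathrm{PGL}_2(\mathbf C)$. Associated tree: equivalence classes of Lamé operators $L_1$ with dihedral projective monodromy of order $2N$ correspond bijectively to trees $[a,b,c]$ with $a,b,c$ positive integers, $a+b+c=N$, $\gcd(a,b,c)=1$, where $[a,b,c]$ is the planar bipartite tree (dessin d'enfant, i.e. $\beta^{-1}([0,1])$ for a polynomial Belyi map $\beta$, black vertices over $0$, white over $1$) having a black center of valency $3$ and three branches that are paths with $a,b,c$ edges in counterclockwise order. Explicitly, given the tree with polynomial model $\beta$, let $S$ be the set of points of $\beta^{-1}(\{0,1\})$ of odd ramification index (the center and the three ends); $E$ is the double cover of $\mathbf P^1$ branched at $S$ with origin over the center,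 and the point $P$ with $x(P)=B$ is a preimage of $\infty$. The signature of $[a,b,c]$ is the number of black vertices of valency $1$, i.e. the number of even integers among $a,b,c$; for $N=p$ odd it is $0$ or $2$. *)

theory Defs
  imports
    "HOL-Analysis.Analysis"
    "HOL-Algebra.Ideal_Product"
    "HOL-Algebra.Generated_Fields"
    "HOL-Algebra.Algebraic_Closure_Type"
begin

section \<open>Lame operators and their projective monodromy\<close>

definition lame_poly :: "complex \<Rightarrow> complex \<Rightarrow> complex poly" where
  "lame_poly g2 g3 = [:- g3, - g2, 0, 4:]"

definition lame_operator ::
  "complex \<Rightarrow> complex \<Rightarrow> complex \<Rightarrow> (complex \<Rightarrow> complex) \<Rightarrow> complex \<Rightarrow> complex" where
  "lame_operator g2 g3 B y x =
     deriv (deriv y) x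
     + poly (pderiv (lame_poly g2 g3)) x / (2 * poly (lame_poly g2 g3) x) * deriv y x
     - (2 * x + B) / poly (lame_poly g2 g3) x * y x"

definition local_solution ::
  "complex \<Rightarrow> complex \<Rightarrow> complex \<Rightarrow> complex \<Rightarrow> (complex \<Rightarrow> complex) \<Rightarrow> bool" where
  "local_solution g2 g3 B z y \<longleftrightarrow>
     (\<exists>r>0. y holomorphic_on ball z r \<and>
        (\<forall>x\<in>ball z r. poly (lame_poly g2 g3) x \<noteq> 0 \<and> lame_operator g2 g3 B y x = 0))"

text \<open>Analytic continuation of a solution along the path \<open>\<gamma>\<close>: the germ of \<open>F t\<close> at \<open>\<gamma> t\<close> is the
  continuation of the germ of \<open>F 0\<close> at \<open>\<gamma> 0\<close>.\<close>

definition continuation ::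
  "complex \<Rightarrow> complex \<Rightarrow> complex \<Rightarrow> (real \<Rightarrow> complex) \<Rightarrow> (real \<Rightarrow> complex \<Rightarrow> complex) \<Rightarrow> bool" where
  "continuation g2 g3 B \<gamma> F \<longleftrightarrow>
     (\<forall>t\<in>{0..1}. local_solution g2 g3 B (\<gamma> t) (F t) \<and>
        (\<forall>\<^sub>F s in at t within {0..1}. \<forall>\<^sub>F x in nhds (\<gamma> s). F s x = F t x))"

text \<open>A germ of a solution at a regular point is determined by its value and first derivative
  there, and these can be prescribed; so the solution space at \<open>z\<close> is identified with
  \<open>complex ^ 2\<close>.\<close>

definition jet :: "complex \<Rightarrow> (complex \<Rightarrow> complex) \<Rightarrow> complex ^ 2" where
  "jet z y = vector [y z, deriv y z]"

definition monodromy :: "complex \<Rightarrow> complex \<Rightarrow> complex \<Rightarrow> complex \<Rightarrow> (complex ^ 2 ^ 2) set" where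
  "monodromy g2 g3 B x0 =
     {A. \<exists>\<gamma>. path \<gamma> \<and> pathstart \<gamma> = x0 \<and> pathfinish \<gamma> = x0 \<and>
           path_image \<gamma> \<subseteq> {x. poly (lame_poly g2 g3) x \<noteq> 0} \<and>
           (\<forall>F. continuation g2 g3 B \<gamma> F \<longrightarrow> jet x0 (F 1) = A *v jet x0 (F 0))}"

definition GL2 :: "(complex ^ 2 ^ 2) monoid" where
  "GL2 = \<lparr>carrier = {A. invertible A}, monoid.mult = (**), one = mat 1\<rparr>"

definition scalars :: "(complex ^ 2 ^ 2) set" where
  "scalars = {mat c | c. c \<noteq> 0}"

definition PGL2 :: "(complex ^ 2 ^ 2) set monoid" where
  "PGL2 = GL2 Mod scalars"

definition projective_monodromy ::
  "complex \<Rightarrow> complex \<Rightarrow> complex \<Rightarrow> complex \<Rightarrow> (complex ^ 2 ^ 2) set monoid" where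
  "projective_monodromy g2 g3 B x0 =
     PGL2 \<lparr>carrier := (\<lambda>A. scalars #>\<^bsub>GL2\<^esub> A) ` monodromy g2 g3 B x0\<rparr>"

text \<open>The dihedral group of order \<open>2 * N\<close> as the semidirect product of the integers modulo \<open>N\<close>
  and \<open>{1, -1}\<close>.\<close>

definition dihedral_group :: "nat \<Rightarrow> (int \<times> int) monoid" where
  "dihedral_group N =
     \<lparr>carrier = {0..<int N} \<times> {1, -1},
      monoid.mult = (\<lambda>(i, a) (j, b). ((i + a * j) mod int N, a * b)),
      one = (0, 1)\<rparr>"


section \<open>Field of moduli, primes and ramification\<close>

definition lame_equiv ::
  "complex \<times> complex \<times> complex \<Rightarrow> complex \<times> complex \<times> complex \<Rightarrow> bool" where
  "lame_equiv = (\<lambda>(g2, g3, B) (g2', g3', B').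
     \<exists>u. u \<noteq> 0 \<and> g2' = u ^ 2 * g2 \<and> g3' = u ^ 3 * g3 \<and> B' = u * B)"

text \<open>In characteristic zero the generated subfield contains the rationals.\<close>

definition field_of_moduli :: "complex \<Rightarrow> complex \<Rightarrow> complex \<Rightarrow> complex set" where
  "field_of_moduli g2 g3 B =
     \<Inter> {generate_field ring_of_type_algebra {g2', g3', B'} | g2' g3' B'.
           lame_equiv (g2, g3, B) (g2', g3', B')}"

definition ring_of_integers :: "complex set \<Rightarrow> complex ring" where
  "ring_of_integers K = ring_of_type_algebra \<lparr>carrier := {x \<in> K. algebraic_int x}\<rparr>"

definition prime_above :: "nat \<Rightarrow> complex set \<Rightarrow> complex set \<Rightarrow> bool" where
  "prime_above p K P \<longleftrightarrow> primeideal P (ring_of_integers K) \<and> of_nat p \<in> P"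

text \<open>The exponent of \<open>P\<close> in the factorization of the ideal generated by \<open>p\<close>.\<close>

definition ramification_index :: "nat \<Rightarrow> complex set \<Rightarrow> complex set \<Rightarrow> nat" where
  "ramification_index p K P =
     (GREATEST n. PIdl\<^bsub>ring_of_integers K\<^esub> (of_nat p)
                    \<subseteq> P [^]\<^bsub>ideals_set (ring_of_integers K)\<^esub> n)"


section \<open>Plane trees of polynomial Belyi maps\<close>

definition belyi_poly :: "complex poly \<Rightarrow> bool" where
  "belyi_poly \<beta> \<longleftrightarrow> Polynomial.degree \<beta> > 0 \<and> (\<forall>z. poly (pderiv \<beta>) z = 0 \<longrightarrow> poly \<beta> z \<in> {0, 1})"

definition dessin :: "complex poly \<Rightarrow> complex set" where
  "dessin \<beta> = {z. poly \<beta> z \<in> closed_segment 0 1}"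

definition black :: "complex poly \<Rightarrow> complex set" where
  "black \<beta> = {z. poly \<beta> z = 0}"

definition white :: "complex poly \<Rightarrow> complex set" where
  "white \<beta> = {z. poly \<beta> z = 1}"

text \<open>The valency of a vertex is the ramification index of \<open>\<beta>\<close> there.\<close>

definition valency :: "complex poly \<Rightarrow> complex \<Rightarrow> nat" where
  "valency \<beta> z = Polynomial.order z (\<beta> - [:poly \<beta> z:])"

definition signature :: "complex poly \<Rightarrow> nat" where
  "signature \<beta> = card {z \<in> black \<beta>. valency \<beta> z = 1}"

text \<open>\<open>\<gamma>\<close> parametrizes a path in the dessin with \<open>k\<close> edges (hence \<open>k + 1\<close> vertices) leaving
  \<open>z0\<close> in the direction of the unit vector \<open>d\<close>.\<close>

definition is_branch ::
  "complex poly \<Rightarrow> complex \<Rightarrow> complex \<Rightarrow> nat \<Rightarrow> (real \<Rightarrow> complex) \<Rightarrow> bool" where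
  "is_branch \<beta> z0 d k \<gamma> \<longleftrightarrow>
     arc \<gamma> \<and> pathstart \<gamma> = z0 \<and> path_image \<gamma> \<subseteq> dessin \<beta> \<and>
     card (path_image \<gamma> \<inter> (black \<beta> \<union> white \<beta>)) = k + 1 \<and>
     ((\<lambda>t. sgn (\<gamma> t - z0)) \<longlongrightarrow> d) (at_right 0)"

text \<open>The dessin of \<open>\<beta>\<close> is the plane tree \<open>[a, b, c]\<close> with black center \<open>z0\<close>. Near \<open>z0\<close> the
  dessin consists of three arcs whose tangent directions differ by the cube roots of unity, and
  multiplication by \<open>cis (2 * pi / 3)\<close> passes to the next one counterclockwise.\<close>

definition tree_model :: "complex poly \<Rightarrow> complex \<Rightarrow> nat \<Rightarrow> nat \<Rightarrow> nat \<Rightarrow> bool" where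
  "tree_model \<beta> z0 a b c \<longleftrightarrow>
     belyi_poly \<beta> \<and> z0 \<in> black \<beta> \<and> valency \<beta> z0 = 3 \<and>
     (\<exists>d \<gamma>1 \<gamma>2 \<gamma>3.
        is_branch \<beta> z0 d a \<gamma>1 \<and>
        is_branch \<beta> z0 (cis (2 * pi / 3) * d) b \<gamma>2 \<and>
        is_branch \<beta> z0 (cis (4 * pi / 3) * d) c \<gamma>3 \<and>
        path_image \<gamma>1 \<inter> path_image \<gamma>2 = {z0} \<and>
        path_image \<gamma>1 \<inter> path_image \<gamma>3 = {z0} \<and>
        path_image \<gamma>2 \<inter> path_image \<gamma>3 = {z0} \<and>
        path_image \<gamma>1 \<union> path_image \<gamma>2 \<union> path_image \<gamma>3 = dessin \<beta>)"

definition odd_vertices :: "complex poly \<Rightarrow> complex set" where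
  "odd_vertices \<beta> = {z \<in> black \<beta> \<union> white \<beta>. odd (valency \<beta> z)}"


section \<open>The tree associated to a Lame operator\<close>

text \<open>In the projective line and on the curve, \<open>None\<close> is the point at infinity, which is the
  origin of the curve.\<close>

definition weierstrass_curve :: "complex \<Rightarrow> complex \<Rightarrow> (complex \<times> complex) option set" where
  "weierstrass_curve g2 g3 =
     insert None (Some ` {(x, y). y ^ 2 = poly (lame_poly g2 g3) x})"

definition x_coord :: "(complex \<times> complex) option \<Rightarrow> complex option" where
  "x_coord = map_option fst"

definition moebius :: "complex \<Rightarrow> complex \<Rightarrow> complex \<Rightarrow> complex \<Rightarrow> complex option \<Rightarrow> complex option" where
  "moebius a b c d z =
     (case z of
        None \<Rightarrow> if c = 0 then None else Some (a / c)
      | Some x \<Rightarrow> if c * x + d = 0 then None else Some ((a * x + b) / (c * x + d)))"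

text \<open>The double covers of the projective line by the elliptic curve which are ramified at the
  origin are, up to automorphisms of the projective line, the \<open>x\<close>-coordinate.\<close>

definition double_cover ::
  "((complex \<times> complex) option \<Rightarrow> complex option) \<Rightarrow> bool" where
  "double_cover \<phi> \<longleftrightarrow> (\<exists>a b c d. a * d - b * c \<noteq> 0 \<and> \<phi> = moebius a b c d \<circ> x_coord)"

definition branch_points ::
  "(complex \<times> complex) option set \<Rightarrow> ((complex \<times> complex) option \<Rightarrow> complex option)
     \<Rightarrow> complex option set" where
  "branch_points E \<phi> = {q. \<exists>!P. P \<in> E \<and> \<phi> P = q}"

text \<open>\<open>\<beta>\<close> is a polynomial model of the tree \<open>[a, b, c]\<close>, with \<open>N\<close> edges, associated to the Lame
  operator with parameters \<open>g2\<close>, \<open>g3\<close>, \<open>B\<close>. Without the gcd condition the same operator would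
  also be obtained from the trees \<open>[k * a, k * b, k * c]\<close>.\<close>

definition associated_tree ::
  "nat \<Rightarrow> complex \<Rightarrow> complex \<Rightarrow> complex \<Rightarrow> complex poly \<Rightarrow> bool" where
  "associated_tree N g2 g3 B \<beta> \<longleftrightarrow>
     (\<exists>z0 a b c \<phi>. a > 0 \<and> b > 0 \<and> c > 0 \<and> a + b + c = N \<and> gcd a (gcd b c) = 1 \<and>
        tree_model \<beta> z0 a b c \<and>
        double_cover \<phi> \<and>
        branch_points (weierstrass_curve g2 g3) \<phi> = Some ` odd_vertices \<beta> \<and>
        \<phi> None = Some z0 \<and>
        (\<exists>P \<in> weierstrass_curve g2 g3. x_coord P = Some B \<and> \<phi> P = None))"

end

theory Submission
  imports Defs
begin

text \<open>By Riemann--Hurwitz and since the double cover has four branch points, \<open>\<beta>\<close> has degree \<open>p\<close> and, in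
  a suitable coordinate centred at \<open>z0\<close>, is a monic polynomial \<open>F = x\<^sup>3 A Q\<^sup>2\<close> with
  \<open>F - 1 = W R\<^sup>2\<close> and \<open>F' = p x\<^sup>2 Q R\<close>, where \<open>A\<close> has degree \<open>s\<close>, \<open>W\<close> has degree \<open>3 - s\<close> and
  \<open>s\<close> is \<open>0\<close> or \<open>2\<close>. The finite branch points of the \<open>x\<close>-coordinate are the points
  \<open>B + k / w\<close> for the roots \<open>w\<close> of \<open>A W\<close>.

  For every valuation ring of the complex numbers with residue characteristic \<open>p\<close>, the derivative
  of \<open>F\<close> vanishes modulo the maximal ideal, so \<open>F\<close> reduces to \<open>x\<^sup>p\<close>: the zeros of \<open>F\<close> lie in the
  maximal ideal and those of \<open>F - 1\<close> are congruent to \<open>1\<close>. Hence the \<open>w\<close> are algebraic and the field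
  of moduli is a number field. Rescaling around a root of \<open>W\<close> (if \<open>s = 0\<close>) or around \<open>0\<close> (if
  \<open>s = 2\<close>) until the roots nearby separate makes the derivative a unit multiple of a monic
  polynomial; the exponent of the scaling factor gives the differences of these odd vertices
  valuation \<open>2 / (p + 1 - s)\<close> when \<open>p\<close> has valuation \<open>1\<close>. The weight zero invariant
  \<open>(g2\<^sup>3 - 27 g3\<^sup>2) / (4 B\<^sup>3 - g2 B - g3)\<^sup>2\<close> lies in the field of moduli and has valuation
  \<open>12 / (p + 1)\<close> or \<open>- 4 / (p - 1)\<close>. As \<open>\<pp>\<close> has a discrete valuation,
  \<open>p + 1 - s\<close> divides \<open>4 (3 - s)\<close> times the ramification index.\<close>

hide_const (open) Polynomials.degree Coset.order up_ring.coeff up_ring.monom module.smult Polynomials.lead_coeff Divisibility.prime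

section \<open>Valuation rings\<close>

text \<open>The vertices are not known to be algebraic at the outset, so no number field is at hand
  in which to measure them. Valuation rings of the whole field of complex numbers take its place.
  The same computation then serves twice: over all valuation rings above \<open>p\<close> it yields
  algebraicity, and over one that dominates the given prime it yields ramification.

  The price is an arbitrary value group. That \<open>x\<close> has \<open>m / a\<close> times the
  valuation of \<open>p\<close> is therefore expressed by \<open>x ^ a / of_nat p powi m\<close>
  being a unit. Integer values return only on \<open>K\<close>, where the bounded degree makes the
  valuation discrete.

  The constant \<open>4 * (3 - s)\<close> arises as follows. With
  \<open>h = (p + 1 - s) / 2\<close>, the close odd vertices have mutual distances of valuation
  \<open>1 / h\<close>. The invariant is the square of the product of the three differences over the
  product of the three ends. For \<open>s = 0\<close> all three differences count and the ends are
  units, which gives \<open>6 / h\<close>. For \<open>s = 2\<close> one difference counts against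
  two ends that are themselves small, which gives \<open>- 2 / h\<close>. In absolute value both are
  \<open>4 * (3 - s) / (p + 1 - s)\<close>.\<close>

locale valuation_ring =
  fixes V M :: "'a::field set"
  assumes one_V: "1 \<in> V"
    and add_V: "\<And>x y. x \<in> V \<Longrightarrow> y \<in> V \<Longrightarrow> x + y \<in> V"
    and uminus_V: "\<And>x. x \<in> V \<Longrightarrow> - x \<in> V"
    and mult_V: "\<And>x y. x \<in> V \<Longrightarrow> y \<in> V \<Longrightarrow> x * y \<in> V"
    and M_subset_V: "M \<subseteq> V"
    and zero_M: "0 \<in> M"
    and add_M: "\<And>x y. x \<in> M \<Longrightarrow> y \<in> M \<Longrightarrow> x + y \<in> M"
    and mult_M: "\<And>x y. x \<in> V \<Longrightarrow> y \<in> M \<Longrightarrow> x * y \<in> M"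
    and one_notin_M: "1 \<notin> M"
    and notin_V: "\<And>x. x \<notin> V \<Longrightarrow> inverse x \<in> M"
begin

definition vunit :: "'a \<Rightarrow> bool" where
  "vunit x \<longleftrightarrow> x \<in> V \<and> x \<notin> M"

lemma zero_V: "0 \<in> V" using M_subset_V zero_M by auto

lemma M_V: "x \<in> M \<Longrightarrow> x \<in> V" using M_subset_V by auto

lemma mult_M': "x \<in> M \<Longrightarrow> y \<in> V \<Longrightarrow> x * y \<in> M"
  using mult_M[of y x] by (simp add: mult.commute)

lemma uminus_M: "x \<in> M \<Longrightarrow> - x \<in> M"
  using mult_M[of "- 1" x] uminus_V[OF one_V] by simp

lemma diff_V: "x \<in> V \<Longrightarrow> y \<in> V \<Longrightarrow> x - y \<in> V"
  using add_V[of x "- y"] uminus_V[of y] by simp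

lemma diff_M: "x \<in> M \<Longrightarrow> y \<in> M \<Longrightarrow> x - y \<in> M"
  using add_M[of x "- y"] uminus_M[of y] by simp

lemma power_V: "x \<in> V \<Longrightarrow> x ^ n \<in> V"
  by (induction n) (auto intro: one_V mult_V)

lemma power_M: "x \<in> M \<Longrightarrow> n > 0 \<Longrightarrow> x ^ n \<in> M"
  by (cases n) (auto intro: mult_M' power_V M_V)

lemma of_nat_V: "of_nat n \<in> V"
  by (induction n) (auto intro: one_V zero_V add_V)

lemma of_int_V: "of_int n \<in> V"
  by (cases n) (auto intro: uminus_V of_nat_V diff_V one_V simp del: of_nat_Suc)

lemma sum_V: "(\<And>i. i \<in> S \<Longrightarrow> f i \<in> V) \<Longrightarrow> sum f S \<in> V"
  by (induction S rule: infinite_finite_induct) (auto intro: zero_V add_V)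

lemma sum_M: "(\<And>i. i \<in> S \<Longrightarrow> f i \<in> M) \<Longrightarrow> sum f S \<in> M"
  by (induction S rule: infinite_finite_induct) (auto intro: zero_M add_M)

lemma prod_V: "(\<And>i. i \<in> S \<Longrightarrow> f i \<in> V) \<Longrightarrow> prod f S \<in> V"
  by (induction S rule: infinite_finite_induct) (auto intro: one_V mult_V)

lemma inverse_notin_V: "x \<in> M \<Longrightarrow> x \<noteq> 0 \<Longrightarrow> inverse x \<notin> V"
  using mult_M[of "inverse x" x] one_notin_M by auto

text \<open>Applied to \<open>inverse x\<close>, the axiom \<open>notin_V\<close> turns every
  element of \<open>V\<close> outside \<open>M\<close> into a unit, so \<open>M\<close> is exactly
  the set of nonunits.\<close>

lemma inverse_V: "x \<in> V \<Longrightarrow> x \<notin> M \<Longrightarrow> inverse x \<in> V"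
  using notin_V[of "inverse x"] by auto

lemma vunit_V: "vunit x \<Longrightarrow> x \<in> V" by (simp add: vunit_def)

lemma vunit_nonzero: "vunit x \<Longrightarrow> x \<noteq> 0" using zero_M by (auto simp: vunit_def)

lemma vunit_one: "vunit 1" by (simp add: vunit_def one_V one_notin_M)

lemma vunit_iff: "vunit x \<longleftrightarrow> x \<in> V \<and> x \<noteq> 0 \<and> inverse x \<in> V"
  unfolding vunit_def using zero_M inverse_V inverse_notin_V by auto

lemma vunit_inverse: "vunit x \<Longrightarrow> vunit (inverse x)"
  by (auto simp: vunit_iff)

lemma vunit_mult: "vunit x \<Longrightarrow> vunit y \<Longrightarrow> vunit (x * y)"
  by (auto simp: vunit_iff intro: mult_V)

lemma vunit_divide: "vunit x \<Longrightarrow> vunit y \<Longrightarrow> vunit (x / y)"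
  by (simp add: divide_inverse vunit_mult vunit_inverse)

lemma vunit_uminus: "vunit x \<Longrightarrow> vunit (- x)"
  by (auto simp: vunit_iff intro: uminus_V)

lemma vunit_power: "vunit x \<Longrightarrow> vunit (x ^ n)"
  by (induction n) (auto intro: vunit_one vunit_mult)

lemma vunit_prod: "(\<And>i. i \<in> S \<Longrightarrow> vunit (f i)) \<Longrightarrow> vunit (prod f S)"
  by (induction S rule: infinite_finite_induct) (auto intro: vunit_one vunit_mult)

lemma vunit_add_M: "vunit x \<Longrightarrow> y \<in> M \<Longrightarrow> vunit (x + y)"
  unfolding vunit_def using add_V M_V diff_M[of "x + y" y] by auto

lemma vunit_diff_M: "vunit x \<Longrightarrow> y \<in> M \<Longrightarrow> vunit (x - y)"
  using vunit_add_M[of x "- y"] uminus_M[of y] by auto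

lemma vunit_multD: "x \<in> V \<Longrightarrow> y \<in> V \<Longrightarrow> vunit (x * y) \<Longrightarrow> vunit x"
  unfolding vunit_def using mult_M'[of x y] by auto

lemma vunit_prodD:
  assumes "finite S" "vunit (prod f S)" "\<And>i. i \<in> S \<Longrightarrow> f i \<in> V" "i \<in> S"
  shows "vunit (f i)"
  using assms vunit_multD[of "f i" "prod f (S - {i})"] prod_V[of "S - {i}" f]
  by (simp add: prod.remove[of S i])

lemma power_in_M: "x ^ n \<in> M \<Longrightarrow> x \<in> M"
proof (rule ccontr)
  assume *: "x ^ n \<in> M" "x \<notin> M"
  show False
  proof (cases "x \<in> V")
    case True
    then show ?thesis using * vunit_power[of x n] by (auto simp: vunit_def)
  next
    case False
    then have "inverse x \<in> M" "x \<noteq> 0" using notin_V zero_V by auto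
    then show False
      using mult_M[of "inverse x ^ n" "x ^ n"] * M_V power_V one_notin_M
      by (simp flip: power_mult_distrib)
  qed
qed

lemma power_in_V: "x ^ n \<in> V \<Longrightarrow> n > 0 \<Longrightarrow> x \<in> V"
  using power_M[of "inverse x" n] inverse_notin_V[of "inverse x ^ n"] notin_V[of x] zero_V
  by (cases "x = 0") (auto simp: power_inverse)

lemma vunit_powerD: "vunit (x ^ n) \<Longrightarrow> n > 0 \<Longrightarrow> vunit x"
  unfolding vunit_def using power_in_V power_M by auto

text \<open>Since the value group is never constructed, an element of largest absolute value is
  described by quotients. Later \<open>l\<close> is the scaling factor that brings a set of roots
  into \<open>V\<close>, or the dominant term of a vanishing sum.\<close>

lemma exists_max:
  assumes "finite S" "S \<noteq> {}" "0 \<notin> S"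
  shows "\<exists>l\<in>S. \<forall>r\<in>S. r / l \<in> V"
  using assms
proof (induction S rule: finite_ne_induct)
  case (singleton x)
  then show ?case by (simp add: one_V)
next
  case (insert x F)
  then obtain l where l: "l \<in> F" "\<And>r. r \<in> F \<Longrightarrow> r / l \<in> V" by auto
  then have nz: "l \<noteq> 0" "x \<noteq> 0" using insert by auto
  show ?case
  proof (cases "x / l \<in> V")
    case True
    then show ?thesis using l by auto
  next
    case False
    then have "l / x \<in> V" using notin_V[of "x / l"] M_V by (auto simp: inverse_eq_divide)
    then have "r / x \<in> V" if "r \<in> F" for r
      using mult_V[OF l(2)[OF that], of "l / x"] nz by simp
    then show ?thesis using one_V nz by auto
  qed
qed

end

text \<open>Every subset closed under differences and products that omits 1 lies in the maximal ideal of
  a valuation ring, namely in any maximal such set \<open>J\<close>; the ring is the stabilizer of \<open>J\<close>.\<close>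

theorem exists_valuation_ring:
  fixes J0 :: "'a::field set"
  assumes "0 \<in> J0" "\<And>x y. x \<in> J0 \<Longrightarrow> y \<in> J0 \<Longrightarrow> x - y \<in> J0"
    "\<And>x y. x \<in> J0 \<Longrightarrow> y \<in> J0 \<Longrightarrow> x * y \<in> J0" "1 \<notin> J0"
  shows "\<exists>V M. valuation_ring V M \<and> J0 \<subseteq> M"
proof -
  define rng :: "'a set \<Rightarrow> bool" where
    "rng J \<longleftrightarrow> 0 \<in> J \<and> (\<forall>x\<in>J. \<forall>y\<in>J. x - y \<in> J) \<and> (\<forall>x\<in>J. \<forall>y\<in>J. x * y \<in> J)" for J
  define \<F> where "\<F> = {J. rng J \<and> 1 \<notin> J \<and> J0 \<subseteq> J}"
  have "\<exists>J\<in>\<F>. \<forall>Y\<in>\<F>. J \<subseteq> Y \<longrightarrow> Y = J"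
  proof (rule subset_Zorn_nonempty)
    have "rng J0" unfolding rng_def using assms(1-3) by blast
    then have "J0 \<in> \<F>" unfolding \<F>_def using assms(4) by blast
    then show "\<F> \<noteq> {}" by blast
  next
    fix C assume C: "C \<noteq> {}" "subset.chain \<F> C"
    have up: "\<exists>J\<in>C. x \<in> J \<and> y \<in> J" if "x \<in> \<Union>C" "y \<in> \<Union>C" for x y
    proof -
      from that obtain J1 J2 where J: "J1 \<in> C" "x \<in> J1" "J2 \<in> C" "y \<in> J2" by auto
      then have "J1 \<subseteq> J2 \<or> J2 \<subseteq> J1" using C(2) by (auto simp: subset.chain_def)
      then show ?thesis using J by auto
    qed
    have mem: "rng J \<and> 1 \<notin> J \<and> J0 \<subseteq> J" if "J \<in> C" for J
      using C that by (auto simp: subset.chain_def \<F>_def)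
    have "rng (\<Union>C)"
      unfolding rng_def
    proof (intro conjI ballI)
      show "0 \<in> \<Union>C" using C(1) mem by (auto simp: rng_def)
    next
      fix x y assume "x \<in> \<Union>C" "y \<in> \<Union>C"
      then obtain J where "J \<in> C" "x \<in> J" "y \<in> J" using up by blast
      then show "x - y \<in> \<Union>C" "x * y \<in> \<Union>C" using mem[of J] unfolding rng_def by blast+
    qed
    then show "\<Union>C \<in> \<F>" using C(1) mem by (auto simp: \<F>_def)
  qed
  then obtain J where J: "rng J" "1 \<notin> J" "J0 \<subseteq> J"
    and max0: "\<forall>Y\<in>\<F>. J \<subseteq> Y \<longrightarrow> Y = J"
    unfolding \<F>_def by blast
  have max: "Y = J" if "rng Y" "J \<subseteq> Y" "1 \<notin> Y" for Y
    using max0 that J(3) unfolding \<F>_def by blast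
  have J_zero: "0 \<in> J" and J_diff: "\<And>x y. x \<in> J \<Longrightarrow> y \<in> J \<Longrightarrow> x - y \<in> J"
    and J_mult: "\<And>x y. x \<in> J \<Longrightarrow> y \<in> J \<Longrightarrow> x * y \<in> J"
    using J(1) by (auto simp: rng_def)
  have J_minus: "- x \<in> J" if "x \<in> J" for x using J_diff[OF J_zero that] by simp
  have J_add: "x + y \<in> J" if "x \<in> J" "y \<in> J" for x y
    using J_diff[OF that(1) J_minus[OF that(2)]] by simp
  have J_sum: "sum f S \<in> J" if "\<And>i. i \<in> S \<Longrightarrow> f i \<in> J" for f and S :: "nat set"
    using that by (induction S rule: infinite_finite_induct) (auto intro: J_zero J_add)
  have J_power: "x ^ Suc n \<in> J" if "x \<in> J" for x n
    by (induction n) (auto intro: J_mult that)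
  define V where "V = {x. \<forall>j\<in>J. x * j \<in> J}"
  have V_mult: "x * y \<in> V" if "x \<in> V" "y \<in> V" for x y
    using that unfolding V_def by (simp add: mult.assoc)
  have V_one: "1 \<in> V" by (simp add: V_def)
  have V_minus: "- x \<in> V" if "x \<in> V" for x
    using that J_minus by (auto simp: V_def)
  have V_add: "x + y \<in> V" if "x \<in> V" "y \<in> V" for x y
    using that J_add by (auto simp: V_def distrib_right)
  have J_V: "x \<in> V" if "x \<in> J" for x using that J_mult by (auto simp: V_def)
  have inv1: "inverse (1 - j) \<in> V" if j: "j \<in> J" for j
  proof -
    have nz: "1 - j \<noteq> 0" using j J(2) by auto
    \<comment> \<open>\<open>Y\<close> is \<open>J\<close> with the inverse of \<open>1 - j\<close>
      adjoined. It still omits 1, because every power of \<open>1 - j\<close> is congruent to 1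
      modulo \<open>J\<close>; so maximality leaves \<open>Y = J\<close>.\<close>
    define Y where "Y = {a * inverse (1 - j) ^ n | a n. a \<in> J}"
    have pV: "(1 - j) ^ n \<in> V" for n
      by (induction n) (use V_mult V_one V_add[OF V_one V_minus[OF J_V[OF j]]] in auto)
    have "rng Y"
      unfolding rng_def
    proof (intro conjI ballI)
      show "0 \<in> Y" using J_zero by (force simp: Y_def)
    next
      fix x y assume "x \<in> Y" "y \<in> Y"
      then obtain a b m n where *: "a \<in> J" "b \<in> J" "x = a * inverse (1 - j) ^ m"
        "y = b * inverse (1 - j) ^ n" by (auto simp: Y_def)
      have "x - y = ((1 - j) ^ n * a - (1 - j) ^ m * b) * inverse (1 - j) ^ (m + n)"
        unfolding *(3,4) using nz by (simp add: field_simps power_add)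
      moreover have "(1 - j) ^ n * a - (1 - j) ^ m * b \<in> J"
        using pV * by (intro J_diff) (auto simp: V_def)
      ultimately show "x - y \<in> Y" by (auto simp: Y_def)
      have "x * y = (a * b) * inverse (1 - j) ^ (m + n)" using * by (simp add: power_add)
      then show "x * y \<in> Y" unfolding Y_def using J_mult[OF *(1,2)] by blast
    qed
    moreover have "J \<subseteq> Y"
    proof
      fix x assume "x \<in> J"
      then show "x \<in> Y" unfolding Y_def by (intro CollectI exI[of _ x] exI[of _ 0]) auto
    qed
    moreover have "1 \<notin> Y"
    proof
      assume "1 \<in> Y"
      then obtain a n where a: "a \<in> J" "1 = a * inverse (1 - j) ^ n" by (auto simp: Y_def)
      then have "(1 - j) ^ n = a" using nz by (simp add: field_simps)
      moreover have "1 - (1 - j) ^ n \<in> J"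
      proof (induction n)
        case (Suc n)
        have "1 - (1 - j) ^ Suc n = (1 - (1 - j) ^ n) + (1 - j) ^ n * j" by (simp add: algebra_simps)
        moreover have "(1 - j) ^ n * j \<in> J" using pV[of n] j by (simp add: V_def)
        ultimately show ?case using J_add[OF Suc] by (simp only:)
      qed (simp add: J_zero)
      ultimately show False using a J(2) J_add[of a "1 - a"] by simp
    qed
    ultimately have "Y = J" using max by blast
    have "inverse (1 - j) * a \<in> J" if "a \<in> J" for a
    proof -
      have "inverse (1 - j) * a \<in> Y"
        unfolding Y_def using that by (intro CollectI exI[of _ a] exI[of _ 1]) auto
      then show ?thesis using \<open>Y = J\<close> by simp
    qed
    then show ?thesis by (simp add: V_def)
  qed
  have inv2: "inverse x \<in> V" if x: "x \<in> V" "x \<notin> J" for x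
  proof -
    \<comment> \<open>This set properly contains \<open>J\<close>, so by maximality it contains 1.
      Thus \<open>x\<close> is invertible modulo \<open>J\<close>, and \<open>inv1\<close> upgrades
      this to an inverse in \<open>V\<close>.\<close>
    define Y where "Y = {j + x * b | j b. j \<in> J \<and> b \<in> V}"
    have "rng Y"
      unfolding rng_def
    proof (intro conjI ballI)
      show "0 \<in> Y" unfolding Y_def
        by (intro CollectI exI[of _ 0]) (simp add: J_zero J_V)
    next
      fix u v assume "u \<in> Y" "v \<in> Y"
      then obtain j b j' b' where *: "j \<in> J" "b \<in> V" "u = j + x * b"
        "j' \<in> J" "b' \<in> V" "v = j' + x * b'" by (auto simp: Y_def)
      have "u - v = (j - j') + x * (b - b')" using * by (simp add: algebra_simps)
      moreover have "b - b' \<in> V" using V_add[OF _ V_minus, of b b'] * by simp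
      ultimately show "u - v \<in> Y" unfolding Y_def using J_diff[OF *(1,4)] by blast
      have "u * v = (j * j') + x * (b * j' + j * b' + b * (x * b'))" using * by (simp add: algebra_simps)
      moreover have "b * j' + j * b' + b * (x * b') \<in> V"
        using * x by (intro V_add V_mult) (auto intro: J_V)
      ultimately show "u * v \<in> Y" unfolding Y_def using J_mult[OF *(1,4)] by blast
    qed
    moreover have "J \<subseteq> Y"
    proof
      fix j assume "j \<in> J"
      then show "j \<in> Y" unfolding Y_def
        by (intro CollectI exI[of _ j] exI[of _ 0]) (simp add: J_zero J_V)
    qed
    moreover have "x \<in> Y" unfolding Y_def
      by (intro CollectI exI[of _ 0] exI[of _ 1]) (simp add: J_zero V_one)
    ultimately have "1 \<in> Y" using max x by blast
    then obtain j b where jb: "j \<in> J" "b \<in> V" "1 = j + x * b" by (auto simp: Y_def)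
    then have "x * b = 1 - j" "1 - j \<noteq> 0" using J(2) by (auto simp: algebra_simps)
    then have "inverse x = b * inverse (1 - j)" by (metis mult.commute mult.assoc mult.right_neutral inverse_unique right_inverse)
    then show ?thesis using jb inv1 V_mult by simp
  qed
  \<comment> \<open>A relation that writes 1 as a polynomial in \<open>x\<close> of degree at most
    \<open>n\<close> with coefficients in \<open>J\<close>. If there were none, the values of such
    polynomials would form a set equal to \<open>J\<close> by maximality, and \<open>x\<close> would
    stabilize \<open>J\<close>.\<close>
  define P where "P x n \<longleftrightarrow> (\<exists>a. (\<forall>i. a i \<in> J) \<and> (\<Sum>i\<le>n. a i * x ^ i) = 1)" for x n
  have ex_P: "\<exists>n. P x n" if x: "x \<notin> V" for x
  proof (rule ccontr)
    assume no: "\<nexists>n. P x n"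
    define Y where "Y = {poly q x | q. \<forall>i. coeff q i \<in> J}"
    have "rng Y"
      unfolding rng_def
    proof (intro conjI ballI)
      show "0 \<in> Y" unfolding Y_def by (intro CollectI exI[of _ 0]) (simp add: J_zero)
    next
      fix u v assume "u \<in> Y" "v \<in> Y"
      then obtain q r where *: "\<And>i. coeff q i \<in> J" "\<And>i. coeff r i \<in> J" "u = poly q x" "v = poly r x"
        by (auto simp: Y_def)
      show "u - v \<in> Y" unfolding Y_def
        by (intro CollectI exI[of _ "q - r"]) (use * J_diff in auto)
      show "u * v \<in> Y" unfolding Y_def
        by (intro CollectI exI[of _ "q * r"]) (use * in \<open>auto simp: coeff_mult intro: J_sum J_mult\<close>)
    qed
    moreover have "J \<subseteq> Y"
    proof
      fix j assume "j \<in> J"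
      then show "j \<in> Y" unfolding Y_def
        by (intro CollectI exI[of _ "[:j:]"]) (auto simp: coeff_pCons J_zero split: nat.split)
    qed
    moreover have "1 \<notin> Y"
    proof
      assume "1 \<in> Y"
      then obtain q where "\<And>i. coeff q i \<in> J" "poly q x = 1" by (auto simp: Y_def)
      then have "P x (degree q)" by (auto simp: P_def poly_altdef intro!: exI[of _ "coeff q"])
      then show False using no by blast
    qed
    ultimately have "Y = J" using max by blast
    have "x * a \<in> J" if "a \<in> J" for a
    proof -
      have "x * a \<in> Y" unfolding Y_def
        by (intro CollectI exI[of _ "[:0, a:]"])
          (use that in \<open>auto simp: coeff_pCons J_zero split: nat.split\<close>)
      then show ?thesis using \<open>Y = J\<close> by simp
    qed
    then show False using x by (simp add: V_def)
  qed
  \<comment> \<open>Chevalley's argument with shortest relations: the relation for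
    \<open>inverse x\<close>, multiplied by \<open>x ^ n / (1 - b 0)\<close>, expresses
    \<open>x ^ n\<close> by lower powers of \<open>x\<close>. Substituted into the shortest relation
    for \<open>x\<close>, it produces a shorter one.\<close>
  have key: False if nz: "x \<noteq> 0" and n: "P x n" "\<And>k. P x k \<Longrightarrow> n \<le> k"
    and m: "P (inverse x) m" "m \<le> n" for x m n
  proof -
    obtain a where a: "\<And>i. a i \<in> J" "(\<Sum>i\<le>n. a i * x ^ i) = 1" using n(1) by (auto simp: P_def)
    obtain b where b: "\<And>i. b i \<in> J" "(\<Sum>i\<le>m. b i * inverse x ^ i) = 1" using m(1) by (auto simp: P_def)
    have "n \<noteq> 0" using a J(2) by (intro notI) (metis atMost_0 finite.intros(1) finite_insert mult.right_neutral empty_iff sum.insert sum.empty power_0 add.right_neutral)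
    define c where "c = inverse (1 - b 0)"
    have c: "c \<in> V" "1 - b 0 \<noteq> 0" using inv1[OF b(1)] b(1)[of 0] J(2) by (auto simp: c_def)
    have "1 - b 0 = (\<Sum>i=1..m. b i * inverse x ^ i)"
      using b(2) by (simp add: atMost_atLeast0 sum.atLeast_Suc_atMost algebra_simps)
    then have "x ^ n * (1 - b 0) = (\<Sum>i=1..m. x ^ n * (b i * inverse x ^ i))"
      by (simp only: sum_distrib_left)
    also have "\<dots> = (\<Sum>i=1..m. b i * x ^ (n - i))"
      using nz m(2) by (intro sum.cong) (auto simp: power_diff field_simps)
    finally have "x ^ n * (1 - b 0) = (\<Sum>i=1..m. b i * x ^ (n - i))" .
    then have "x ^ n = c * (\<Sum>i=1..m. b i * x ^ (n - i))"
      using c(2) by (simp add: c_def field_simps)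
    also have "(\<Sum>i=1..m. b i * x ^ (n - i)) = (\<Sum>k=n-m..n-1. b (n - k) * x ^ k)"
      by (rule sum.reindex_bij_witness[of _ "\<lambda>k. n - k" "\<lambda>k. n - k"]) (use m(2) \<open>n \<noteq> 0\<close> in auto)
    also have "\<dots> = (\<Sum>k\<le>n-1. (if n - m \<le> k then b (n - k) else 0) * x ^ k)"
      by (rule sum.mono_neutral_cong_left) auto
    finally have xn: "a n * x ^ n = (\<Sum>k\<le>n-1. (c * a n * (if n - m \<le> k then b (n - k) else 0)) * x ^ k)"
      by (simp add: sum_distrib_left algebra_simps)
    have "1 = (\<Sum>k\<le>n-1. a k * x ^ k) + a n * x ^ n"
      using a(2) \<open>n \<noteq> 0\<close> by (cases n) auto
    also have "\<dots> = (\<Sum>k\<le>n-1. (a k + c * a n * (if n - m \<le> k then b (n - k) else 0)) * x ^ k)"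
      unfolding xn by (simp add: sum.distrib distrib_right)
    finally have "P x (n - 1)"
      unfolding P_def
      by (intro exI[of _ "\<lambda>k. a k + c * a n * (if n - m \<le> k then b (n - k) else 0)"])
        (use a b c J_add J_mult J_zero in \<open>auto simp: V_def\<close>)
    then show False using n(2)[of "n - 1"] \<open>n \<noteq> 0\<close> by simp
  qed
  have V_total: "inverse x \<in> V" if x: "x \<notin> V" for x
  proof (rule ccontr)
    assume y: "inverse x \<notin> V"
    have nz: "x \<noteq> 0" using x J_zero J_V by auto
    define n m where "n = (LEAST n. P x n)" and "m = (LEAST n. P (inverse x) n)"
    have "P x n" "P (inverse x) m" unfolding n_def m_def using LeastI_ex ex_P x y by metis+
    moreover have "\<And>k. P x k \<Longrightarrow> n \<le> k" "\<And>k. P (inverse x) k \<Longrightarrow> m \<le> k"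
      unfolding n_def m_def by (auto intro: Least_le)
    ultimately show False
      using key[of x n m] key[of "inverse x" m n] nz by (cases "m \<le> n") auto
  qed
  have "valuation_ring V J"
  proof
    fix x assume "x \<notin> V"
    then show "inverse x \<in> J" using V_total[of x] inv2[of "inverse x"] by auto
  qed (use V_one V_add V_minus V_mult J_V J_zero J_add J(2) in \<open>auto simp: V_def\<close>)
  then show ?thesis using J(3) by blast
qed

section \<open>Valuations and algebraic integers\<close>

lemma (in valuation_ring) Ints_V: "x \<in> \<int> \<Longrightarrow> x \<in> V"
  by (auto elim: Ints_cases intro: of_int_V)

lemma (in valuation_ring) poly_V: "(\<And>i. coeff q i \<in> V) \<Longrightarrow> x \<in> V \<Longrightarrow> poly q x \<in> V"
  by (auto simp: poly_altdef intro: sum_V mult_V power_V)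

text \<open>If \<open>x\<close> were outside \<open>V\<close>, dividing the equation by the top
  power of \<open>x\<close> would leave 1 plus terms in \<open>M\<close>.\<close>

lemma (in valuation_ring) monic_root_V:
  assumes c: "\<And>i. coeff q i \<in> V" and lead: "lead_coeff q = 1" and root: "poly q x = 0"
  shows "x \<in> V"
proof (rule ccontr)
  assume "x \<notin> V"
  then have M: "inverse x \<in> M" and nz: "x \<noteq> 0" using notin_V zero_V by auto
  define n where "n = degree q"
  have "0 = inverse x ^ n * (\<Sum>i\<le>n. coeff q i * x ^ i)"
    using root by (simp add: poly_altdef n_def)
  also have "\<dots> = (\<Sum>i\<le>n. coeff q i * inverse x ^ (n - i))"
    unfolding sum_distrib_left using nz
    by (intro sum.cong) (auto simp: power_diff field_simps)
  also have "\<dots> = 1 + (\<Sum>i<n. coeff q i * inverse x ^ (n - i))"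
    using lead by (simp add: n_def flip: lessThan_Suc_atMost)
  finally have "1 = - (\<Sum>i<n. coeff q i * inverse x ^ (n - i))"
    by (simp add: eq_neg_iff_add_eq_0)
  moreover have "(\<Sum>i<n. coeff q i * inverse x ^ (n - i)) \<in> M"
    by (intro sum_M mult_M c power_M M) auto
  ultimately show False using uminus_M one_notin_M by metis
qed

lemma (in valuation_ring) algebraic_int_V: "algebraic_int x \<Longrightarrow> x \<in> V"
  by (auto elim!: algebraic_int.cases intro: monic_root_V Ints_V)

text \<open>The values at \<open>inverse x\<close> of integer polynomials with constant term
  divisible by \<open>m\<close> are closed under differences and products, and the hypothesis says
  that 1 is not among them. The parameter covers two cases: \<open>m = 0\<close> leaves the residue
  characteristic free, a prime \<open>m\<close> fixes it.\<close>

lemma exists_pole_valuation: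
  fixes x :: "'a::field_char_0" and m :: int
  assumes "\<And>r k. (\<And>i. coeff r i \<in> \<int>) \<Longrightarrow> coeff r 0 = of_int (1 + m * k) \<Longrightarrow> poly r (inverse x) \<noteq> 0"
  shows "\<exists>V M. valuation_ring V M \<and> of_int m \<in> M \<and> inverse x \<in> M"
proof -
  define P where "P q \<longleftrightarrow> (\<forall>i. coeff q i \<in> \<int>) \<and> (\<exists>k. coeff q 0 = of_int (m * k))" for q :: "'a poly"
  define J where "J = {poly q (inverse x) | q. P q}"
  have "\<exists>V M. valuation_ring V M \<and> J \<subseteq> M"
  proof (rule exists_valuation_ring)
    have "P 0" unfolding P_def by (auto intro: exI[of _ 0])
    then show "0 \<in> J" unfolding J_def by (auto intro!: exI[of _ 0])
  next
    fix u v assume "u \<in> J" "v \<in> J"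
    then obtain q r where *: "P q" "P r" "u = poly q (inverse x)" "v = poly r (inverse x)"
      by (auto simp: J_def)
    then obtain k l where kl: "coeff q 0 = of_int (m * k)" "coeff r 0 = of_int (m * l)"
      by (auto simp: P_def)
    have "P (q - r)"
      unfolding P_def using * kl by (auto simp: P_def algebra_simps intro!: Ints_diff exI[of _ "k - l"])
    then show "u - v \<in> J" unfolding J_def using * by (intro CollectI exI[of _ "q - r"]) auto
    have "P (q * r)"
      unfolding P_def using * kl
      by (auto simp: P_def coeff_mult intro!: Ints_sum Ints_mult exI[of _ "m * k * l"])
    then show "u * v \<in> J" unfolding J_def using * by (intro CollectI exI[of _ "q * r"]) auto
  next
    show "1 \<notin> J"
    proof
      assume "1 \<in> J"
      then obtain q where q: "P q" "poly q (inverse x) = 1" by (auto simp: J_def)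
      then obtain k where k: "coeff q 0 = of_int (m * k)" by (auto simp: P_def)
      have "coeff (1 - q) i \<in> \<int>" for i
        using q by (auto simp: P_def intro!: Ints_diff)
      then show False using assms[of "1 - q" "- k"] q k by simp
    qed
  qed
  moreover have "of_int m \<in> J"
    unfolding J_def P_def
    by (intro CollectI exI[of _ "[:of_int m:]"]) (auto simp: coeff_pCons split: nat.split intro: exI[of _ 1])
  moreover have "inverse x \<in> J"
    unfolding J_def P_def
    by (intro CollectI exI[of _ "[:0, 1:]"]) (auto simp: coeff_pCons split: nat.split intro: exI[of _ 0])
  ultimately show ?thesis by blast
qed

text \<open>The integral closure of the integers is the intersection of all valuation rings. Closure
  of the algebraic integers under ring operations becomes immediate, since each valuation ring is
  closed.\<close>

lemma algebraic_int_iff_valuation: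
  fixes x :: "'a::field_char_0"
  shows "algebraic_int x \<longleftrightarrow> (\<forall>V M. valuation_ring V M \<longrightarrow> x \<in> V)"
proof
  assume R: "\<forall>V M. valuation_ring V M \<longrightarrow> x \<in> V"
  show "algebraic_int x"
  proof (rule ccontr)
    assume n: "\<not> algebraic_int x"
    then have nz: "x \<noteq> 0" by auto
    \<comment> \<open>For \<open>m = 0\<close> a forbidden relation has constant term 1, so its
      reflection is a monic integer polynomial with root \<open>x\<close>.\<close>
    have "\<exists>V M. valuation_ring V M \<and> of_int 0 \<in> M \<and> inverse x \<in> M"
    proof (rule exists_pole_valuation)
      fix r :: "'a poly" and k :: int
      assume r: "\<And>i. coeff r i \<in> \<int>" "coeff r 0 = of_int (1 + 0 * k)"
      show "poly r (inverse x) \<noteq> 0"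
      proof
        assume 0: "poly r (inverse x) = 0"
        have "algebraic_int x"
        proof (rule algebraic_int.intros)
          show "lead_coeff (reflect_poly r) = 1"
            using r(2) by (simp add: coeff_reflect_poly)
          show "\<forall>i. coeff (reflect_poly r) i \<in> \<int>"
            using r(1) by (simp add: coeff_reflect_poly)
          show "poly (reflect_poly r) x = 0"
            using 0 nz by (simp add: poly_reflect_poly_nz)
        qed
        then show False using n by simp
      qed
    qed
    then obtain V M where V: "valuation_ring V M" "inverse x \<in> M" by auto
    interpret valuation_ring V M by fact
    show False using inverse_notin_V[OF V(2)] R V(1) nz by auto
  qed
qed (auto intro: valuation_ring.algebraic_int_V)

lemma algebraic_int_add: "algebraic_int x \<Longrightarrow> algebraic_int y \<Longrightarrow> algebraic_int (x + y)"
  for x y :: "'a::field_char_0"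
  unfolding algebraic_int_iff_valuation by (blast intro: valuation_ring.add_V)

lemma algebraic_int_mult: "algebraic_int x \<Longrightarrow> algebraic_int y \<Longrightarrow> algebraic_int (x * y)"
  for x y :: "'a::field_char_0"
  unfolding algebraic_int_iff_valuation by (blast intro: valuation_ring.mult_V)

lemma algebraic_int_diff: "algebraic_int x \<Longrightarrow> algebraic_int y \<Longrightarrow> algebraic_int (x - y)"
  for x y :: "'a::field_char_0"
  unfolding algebraic_int_iff_valuation by (blast intro: valuation_ring.diff_V)

text \<open>Control above \<open>p\<close> alone does not give an algebraic integer, but it gives
  algebraicity: a transcendental \<open>x\<close> satisfies no integer relation and
  \<open>1 + p * k\<close> is never 0, so \<open>x\<close> would have a pole at some valuation above
  \<open>p\<close>.\<close>

lemma algebraic_if_integral_above_prime: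
  fixes x :: "'a::field_char_0" and p :: nat
  assumes p: "p > 1" and V: "\<And>V M. valuation_ring V M \<Longrightarrow> of_nat p \<in> M \<Longrightarrow> x \<in> V"
  shows "algebraic x"
proof (rule ccontr)
  assume n: "\<not> algebraic x"
  then have nz: "x \<noteq> 0" by auto
  have "\<exists>V M. valuation_ring V M \<and> of_int (int p) \<in> M \<and> inverse x \<in> M"
  proof (rule exists_pole_valuation)
    fix r :: "'a poly" and k :: int
    assume r: "\<And>i. coeff r i \<in> \<int>" "coeff r 0 = of_int (1 + int p * k)"
    have "1 + int p * k \<noteq> 0"
    proof
      assume "1 + int p * k = 0"
      then have "int p dvd 1" by (metis add_eq_0_iff dvd_minus_iff dvd_triv_left)
      then show False using p by simp
    qed
    then have "r \<noteq> 0" using r(2) by (metis coeff_0 of_int_eq_0_iff)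
    show "poly r (inverse x) \<noteq> 0"
    proof
      assume "poly r (inverse x) = 0"
      then have "algebraic (inverse x)" using r(1) \<open>r \<noteq> 0\<close> by (intro algebraicI)
      then show False using n algebraic_inverse[of "inverse x"] by simp
    qed
  qed
  then obtain V M where VM: "valuation_ring V M" "of_nat p \<in> M" "inverse x \<in> M" by auto
  interpret valuation_ring V M by fact
  show False using inverse_notin_V[OF VM(3)] V[OF VM(1,2)] nz by auto
qed

section \<open>Valuation rings of residue characteristic \<open>p\<close>\<close>

locale residue_char = valuation_ring V M for V M :: "'a::field_char_0 set" +
  fixes p :: nat
  assumes prime_p: "Factorial_Ring.prime p" and p_M: "of_nat p \<in> M"
begin

lemma vunit_of_int:
  assumes "\<not> int p dvd k"
  shows "vunit (of_int k)"
proof -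
  have "coprime (int p) k" using assms prime_p by (simp add: prime_imp_coprime)
  then obtain a b where ab: "a * int p + b * k = 1" using coprime_iff_gcd_eq_1 bezout_int by metis
  have "of_int k \<notin> M"
  proof
    assume k: "of_int k \<in> M"
    have "of_int a * of_nat p + of_int b * (of_int k :: 'a) \<in> M"
      by (intro add_M mult_M of_int_V p_M k)
    moreover have "of_int a * of_nat p + of_int b * (of_int k :: 'a) = of_int (a * int p + b * k)" by simp
    ultimately show False using ab one_notin_M by simp
  qed
  then show ?thesis by (simp add: vunit_def of_int_V)
qed

lemma of_int_M_iff: "of_int k \<in> M \<longleftrightarrow> int p dvd k"
proof
  assume "int p dvd k"
  then obtain l where "k = l * int p" by (auto simp: dvd_def mult.commute)
  then show "of_int k \<in> M" using mult_M[OF of_int_V p_M, of l] by simp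
qed (use vunit_of_int in \<open>auto simp: vunit_def\<close>)

lemma vunit_of_nat: "\<not> p dvd k \<Longrightarrow> vunit (of_nat k)"
  using vunit_of_int[of "int k"] by simp

lemma vunit_power_int_pD:
  assumes "vunit (of_nat p powi k)"
  shows "k = 0"
proof (rule ccontr)
  assume "k \<noteq> 0"
  have "vunit (of_nat p ^ nat \<bar>k\<bar>)"
    using assms vunit_inverse[OF assms] by (cases "k \<ge> 0") (auto simp: power_int_def power_inverse)
  then show False using \<open>k \<noteq> 0\<close> power_M[OF p_M, of "nat \<bar>k\<bar>"] by (simp add: vunit_def)
qed

lemma of_int_vunit_power:
  assumes "k \<noteq> 0"
  shows "\<exists>a::nat. \<exists>u. vunit u \<and> of_int k = u * of_nat p ^ a"
proof -
  have "\<not> is_unit (int p)" using prime_gt_1_nat[OF prime_p] by auto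
  then obtain m where m: "k = int p ^ multiplicity (int p) k * m" "\<not> int p dvd m"
    using multiplicity_decompose'[of k "int p"] assms by metis
  have "of_int k = (of_int m :: 'a) * of_nat p ^ multiplicity (int p) k"
    by (subst m(1)) simp
  then show ?thesis using vunit_of_int[OF m(2)] by blast
qed

end

section \<open>Primes of a number field\<close>

locale complex_subfield =
  fixes K :: "complex set"
  assumes one_K: "1 \<in> K"
    and diff_K: "\<And>x y. x \<in> K \<Longrightarrow> y \<in> K \<Longrightarrow> x - y \<in> K"
    and mult_K: "\<And>x y. x \<in> K \<Longrightarrow> y \<in> K \<Longrightarrow> x * y \<in> K"
    and inverse_K: "\<And>x. x \<in> K \<Longrightarrow> inverse x \<in> K"
begin

definition \<O> :: "complex set" where "\<O> = {x \<in> K. algebraic_int x}"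

lemma zero_K: "0 \<in> K" using diff_K[OF one_K one_K] by simp
lemma uminus_K: "x \<in> K \<Longrightarrow> - x \<in> K" using diff_K[OF zero_K, of x] by simp
lemma add_K: "x \<in> K \<Longrightarrow> y \<in> K \<Longrightarrow> x + y \<in> K" using diff_K[of x "- y"] uminus_K[of y] by simp
lemma divide_K: "x \<in> K \<Longrightarrow> y \<in> K \<Longrightarrow> x / y \<in> K" by (simp add: divide_inverse mult_K inverse_K)
lemma power_K: "x \<in> K \<Longrightarrow> x ^ k \<in> K" by (induction k) (auto intro: one_K mult_K)
lemma power_int_K: "x \<in> K \<Longrightarrow> x powi k \<in> K" by (auto simp: power_int_def intro: power_K inverse_K)
lemma of_nat_K: "of_nat k \<in> K" by (induction k) (auto intro: zero_K one_K add_K)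
lemma of_int_K: "of_int k \<in> K" by (cases k rule: int_diff_cases) (auto intro: diff_K of_nat_K)
lemma sum_K: "(\<And>i. i \<in> S \<Longrightarrow> f i \<in> K) \<Longrightarrow> sum f S \<in> K"
  by (induction S rule: infinite_finite_induct) (auto intro: zero_K add_K)

lemma \<O>_add: "x \<in> \<O> \<Longrightarrow> y \<in> \<O> \<Longrightarrow> x + y \<in> \<O>"
  by (auto simp: \<O>_def intro: add_K algebraic_int_add)
lemma \<O>_diff: "x \<in> \<O> \<Longrightarrow> y \<in> \<O> \<Longrightarrow> x - y \<in> \<O>"
  by (auto simp: \<O>_def intro: diff_K algebraic_int_diff)
lemma \<O>_mult: "x \<in> \<O> \<Longrightarrow> y \<in> \<O> \<Longrightarrow> x * y \<in> \<O>"
  by (auto simp: \<O>_def intro: mult_K algebraic_int_mult)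
lemma \<O>_of_int: "of_int k \<in> \<O>"
  by (auto simp: \<O>_def intro: of_int_K int_imp_algebraic_int)
lemma \<O>_of_nat: "of_nat k \<in> \<O>" using \<O>_of_int[of "int k"] by simp
lemma \<O>_0: "0 \<in> \<O>" and \<O>_1: "1 \<in> \<O>" using \<O>_of_int[of 0] \<O>_of_int[of 1] by auto
lemma \<O>_power: "x \<in> \<O> \<Longrightarrow> x ^ k \<in> \<O>" by (induction k) (auto intro: \<O>_1 \<O>_mult)
lemma \<O>_uminus: "x \<in> \<O> \<Longrightarrow> - x \<in> \<O>" using \<O>_diff[OF \<O>_0, of x] by simp
lemma \<O>_sum: "(\<And>i. i \<in> S \<Longrightarrow> f i \<in> \<O>) \<Longrightarrow> sum f S \<in> \<O>"
  by (induction S rule: infinite_finite_induct) (auto intro: \<O>_0 \<O>_add)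

lemma poly_K: "x \<in> K \<Longrightarrow> (\<And>i. coeff q i \<in> \<int>) \<Longrightarrow> poly q x \<in> K"
  unfolding poly_altdef by (intro sum_K mult_K power_K) (metis Ints_cases of_int_K)

lemma poly_\<O>: "x \<in> \<O> \<Longrightarrow> (\<And>i. coeff q i \<in> \<int>) \<Longrightarrow> poly q x \<in> \<O>"
  unfolding poly_altdef by (intro \<O>_sum \<O>_mult \<O>_power) (metis Ints_cases \<O>_of_int)

end

text \<open>In characteristic 0 a uniform bound on degrees is equivalent to finite degree, by the
  primitive element theorem. The bound is the form that is needed: it makes \<open>fact n\<close> a
  common denominator for the valuations of elements of \<open>K\<close>.\<close>

locale number_field = complex_subfield K for K +
  fixes n :: nat
  assumes bounded_degree: "\<And>x. x \<in> K \<Longrightarrow>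
    \<exists>q::int poly. q \<noteq> 0 \<and> degree q \<le> n \<and> poly (map_poly of_int q) x = 0"

lemma poly_shift_Suc: "poly_shift m q = pCons (coeff q m) (poly_shift (Suc m) q)"
  by (intro poly_eqI) (auto simp: coeff_poly_shift coeff_pCons split: nat.split)

lemma poly_poly_shift_Suc:
  "poly (poly_shift m q) x = coeff q m + x * poly (poly_shift (Suc m) q) x"
  by (subst poly_shift_Suc) simp

lemma poly_eq_sum_poly_shift:
  "poly q (x :: 'a :: comm_ring_1) = (\<Sum>i<m. coeff q i * x ^ i) + x ^ m * poly (poly_shift m q) x"
proof (induction m)
  case (Suc m)
  then show ?case using poly_poly_shift_Suc[of m q x] by (simp add: algebra_simps)
qed simp

text \<open>The Horner partial sums of a root \<open>x\<close> are integral over every valuation ring: if \<open>x\<close> is not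
  in the ring, its inverse is, and each sum is computed from the previous one by dividing by \<open>x\<close>.\<close>

lemma algebraic_int_horner:
  fixes x :: "'a::field_char_0"
  assumes c: "\<And>i. coeff q i \<in> \<int>" and root: "poly q x = 0"
  shows "algebraic_int (poly (poly_shift m q) x)"
  unfolding algebraic_int_iff_valuation
proof (intro allI impI)
  fix V M :: "'a set" assume "valuation_ring V M"
  then interpret valuation_ring V M .
  show "poly (poly_shift m q) x \<in> V"
  proof (cases "x \<in> V")
    case True
    then show ?thesis by (intro poly_V) (auto simp: coeff_poly_shift intro: Ints_V c)
  next
    case False
    then have x: "inverse x \<in> V" "x \<noteq> 0" using notin_V zero_V M_V by auto
    show ?thesis
    proof (induction m)
      case 0
      show ?case using root zero_V by simp
    next
      case (Suc m)
      have "poly (poly_shift (Suc m) q) x = inverse x * (poly (poly_shift m q) x - coeff q m)"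
        using poly_poly_shift_Suc[of m q x] x(2) by (simp add: field_simps)
      then show ?case using Suc x(1) c by (auto intro: mult_V diff_V Ints_V)
    qed
  qed
qed

lemma primitive_int_poly:
  fixes x :: "'a::field_char_0"
  assumes "algebraic x"
  obtains q :: "int poly" where "content q = 1" "poly (map_poly of_int q) x = 0"
proof -
  obtain q :: "int poly" where q: "q \<noteq> 0" "poly (map_poly of_int q) x = 0"
    using algebraicE'[OF assms] by blast
  have "map_poly of_int q = smult (of_int (content q)) (map_poly of_int (primitive_part q) :: 'a poly)"
    by (subst (1) content_times_primitive_part[of q, symmetric], subst map_poly_smult) auto
  then have "poly (map_poly of_int (primitive_part q)) x = 0" using q by simp
  then show ?thesis using that[of "primitive_part q"] q(1) by simp
qed

text \<open>Writes \<open>x\<close> as a fraction of algebraic integers with denominator a unit at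
  \<open>V\<close>, both polynomials in \<open>x\<close> and so in every field containing it.
  Consecutive Horner sums differ by a factor \<open>x\<close> and a coefficient; if all lay in
  \<open>M\<close>, every coefficient would be divisible by \<open>p\<close>, against
  primitivity.\<close>

lemma (in residue_char) fraction_of_integral:
  assumes x: "x \<in> V" "algebraic x"
  obtains q r where "\<And>i. coeff q i \<in> \<int>" "\<And>i. coeff r i \<in> \<int>"
    "algebraic_int (poly q x)" "algebraic_int (poly r x)" "vunit (poly r x)" "x * poly r x = poly q x"
proof -
  obtain c :: "int poly" where c: "content c = 1" "poly (map_poly of_int c) x = 0"
    using primitive_int_poly[OF x(2)] by blast
  define C where "C = (map_poly of_int c :: 'a poly)"
  have C: "coeff C i = of_int (coeff c i)" for i by (simp add: C_def coeff_map_poly)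
  have root: "poly C x = 0" using c by (simp add: C_def)
  have int: "coeff (poly_shift m C) i \<in> \<int>" for m i by (simp add: coeff_poly_shift C)
  have alg: "algebraic_int (poly (poly_shift m C) x)" for m
    by (rule algebraic_int_horner) (auto simp: C root)
  have "\<exists>m. poly (poly_shift (Suc m) C) x \<notin> M"
  proof (rule ccontr)
    assume "\<nexists>m. poly (poly_shift (Suc m) C) x \<notin> M"
    then have M: "poly (poly_shift m C) x \<in> M" for m
      using root zero_M by (cases m) auto
    have "int p dvd coeff c m" for m
    proof -
      have "of_int (coeff c m) = poly (poly_shift m C) x - x * poly (poly_shift (Suc m) C) x"
        using poly_poly_shift_Suc[of m C x] C by (simp add: algebra_simps)
      then have "of_int (coeff c m) \<in> M" using M x(1) by (auto intro!: diff_M mult_M)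
      then show ?thesis by (simp add: of_int_M_iff)
    qed
    then have "[:int p:] dvd c" by (simp add: const_poly_dvd_iff)
    then show False using c(1) prime_gt_1_nat[OF prime_p] by (simp add: const_poly_dvd_iff_dvd_content)
  qed
  then obtain m where m: "poly (poly_shift (Suc m) C) x \<notin> M" by blast
  show ?thesis
  proof (rule that[of "poly_shift m C - [:coeff C m:]" "poly_shift (Suc m) C"])
    show "coeff (poly_shift m C - [:coeff C m:]) i \<in> \<int>" for i
      using int[of m i] by (auto simp: coeff_pCons C split: nat.split)
    show eq: "x * poly (poly_shift (Suc m) C) x = poly (poly_shift m C - [:coeff C m:]) x"
      using poly_poly_shift_Suc[of m C x] by simp
    show "algebraic_int (poly (poly_shift m C - [:coeff C m:]) x)"
      using alg[of m] by (auto intro!: algebraic_int_diff simp: C)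
    show "vunit (poly (poly_shift (Suc m) C) x)"
      using m algebraic_int_V[OF alg] by (simp add: vunit_def)
  qed (use int alg in auto)
qed

text \<open>Takes the place of the finiteness of residue fields. In a monic equation for
  \<open>x\<close>, the terms below the first coefficient prime to \<open>p\<close> are collected in
  \<open>of_nat p * t\<close>; what remains is a power of \<open>x\<close> times
  \<open>of_int k + x * z\<close>.\<close>

lemma (in complex_subfield) int_reduction:
  assumes x: "x \<in> \<O>" and p: "p > (1::nat)"
  obtains y z t k i where "y \<in> \<O>" "z \<in> \<O>" "t \<in> \<O>" "\<not> int p dvd k" "y = of_int k + x * z"
    "x ^ i * y = of_nat p * t"
proof -
  obtain c :: "int poly" where c: "poly (map_poly of_int c) x = 0" "lead_coeff c = 1"
    using x by (auto simp: \<O>_def algebraic_int_altdef_ipoly)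
  define C where "C = (map_poly of_int c :: complex poly)"
  have C: "coeff C i = of_int (coeff c i)" for i by (simp add: C_def coeff_map_poly)
  have "\<exists>i. \<not> int p dvd coeff c i"
    using c(2) p by (intro exI[of _ "degree c"]) auto
  then obtain i where i: "\<not> int p dvd coeff c i" "\<And>j. j < i \<Longrightarrow> int p dvd coeff c j"
    using exists_least_iff[of "\<lambda>i. \<not> int p dvd coeff c i"] by blast
  define t where "t = - (\<Sum>j<i. of_int (coeff c j div int p) * x ^ j)"
  show ?thesis
  proof (rule that[of "poly (poly_shift i C) x" "poly (poly_shift (Suc i) C) x" t "coeff c i" i])
    show "poly (poly_shift i C) x \<in> \<O>" "poly (poly_shift (Suc i) C) x \<in> \<O>"
      by (intro poly_\<O> x; simp add: coeff_poly_shift C)+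
    show "t \<in> \<O>" unfolding t_def
      by (intro \<O>_uminus \<O>_sum \<O>_mult \<O>_of_int \<O>_power x)
    show "poly (poly_shift i C) x = of_int (coeff c i) + x * poly (poly_shift (Suc i) C) x"
      using poly_poly_shift_Suc[of i C x] by (simp add: C)
    have "(\<Sum>j<i. coeff C j * x ^ j) = (\<Sum>j<i. of_nat p * (of_int (coeff c j div int p) * x ^ j))"
    proof (rule sum.cong)
      fix j assume "j \<in> {..<i}"
      then have "coeff c j = int p * (coeff c j div int p)" using i(2) by simp
      then have "coeff C j = of_nat p * of_int (coeff c j div int p)"
        unfolding C by (metis of_int_mult of_int_of_nat_eq)
      then show "coeff C j * x ^ j = of_nat p * (of_int (coeff c j div int p) * x ^ j)" by simp
    qed simp
    then have "(\<Sum>j<i. coeff C j * x ^ j) = - (of_nat p * t)"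
      by (simp add: t_def sum_distrib_left)
    then show "x ^ i * poly (poly_shift i C) x = of_nat p * t"
      using poly_eq_sum_poly_shift[of C x i] c(1) by (simp add: C_def)
  qed (use i in auto)
qed

locale number_field_valuation = number_field K n + residue_char V M p
  for K :: "complex set" and n :: nat and V M :: "complex set" and p
begin

lemma \<O>_V: "x \<in> \<O> \<Longrightarrow> x \<in> V"
  by (auto simp: \<O>_def intro: algebraic_int_V)

lemma algebraic_K: "x \<in> K \<Longrightarrow> algebraic x"
  using bounded_degree[of x] unfolding algebraic_def
  by (metis Ints_of_int coeff_map_poly map_poly_eq_0_iff of_int_0 of_int_eq_0_iff)

text \<open>The Newton polygon argument: in a vanishing sum the largest absolute value is attained
  by at least two terms. Their quotient is a unit and isolates a power of \<open>x\<close> as a unit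
  times a power of \<open>p\<close>.\<close>

lemma power_vunit_bounded:
  assumes x: "x \<in> K" "x \<noteq> 0"
  shows "\<exists>j>0. j \<le> n \<and> (\<exists>k. vunit (x ^ j / of_nat p powi k))"
proof -
  obtain q :: "int poly" where q: "q \<noteq> 0" "degree q \<le> n" "poly (map_poly of_int q) x = 0"
    using bounded_degree[OF x(1)] by blast
  have p0: "of_nat p \<noteq> (0::complex)" using prime_gt_0_nat[OF prime_p] by simp
  define I where "I = {i. i \<le> degree q \<and> coeff q i \<noteq> 0}"
  define t where "t i = of_int (coeff q i) * x ^ i" for i
  have I: "finite I" "degree q \<in> I" using q(1) by (auto simp: I_def)
  have nz: "t i \<noteq> 0" if "i \<in> I" for i using that x(2) by (auto simp: I_def t_def)
  have "poly (map_poly of_int q) x = (\<Sum>i\<le>degree q. t i)"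
    by (simp add: poly_altdef degree_map_poly coeff_map_poly t_def)
  also have "\<dots> = sum t I"
    by (rule sum.mono_neutral_right) (auto simp: I_def t_def)
  finally have 0: "sum t I = 0" using q(3) by simp
  obtain l where l: "l \<in> I" "\<And>i. i \<in> I \<Longrightarrow> t i / t l \<in> V"
    using exists_max[of "t ` I"] I nz by force
  have "\<exists>i\<in>I - {l}. vunit (t i / t l)"
  proof (rule ccontr)
    assume "\<not> ?thesis"
    then have "t i / t l \<in> M" if "i \<in> I - {l}" for i using l(2) that by (auto simp: vunit_def)
    then have "(\<Sum>i\<in>I - {l}. t i / t l) \<in> M" by (rule sum_M)
    moreover have "(\<Sum>i\<in>I - {l}. t i / t l) = (sum t I - t l) / t l"
      using I(1) l(1) by (simp add: sum_divide_distrib[symmetric] sum_diff1)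
    ultimately have "- 1 \<in> M" using 0 nz[OF l(1)] by simp
    then show False using uminus_M[of "-1"] one_notin_M by simp
  qed
  then obtain i where i: "i \<in> I" "i \<noteq> l" "vunit (t i / t l)" by auto
  have main: "\<exists>j>0. j \<le> n \<and> (\<exists>k. vunit (x ^ j / of_nat p powi k))"
    if i: "i \<in> I" "l \<in> I" "l < i" "vunit (t i / t l)" for i l
  proof -
    obtain a u where a: "vunit u" "of_int (coeff q i) = u * of_nat p ^ a"
      using of_int_vunit_power[of "coeff q i"] i(1) by (auto simp: I_def)
    obtain b v where b: "vunit v" "of_int (coeff q l) = v * of_nat p ^ b"
      using of_int_vunit_power[of "coeff q l"] i(2) by (auto simp: I_def)
    have uv: "u \<noteq> 0" "v \<noteq> 0" using a b vunit_nonzero by auto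
    have "x ^ (i - l) / of_nat p powi (int b - int a) = (t i / t l) * (v / u)"
      unfolding t_def a(2) b(2) using uv p0 x(2) i(3)
      by (simp add: power_int_diff power_diff field_simps)
    moreover have "vunit ((t i / t l) * (v / u))"
      by (intro vunit_mult vunit_divide i a b)
    ultimately show ?thesis
      using i q(2) by (intro exI[of _ "i - l"]) (auto simp: I_def intro!: exI[of _ "int b - int a"])
  qed
  show ?thesis
  proof (cases "l < i")
    case True
    then show ?thesis using main[of i l] i l by auto
  next
    case False
    have "vunit (t l / t i)" using vunit_inverse[OF i(3)] by simp
    then show ?thesis using main[of l i] False i l by auto
  qed
qed

lemma power_fact_vunit:
  assumes x: "x \<in> K" "x \<noteq> 0"
  shows "\<exists>k. vunit (x ^ fact n / of_nat p powi k)"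
proof -
  obtain j k where j: "j > 0" "j \<le> n" "vunit (x ^ j / of_nat p powi k)"
    using power_vunit_bounded[OF x] by blast
  then obtain m where m: "fact n = j * m" using dvd_fact[of j n] by (auto simp: dvd_def)
  have "(x ^ j / of_nat p powi k) ^ m = x ^ fact n / of_nat p powi (k * int m)"
    by (simp add: m power_divide power_mult power_int_mult)
  then show ?thesis using vunit_power[OF j(3), of m] by metis
qed

text \<open>The exponents of \<open>power_fact_vunit\<close> form a nonzero group of integers as
  \<open>x\<close> runs through the nonzero elements of \<open>K\<close>. Division by its positive
  generator normalizes the valuation.\<close>

lemma exists_discrete_valuation:
  obtains w :: "complex \<Rightarrow> int" and \<pi> where "\<pi> \<in> \<O>" "\<pi> \<noteq> 0" "w \<pi> = 1"
    "\<And>x y. x \<in> K \<Longrightarrow> y \<in> K \<Longrightarrow> x \<noteq> 0 \<Longrightarrow> y \<noteq> 0 \<Longrightarrow> w (x * y) = w x + w y"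
    "\<And>x. x \<in> K \<Longrightarrow> x \<noteq> 0 \<Longrightarrow> x \<in> V \<longleftrightarrow> w x \<ge> 0"
proof -
  have p0: "of_nat p \<noteq> (0::complex)" using prime_gt_0_nat[OF prime_p] by simp
  have pK: "of_nat p \<in> K" by (rule of_nat_K)
  define D :: nat where "D = fact n"
  have D: "D > 0" by (simp add: D_def)
  \<comment> \<open>This measures valuations in units in which \<open>p\<close> has the value
    \<open>D\<close>. The choice is unique, as \<open>u_eq\<close> shows, because no nonzero power
    of \<open>p\<close> is a unit.\<close>
  define u where "u x = (SOME k. vunit (x ^ D / of_nat p powi k))" for x :: complex
  have u: "vunit (x ^ D / of_nat p powi (u x))" if "x \<in> K" "x \<noteq> 0" for x
    unfolding u_def using someI_ex[OF power_fact_vunit[OF that]] by (simp add: D_def)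
  have u_eq: "u x = k" if "x \<in> K" "x \<noteq> 0" "vunit (x ^ D / of_nat p powi k)" for x k
  proof -
    have "vunit ((x ^ D / of_nat p powi k) / (x ^ D / of_nat p powi (u x)))"
      by (intro vunit_divide u that)
    moreover have "(x ^ D / of_nat p powi k) / (x ^ D / of_nat p powi (u x)) = of_nat p powi (u x - k)"
      using p0 that(2) by (simp add: power_int_diff)
    ultimately show ?thesis using vunit_power_int_pD[of "u x - k"] by simp
  qed
  have u_mult: "u (x * y) = u x + u y" if "x \<in> K" "y \<in> K" "x \<noteq> 0" "y \<noteq> 0" for x y
  proof (rule u_eq)
    have "(x * y) ^ D / of_nat p powi (u x + u y) = (x ^ D / of_nat p powi (u x)) * (y ^ D / of_nat p powi (u y))"
      using p0 by (simp add: power_int_add power_mult_distrib)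
    then show "vunit ((x * y) ^ D / of_nat p powi (u x + u y))"
      using vunit_mult[OF u[OF that(1,3)] u[OF that(2,4)]] by simp
  qed (use that in \<open>auto intro: mult_K\<close>)
  have u_p: "u (of_nat p) = int D"
    by (rule u_eq) (use p0 pK vunit_one in auto)
  have u_V: "x \<in> V \<longleftrightarrow> u x \<ge> 0" if x: "x \<in> K" "x \<noteq> 0" for x
  proof
    assume "u x \<ge> 0"
    then have "(x ^ D / of_nat p powi (u x)) * of_nat p ^ nat (u x) = x ^ D"
      using p0 by (simp add: power_int_def)
    moreover have "(x ^ D / of_nat p powi (u x)) * of_nat p ^ nat (u x) \<in> V"
      by (intro mult_V power_V of_nat_V vunit_V u x)
    ultimately show "x \<in> V" using power_in_V[of x D] D by simp
  next
    assume V: "x \<in> V"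
    show "u x \<ge> 0"
    proof (rule ccontr)
      assume neg: "\<not> u x \<ge> 0"
      then have "x ^ D * of_nat p ^ nat (- u x) = x ^ D / of_nat p powi (u x)"
        using p0 by (simp add: power_int_def field_simps)
      moreover have "x ^ D * of_nat p ^ nat (- u x) \<in> M"
        using neg by (intro mult_M power_V V power_M p_M) auto
      ultimately show False using u[OF x] by (simp add: vunit_def)
    qed
  qed
  have u_power: "u (x ^ k) = int k * u x" if "x \<in> K" "x \<noteq> 0" for x k
  proof (rule u_eq)
    have "(x ^ k) ^ D = (x ^ D) ^ k" by (simp add: mult.commute flip: power_mult)
    moreover have "of_nat p powi (int k * u x) = (of_nat p powi (u x) :: complex) ^ k"
      by (subst mult.commute) (simp add: power_int_mult)
    ultimately have "(x ^ k) ^ D / of_nat p powi (int k * u x) = (x ^ D / of_nat p powi (u x)) ^ k"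
      by (simp add: power_divide)
    then show "vunit ((x ^ k) ^ D / of_nat p powi (int k * u x))"
      using vunit_power[OF u[OF that]] by simp
  qed (use that power_K in auto)
  have u_inverse: "u (inverse x) = - u x" if "x \<in> K" "x \<noteq> 0" for x
  proof -
    have "u 1 = 0" by (rule u_eq) (use one_K vunit_one in auto)
    then show ?thesis using u_mult[of x "inverse x"] that inverse_K by simp
  qed
  have u_power_int: "u (x powi k) = k * u x" if "x \<in> K" "x \<noteq> 0" for x k
    using that u_power[of x "nat k"] u_power[of "inverse x" "nat (- k)"] u_inverse[of x] inverse_K
    by (auto simp: power_int_def)
  define Q where "Q k \<longleftrightarrow> k > 0 \<and> (\<exists>x\<in>K. x \<noteq> 0 \<and> u x = int k)" for k :: nat
  have "Q D" unfolding Q_def using D p0 pK u_p by blast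
  then obtain m where m: "Q m" "\<And>k. k < m \<Longrightarrow> \<not> Q k" using exists_least_iff[of Q] by blast
  then obtain a where a: "a \<in> K" "a \<noteq> 0" "u a = int m" and m0: "m > 0" by (auto simp: Q_def)
  have dvd: "int m dvd u x" if x: "x \<in> K" "x \<noteq> 0" for x
  proof -
    \<comment> \<open>Division with remainder in the value group: \<open>u y\<close> is the
      remainder of \<open>u x\<close> modulo \<open>m\<close>, and minimality of \<open>m\<close>
      forces it to be 0.\<close>
    define y where "y = x * a powi (- (u x div int m))"
    have y: "y \<in> K" "y \<noteq> 0" using x a by (auto simp: y_def intro: mult_K power_int_K)
    have "u y = u x mod int m"
      unfolding y_def using x a
      by (subst u_mult) (auto simp: u_power_int power_int_K minus_div_mult_eq_mod[symmetric])
    then have "\<not> (nat (u x mod int m) > 0)"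
      using m(2)[of "nat (u x mod int m)"] y m0 by (auto simp: Q_def nat_less_iff)
    moreover have "u x mod int m \<ge> 0" using m0 by simp
    ultimately have "u x mod int m = 0" by linarith
    then show ?thesis by (rule mod_0_imp_dvd)
  qed
  define w where "w x = u x div int m" for x
  have w_V: "x \<in> V \<longleftrightarrow> w x \<ge> 0" if "x \<in> K" "x \<noteq> 0" for x
    using u_V[OF that] m0 by (simp add: w_def pos_imp_zdiv_nonneg_iff)
  have w_mult: "w (x * y) = w x + w y" if "x \<in> K" "y \<in> K" "x \<noteq> 0" "y \<noteq> 0" for x y
    using u_mult[OF that] dvd[OF that(1,3)] by (simp add: w_def div_plus_div_distrib_dvd_left)
  have wa: "w a = 1" using a m0 by (simp add: w_def)
  \<comment> \<open>The uniformizer has to be an algebraic integer. As \<open>a\<close> is a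
    fraction whose denominator is a unit, the numerator has valuation 1 as well.\<close>
  obtain q r where qr: "\<And>i. coeff q i \<in> \<int>" "\<And>i. coeff r i \<in> \<int>"
    "algebraic_int (poly q a)" "algebraic_int (poly r a)" "vunit (poly r a)" "a * poly r a = poly q a"
    using fraction_of_integral[of a] w_V[OF a(1,2)] wa algebraic_K[OF a(1)] by (auto simp: less_imp_le)
  have rK: "poly r a \<in> K" and r0: "poly r a \<noteq> 0" using poly_K a qr vunit_nonzero by auto
  have w1: "w 1 = 0" using w_mult[of 1 1] one_K by simp
  have "w (poly r a) \<ge> 0" using w_V[OF rK r0] qr(5) vunit_V by simp
  moreover have "w (inverse (poly r a)) \<ge> 0"
    using w_V[OF inverse_K[OF rK]] r0 vunit_V[OF vunit_inverse[OF qr(5)]] by simp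
  moreover have "w (poly r a) + w (inverse (poly r a)) = 0"
    using w_mult[OF rK inverse_K[OF rK]] r0 w1 by simp
  ultimately have "w (poly q a) = 1"
    using w_mult[OF a(1) rK a(2) r0] wa by (simp add: qr(6))
  moreover have "poly q a \<in> \<O>" using qr a poly_K by (simp add: \<O>_def)
  moreover have "poly q a \<noteq> 0" using qr(6) a(2) r0 by auto
  ultimately show ?thesis using that[of "poly q a" w] w_mult w_V by blast
qed

end

section \<open>Powers of a prime ideal and the ramification index\<close>

lemma ring_of_integers_simps:
  "carrier (ring_of_integers K) = {x \<in> K. algebraic_int x}"
  "x \<otimes>\<^bsub>ring_of_integers K\<^esub> y = x * y"
  "x \<oplus>\<^bsub>ring_of_integers K\<^esub> y = x + y"
  "\<zero>\<^bsub>ring_of_integers K\<^esub> = 0"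
  "\<one>\<^bsub>ring_of_integers K\<^esub> = 1"
  by (simp_all add: ring_of_integers_def ring_of_type_algebra_def)

lemma ideals_set_pow:
  "I [^]\<^bsub>ideals_set R\<^esub> (0::nat) = carrier R"
  "I [^]\<^bsub>ideals_set R\<^esub> (Suc m) = ideal_prod R (I [^]\<^bsub>ideals_set R\<^esub> m) I"
  by (simp_all add: nat_pow_def ideals_set_def)

context number_field_valuation
begin

definition \<pp> :: "complex set" where "\<pp> = {x \<in> \<O>. x \<in> M}"

abbreviation R where "R \<equiv> ring_of_integers K"

lemma carrier_R: "carrier R = \<O>"
  by (simp add: ring_of_integers_simps \<O>_def)

text \<open>By \<open>int_reduction\<close> some \<open>of_int k + d * z\<close> with
  \<open>k\<close> prime to \<open>p\<close> lies in \<open>M\<close>. Bezout's identity for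
  \<open>p\<close> and \<open>k\<close> then makes an integer multiple of \<open>z\<close> an
  inverse of \<open>d\<close>.\<close>

lemma inverse_mod_\<pp>:
  assumes "d \<in> \<O>" "d \<notin> M"
  obtains d' where "d' \<in> \<O>" "1 - d' * d \<in> \<pp>"
proof -
  obtain y z t k i where y: "y \<in> \<O>" "z \<in> \<O>" "t \<in> \<O>" "\<not> int p dvd k"
    "y = of_int k + d * z" "d ^ i * y = of_nat p * t"
    using int_reduction[OF assms(1) prime_gt_1_nat[OF prime_p]] .
  have d: "vunit (d ^ i)" using assms \<O>_V by (intro vunit_power) (auto simp: vunit_def)
  have "of_nat p * t \<in> M" using p_M y(3) \<O>_V by (auto intro: mult_M')
  then have "inverse (d ^ i) * (d ^ i * y) \<in> M"
    unfolding y(6) using vunit_V[OF vunit_inverse[OF d]] by (rule mult_M[rotated])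
  then have yM: "y \<in> M" using vunit_nonzero[OF d] by (simp add: mult.assoc[symmetric])
  have "coprime (int p) k" using y(4) prime_p by (simp add: prime_imp_coprime)
  then obtain a b where ab: "a * int p + b * k = 1" using coprime_iff_gcd_eq_1 bezout_int by metis
  have "1 - (- of_int b * z) * d = of_int (a * int p + b * k) + of_int b * z * d"
    using ab by simp
  also have "\<dots> = of_int a * of_nat p + of_int b * y" using y(5) by (simp add: algebra_simps)
  also have "\<dots> \<in> M" by (intro add_M mult_M of_int_V p_M yM)
  finally have "1 - (- of_int b * z) * d \<in> M" .
  moreover have z: "- of_int b * z \<in> \<O>" by (intro \<O>_mult \<O>_uminus \<O>_of_int y)
  moreover from z have "1 - (- of_int b * z) * d \<in> \<O>" by (intro \<O>_diff \<O>_mult[OF _ assms(1)] \<O>_1)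
  ultimately show ?thesis
    using that[of "- of_int b * z"] by (simp only: \<pp>_def mem_Collect_eq)
qed

lemma mult_power_in_\<pp>_power:
  assumes "r \<in> \<O>" "q \<in> \<pp>"
  shows "r * q ^ k \<in> \<pp> [^]\<^bsub>ideals_set R\<^esub> k"
proof (induction k)
  case 0
  show ?case unfolding ideals_set_pow using assms by (simp add: carrier_R)
next
  case (Suc k)
  have "(r * q ^ k) \<otimes>\<^bsub>R\<^esub> q \<in> \<pp> [^]\<^bsub>ideals_set R\<^esub> Suc k"
    unfolding ideals_set_pow by (rule ideal_prod.prod[OF Suc assms(2)])
  then show ?case by (simp add: ring_of_integers_simps algebra_simps)
qed

lemma add_in_\<pp>_power:
  assumes "x \<in> \<pp> [^]\<^bsub>ideals_set R\<^esub> k" "y \<in> \<pp> [^]\<^bsub>ideals_set R\<^esub> k"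
  shows "x + y \<in> \<pp> [^]\<^bsub>ideals_set R\<^esub> (k::nat)"
proof (cases k)
  case 0
  show ?thesis using assms unfolding 0 ideals_set_pow by (simp add: carrier_R \<O>_add)
next
  case (Suc m)
  have "x \<oplus>\<^bsub>R\<^esub> y \<in> \<pp> [^]\<^bsub>ideals_set R\<^esub> k"
    using assms unfolding Suc ideals_set_pow by (rule ideal_prod.sum)
  then show ?thesis by (simp add: ring_of_integers_simps)
qed

text \<open>Turns ideal powers into a condition on the valuation and so replaces the factorization
  theory of Dedekind domains. The direction from right to left is the substantial one, since a
  denominator that is a unit of \<open>V\<close> need not be a unit of \<open>\<O>\<close>.\<close>

lemma in_\<pp>_power_iff:
  assumes \<pi>: "\<pi> \<in> \<O>" "\<pi> \<noteq> 0" "\<pi> \<in> M" and unif: "\<And>x. x \<in> \<pp> \<Longrightarrow> x / \<pi> \<in> V"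
  shows "x \<in> \<pp> [^]\<^bsub>ideals_set R\<^esub> k \<longleftrightarrow> x \<in> \<O> \<and> x / \<pi> ^ k \<in> V"
proof
  show "x \<in> \<O> \<and> x / \<pi> ^ k \<in> V" if "x \<in> \<pp> [^]\<^bsub>ideals_set R\<^esub> k"
    using that
  proof (induction k arbitrary: x)
    case 0
    then show ?case using \<O>_V unfolding ideals_set_pow by (auto simp: carrier_R)
  next
    case (Suc k)
    from Suc.prems have "x \<in> ideal_prod R (\<pp> [^]\<^bsub>ideals_set R\<^esub> k) \<pp>"
      unfolding ideals_set_pow .
    then show ?case
    proof (induction rule: ideal_prod.induct)
      case (prod i j)
      have "i / \<pi> ^ k * (j / \<pi>) \<in> V" using Suc.IH[OF prod(1)] unif[OF prod(2)] by (intro mult_V) auto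
      moreover have "i / \<pi> ^ k * (j / \<pi>) = i * j / \<pi> ^ Suc k" by (simp add: mult.commute)
      ultimately have "i * j / \<pi> ^ Suc k \<in> V" by (simp only:)
      moreover have "i * j \<in> \<O>" using Suc.IH[OF prod(1)] prod(2) by (auto simp: \<pp>_def intro: \<O>_mult)
      ultimately show ?case by (simp add: ring_of_integers_simps)
    next
      case (sum s1 s2)
      then show ?case by (auto simp: ring_of_integers_simps add_divide_distrib intro: \<O>_add add_V)
    qed
  qed
next
  assume x: "x \<in> \<O> \<and> x / \<pi> ^ k \<in> V"
  define u where "u = x / \<pi> ^ k"
  have uK: "u \<in> K" using x \<pi> by (auto simp: u_def \<O>_def intro: divide_K power_K)
  obtain q r where qr: "\<And>i. coeff q i \<in> \<int>" "\<And>i. coeff r i \<in> \<int>"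
    "algebraic_int (poly q u)" "algebraic_int (poly r u)" "vunit (poly r u)" "u * poly r u = poly q u"
    using fraction_of_integral[of u] x algebraic_K[OF uK] unfolding u_def by blast
  define c d where "c = poly q u" and "d = poly r u"
  have cd: "c \<in> \<O>" "d \<in> \<O>" "d \<notin> M" using qr uK poly_K by (auto simp: c_def d_def \<O>_def vunit_def)
  have dx: "d * x = c * \<pi> ^ k"
    using qr(6) \<pi>(2) by (simp add: c_def d_def u_def field_simps)
  obtain d' where d': "d' \<in> \<O>" "1 - d' * d \<in> \<pp>" using inverse_mod_\<pp>[OF cd(2,3)] .
  \<comment> \<open>The denominator \<open>d\<close> is removed by splitting \<open>x\<close> into
    \<open>x * e ^ k\<close> and \<open>x * (1 - e ^ k)\<close>. The first part is in the ideal
    power because \<open>e\<close> is in \<open>\<pp>\<close>; in the second,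
    \<open>1 - e ^ k\<close> is divisible by \<open>d' * d\<close>, and
    \<open>d * x = c * \<pi> ^ k\<close>.\<close>
  define e where "e = 1 - d' * d"
  have e: "e \<in> \<pp>" "e \<in> \<O>" using d' by (auto simp: e_def \<pp>_def)
  have S: "1 - e ^ k = (1 - e) * (\<Sum>i<k. e ^ i)" by (rule one_diff_power_eq)
  have "x - x * e ^ k = x * (1 - e ^ k)" by (simp add: algebra_simps)
  also have "\<dots> = x * (d' * d * (\<Sum>i<k. e ^ i))" unfolding S by (simp add: e_def)
  finally have "x - x * e ^ k = (\<Sum>i<k. e ^ i) * (d' * (d * x))" by (simp add: mult_ac)
  then have "x = x * e ^ k + ((\<Sum>i<k. e ^ i) * (d' * (d * x)))"
    by (simp add: algebra_simps)
  then have eq: "x = x * e ^ k + ((\<Sum>i<k. e ^ i) * d' * c) * \<pi> ^ k"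
    unfolding dx by (simp add: mult.assoc)
  have "\<pi> \<in> \<pp>" using \<pi> by (simp add: \<pp>_def)
  moreover have "(\<Sum>i<k. e ^ i) * d' * c \<in> \<O>"
    by (intro \<O>_mult \<O>_sum \<O>_power e d' cd)
  ultimately show "x \<in> \<pp> [^]\<^bsub>ideals_set R\<^esub> k"
    using x e by (subst eq) (intro add_in_\<pp>_power mult_power_in_\<pp>_power, auto)
qed

text \<open>The unit condition says that \<open>a\<close> times the valuation of \<open>x\<close> is
  \<open>m\<close> times that of \<open>p\<close>. For the normalized valuation of \<open>K\<close>
  both are integers, and that of \<open>p\<close> is the ramification index.\<close>

theorem dvd_ramification_index:
  assumes x: "x \<in> K" "x \<noteq> 0" "vunit (x ^ a / of_nat p powi m)"
  shows "int a dvd m * int (ramification_index p K \<pp>)"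
proof -
  obtain w \<pi> where \<pi>: "\<pi> \<in> \<O>" "\<pi> \<noteq> 0" "w \<pi> = (1::int)"
    and w_mult: "\<And>x y. x \<in> K \<Longrightarrow> y \<in> K \<Longrightarrow> x \<noteq> 0 \<Longrightarrow> y \<noteq> 0 \<Longrightarrow> w (x * y) = w x + w y"
    and w_V: "\<And>x. x \<in> K \<Longrightarrow> x \<noteq> 0 \<Longrightarrow> x \<in> V \<longleftrightarrow> w x \<ge> 0"
    by (rule exists_discrete_valuation) (rule that)
  have p0: "of_nat p \<noteq> (0::complex)" using prime_gt_0_nat[OF prime_p] by simp
  have pK: "of_nat p \<in> K" by (rule of_nat_K)
  have \<pi>K: "\<pi> \<in> K" using \<pi> by (simp add: \<O>_def)
  have w1: "w 1 = 0" using w_mult[of 1 1] one_K by simp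
  have w_inverse: "w (inverse y) = - w y" if "y \<in> K" "y \<noteq> 0" for y
    using w_mult[of y "inverse y"] that inverse_K w1 by simp
  have w_divide: "w (y / z) = w y - w z" if "y \<in> K" "y \<noteq> 0" "z \<in> K" "z \<noteq> 0" for y z
    using w_mult[of y "inverse z"] that inverse_K w_inverse by (simp add: divide_inverse)
  have w_power: "w (y ^ k) = int k * w y" if "y \<in> K" "y \<noteq> 0" for y k
    by (induction k) (use that w1 w_mult power_K in \<open>auto simp: algebra_simps\<close>)
  have w_power_int: "w (y powi k) = k * w y" if "y \<in> K" "y \<noteq> 0" for y k
    using that w_power[of y "nat k"] w_power[of "inverse y" "nat (- k)"] w_inverse[of y] inverse_K
    by (auto simp: power_int_def)
  have w_M: "y \<in> M \<longleftrightarrow> w y > 0" if "y \<in> K" "y \<noteq> 0" for y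
  proof -
    have "vunit y \<longleftrightarrow> w y = 0"
      unfolding vunit_iff using w_V[OF that] w_V[of "inverse y"] w_inverse[OF that] that inverse_K by auto
    then show ?thesis using w_V[OF that] M_V[of y] by (auto simp: vunit_def)
  qed
  have unif: "y / \<pi> \<in> V" if "y \<in> \<pp>" for y
  proof (cases "y = 0")
    case False
    have yK: "y \<in> K" using that by (simp add: \<pp>_def \<O>_def)
    then have "w y > 0" using that w_M False by (simp add: \<pp>_def)
    then show ?thesis using w_V[of "y / \<pi>"] w_divide[OF yK False \<pi>K \<pi>(2)] False \<pi> yK \<pi>K
      by (simp add: divide_K)
  qed (simp add: zero_V)
  define N where "N = nat (w (of_nat p))"
  have wp: "w (of_nat p) > 0" using w_M[OF pK p0] p_M by simp
  have iff: "PIdl\<^bsub>R\<^esub> (of_nat p) \<subseteq> \<pp> [^]\<^bsub>ideals_set R\<^esub> k \<longleftrightarrow> k \<le> N" for k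
  proof -
    have pow: "y \<in> \<pp> [^]\<^bsub>ideals_set R\<^esub> k \<longleftrightarrow> y \<in> \<O> \<and> y / \<pi> ^ k \<in> V" for y
      by (rule in_\<pp>_power_iff) (use \<pi> unif w_M[OF \<pi>K \<pi>(2)] in auto)
    have "of_nat p / \<pi> ^ k \<in> V \<longleftrightarrow> k \<le> N"
      using w_V[of "of_nat p / \<pi> ^ k"] w_divide[OF pK p0, of "\<pi> ^ k"] w_power[OF \<pi>K \<pi>(2)] \<pi> wp p0 \<pi>K pK
      by (auto simp: N_def divide_K power_K)
    moreover have "PIdl\<^bsub>R\<^esub> (of_nat p) \<subseteq> \<pp> [^]\<^bsub>ideals_set R\<^esub> k \<longleftrightarrow> of_nat p / \<pi> ^ k \<in> V"
    proof
      assume "PIdl\<^bsub>R\<^esub> (of_nat p) \<subseteq> \<pp> [^]\<^bsub>ideals_set R\<^esub> k"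
      moreover have "of_nat p \<in> PIdl\<^bsub>R\<^esub> (of_nat p)"
        unfolding cgenideal_def carrier_R using \<O>_1 by (force simp: ring_of_integers_simps)
      ultimately show "of_nat p / \<pi> ^ k \<in> V" using pow by blast
    next
      assume "of_nat p / \<pi> ^ k \<in> V"
      then have V: "y * of_nat p / \<pi> ^ k \<in> V" if "y \<in> \<O>" for y
        using mult_V[OF \<O>_V[OF that] \<open>of_nat p / \<pi> ^ k \<in> V\<close>] by simp
      then show "PIdl\<^bsub>R\<^esub> (of_nat p) \<subseteq> \<pp> [^]\<^bsub>ideals_set R\<^esub> k"
        unfolding cgenideal_def carrier_R using \<O>_mult[OF _ \<O>_of_nat[of p]]
        by (auto simp: pow ring_of_integers_simps(2-))
    qed
    ultimately show ?thesis by simp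
  qed
  have "ramification_index p K \<pp> = N"
    unfolding ramification_index_def by (rule Greatest_equality) (auto simp: iff)
  moreover have "int a * w x = m * w (of_nat p)"
  proof -
    define y where "y = x ^ a / of_nat p powi m"
    have y: "y \<in> K" "y \<noteq> 0" using x p0 pK by (auto simp: y_def intro: divide_K power_K power_int_K)
    have "y \<in> V" "inverse y \<in> V" using x(3) by (auto simp: y_def vunit_iff)
    then have "w y = 0" using w_V[OF y] w_V[of "inverse y"] w_inverse[OF y] y inverse_K by simp
    then show ?thesis
      unfolding y_def using x p0 pK by (subst (asm) w_divide) (auto simp: power_K power_int_K w_power w_power_int)
  qed
  ultimately show ?thesis using wp by (metis N_def dvd_triv_left int_nat_eq less_imp_le)
qed

end

text \<open>\<open>exists_valuation_ring\<close> applies to the ideal \<open>P\<close> itself, so a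
  valuation ring of the complex numbers dominates it directly. That \<open>M\<close> contains no
  further integers of \<open>K\<close> reflects the maximality of nonzero primes.\<close>

lemma (in number_field) prime_above_valuation:
  assumes p: "Factorial_Ring.prime p" and P: "prime_above p K P"
  obtains V M where "number_field_valuation K n V M p" "P = number_field_valuation.\<pp> K M"
proof -
  have pr: "primeideal P (ring_of_integers K)" and pP: "of_nat p \<in> P" using P by (auto simp: prime_above_def)
  interpret P: primeideal P "ring_of_integers K" by fact
  have carr: "carrier (ring_of_integers K) = \<O>" by (simp add: ring_of_integers_simps \<O>_def)
  note simps = ring_of_integers_simps(2-)
  have sub: "P \<subseteq> \<O>" using P.a_subset carr by simp
  have mult: "x * y \<in> P" if "x \<in> \<O>" "y \<in> P" for x y
    using P.I_l_closed[of y x] that by (simp add: carr simps)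
  have diff: "x - y \<in> P" if "x \<in> P" "y \<in> P" for x y
    using additive_subgroup.a_closed[OF ideal.axioms(1)[OF P.ideal_axioms], of x "- 1 * y"]
      mult[of "-1" y] that \<O>_uminus[OF \<O>_1] by (simp add: simps)
  have prime: "x \<in> P \<or> y \<in> P" if "x \<in> \<O>" "y \<in> \<O>" "x * y \<in> P" for x y
    using P.I_prime[of x y] that by (simp add: carr simps)
  have one: "1 \<notin> P"
  proof
    assume "1 \<in> P"
    then have "\<O> \<subseteq> P" using mult[of _ 1] by auto
    then show False using sub P.I_notcarr carr by auto
  qed
  have "\<exists>V M. valuation_ring V M \<and> P \<subseteq> M"
  proof (rule exists_valuation_ring)
    show "0 \<in> P" using diff[OF pP pP] by simp
  qed (use diff mult sub one in auto)
  then obtain V M where V: "valuation_ring V M" and PM: "P \<subseteq> M" by blast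
  interpret valuation_ring V M by fact
  interpret number_field_valuation K n V M p
    by unfold_locales (use p PM pP in auto)
  have "x \<in> P" if x: "x \<in> \<pp>" for x
  proof (rule ccontr)
    assume nP: "x \<notin> P"
    have xO: "x \<in> \<O>" and xM: "x \<in> M" using x by (auto simp: \<pp>_def)
    \<comment> \<open>If \<open>x\<close> were outside \<open>P\<close>, primality would put
      \<open>y\<close> into \<open>P\<close>, hence into \<open>M\<close>. As \<open>x\<close> is in
      \<open>M\<close> too, the integer \<open>k\<close> would be in \<open>M\<close> although
      \<open>p\<close> does not divide it.\<close>
    obtain y z t k i where y: "y \<in> \<O>" "z \<in> \<O>" "t \<in> \<O>" "\<not> int p dvd k"
      "y = of_int k + x * z" "x ^ i * y = of_nat p * t"
      using int_reduction[OF xO prime_gt_1_nat[OF p]] .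
    have pow: "x ^ j \<notin> P" for j
      by (induction j) (use one nP prime xO \<O>_power in auto)
    have "x ^ i * y \<in> P" unfolding y(6) using mult[OF y(3) pP] by (simp add: mult.commute)
    then have "y \<in> P" using prime[of "x ^ i" y] pow y(1) xO \<O>_power by auto
    then have "y - x * z \<in> M" using PM xM y(2) \<O>_V by (intro diff_M mult_M') auto
    then show False using y(4,5) of_int_M_iff[of k] by simp
  qed
  then have "P = \<pp>" using PM sub by (auto simp: \<pp>_def)
  then show ?thesis using that[of V M] number_field_valuation_axioms by blast
qed

section \<open>Fields generated by algebraic numbers\<close>

lemma ring_of_type_algebra_simps:
  "carrier (ring_of_type_algebra :: 'a::field ring) = UNIV"
  "x \<otimes>\<^bsub>ring_of_type_algebra\<^esub> y = x * (y :: 'a::field)"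
  "x \<oplus>\<^bsub>ring_of_type_algebra\<^esub> y = x + (y :: 'a::field)"
  "\<zero>\<^bsub>ring_of_type_algebra\<^esub> = (0 :: 'a::field)"
  "\<one>\<^bsub>ring_of_type_algebra\<^esub> = (1 :: 'a::field)"
  by (simp_all add: ring_of_type_algebra_def)

lemma ring_of_type_algebra_a_inv: "\<ominus>\<^bsub>ring_of_type_algebra\<^esub> x = - (x :: 'a::field)"
proof -
  interpret R: field "ring_of_type_algebra :: 'a ring" by (rule field_from_type_algebra)
  show ?thesis by (rule R.minus_equality) (simp_all add: ring_of_type_algebra_simps)
qed

lemma ring_of_type_algebra_m_inv:
  assumes "x \<noteq> 0"
  shows "inv\<^bsub>ring_of_type_algebra\<^esub> x = inverse (x :: 'a::field)"
proof -
  interpret R: field "ring_of_type_algebra :: 'a ring" by (rule field_from_type_algebra)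
  show ?thesis by (rule R.comm_inv_char) (use assms in \<open>simp_all add: ring_of_type_algebra_simps\<close>)
qed

lemma complex_subfield_generate_field: "complex_subfield (generate_field ring_of_type_algebra H)"
proof
  let ?F = "generate_field ring_of_type_algebra H"
  show "1 \<in> ?F" using generate_field.one[of ring_of_type_algebra H]
    by (simp add: ring_of_type_algebra_simps)
  have uminus: "- x \<in> ?F" if "x \<in> ?F" for x
    using generate_field.a_inv[OF that] by (simp add: ring_of_type_algebra_a_inv)
  have add: "x + y \<in> ?F" if "x \<in> ?F" "y \<in> ?F" for x y
    using generate_field.eng_add[OF that] by (simp add: ring_of_type_algebra_simps)
  show "x - y \<in> ?F" if "x \<in> ?F" "y \<in> ?F" for x y using add[OF that(1) uminus[OF that(2)]] by simp
  show "x * y \<in> ?F" if "x \<in> ?F" "y \<in> ?F" for x y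
    using generate_field.eng_mult[OF that] by (simp add: ring_of_type_algebra_simps)
  show "inverse x \<in> ?F" if "x \<in> ?F" for x
    using generate_field.m_inv[OF that] that
    by (cases "x = 0") (simp_all add: ring_of_type_algebra_simps ring_of_type_algebra_m_inv)
qed

lemma generate_field_subset:
  fixes H :: "'a::field set"
  assumes "1 \<in> F" "H \<subseteq> F" "\<And>x y. x \<in> F \<Longrightarrow> y \<in> F \<Longrightarrow> x - y \<in> F"
    "\<And>x y. x \<in> F \<Longrightarrow> y \<in> F \<Longrightarrow> x * y \<in> F" "\<And>x. x \<in> F \<Longrightarrow> x \<noteq> 0 \<Longrightarrow> inverse x \<in> F"
  shows "generate_field ring_of_type_algebra H \<subseteq> F"
proof
  have uminus: "- x \<in> F" if "x \<in> F" for x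
    using assms(3)[OF assms(3)[OF assms(1) assms(1)] that] by simp
  have add: "x + y \<in> F" if "x \<in> F" "y \<in> F" for x y
    using assms(3)[OF that(1) uminus[OF that(2)]] by simp
  fix x assume "x \<in> generate_field ring_of_type_algebra H"
  then show "x \<in> F"
    by (induction rule: generate_field.induct)
      (use assms uminus add in \<open>auto simp: ring_of_type_algebra_simps ring_of_type_algebra_a_inv ring_of_type_algebra_m_inv\<close>)
qed

lemma int_poly_of_relation:
  fixes x :: "'a::field_char_0" and g :: "nat \<Rightarrow> rat"
  assumes "i \<le> N" "g i \<noteq> 0" "(\<Sum>i\<le>N. of_rat (g i) * x ^ i) = 0"
  shows "\<exists>q::int poly. q \<noteq> 0 \<and> degree q \<le> N \<and> poly (map_poly of_int q) x = 0"
proof -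
  define d where "d i = snd (quotient_of (g i))" for i
  have d: "d i > 0" for i by (simp add: d_def quotient_of_denom_pos')
  define D where "D = (\<Prod>i\<le>N. d i)"
  define h where "h i = fst (quotient_of (g i)) * (D div d i)" for i
  have "D > 0" unfolding D_def by (rule prod_pos) (use d in auto)
  then have D0: "D \<noteq> 0" by simp
  have h: "of_int (h i) = of_int D * (of_rat (g i) :: 'a)" if "i \<le> N" for i
  proof -
    have "d i dvd D" using that by (auto simp: D_def intro: dvd_prodI)
    then have D: "D = d i * (D div d i)" by simp
    have "g i = of_int (fst (quotient_of (g i))) / of_int (d i)"
      by (rule quotient_of_div) (simp add: d_def)
    then have "(of_rat (g i) :: 'a) = of_int (fst (quotient_of (g i))) / of_int (d i)"
      by (metis of_rat_divide of_rat_of_int_eq)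
    then have "of_int D * (of_rat (g i) :: 'a) = of_int (D div d i) * of_int (fst (quotient_of (g i)))"
      using d[of i] by (subst D) simp
    then show ?thesis by (simp add: h_def)
  qed
  define q where "q = (\<Sum>i\<le>N. monom (h i) i)"
  have coeff: "coeff q j = (if j \<le> N then h j else 0)" for j
    by (simp add: q_def coeff_sum)
  have "degree q \<le> N" by (rule degree_le) (simp add: coeff)
  moreover have "h i \<noteq> 0"
    using h[OF assms(1)] D0 assms(2) by (metis mult_eq_0_iff of_int_eq_0_iff of_rat_eq_0_iff)
  then have "q \<noteq> 0" using coeff[of i] assms(1) by auto
  moreover have "poly (map_poly of_int q) x = (\<Sum>i\<le>N. of_int (coeff q i) * x ^ i)"
    using \<open>degree q \<le> N\<close>
    by (simp add: poly_altdef degree_map_poly coeff_map_poly, intro sum.mono_neutral_left)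
      (auto simp: coeff_eq_0)
  then have "poly (map_poly of_int q) x = of_int D * (\<Sum>i\<le>N. of_rat (g i) * x ^ i)"
    by (simp add: coeff h sum_distrib_left mult.assoc)
  ultimately show ?thesis using assms(3) by auto
qed

interpretation rat_vs: vector_space "\<lambda>(q::rat) x. of_rat q * (x::complex)"
  by unfold_locales (auto simp: algebra_simps of_rat_add of_rat_mult)

lemma algebraic_of_int_poly_root:
  assumes "q \<noteq> 0" "poly (map_poly of_int q) (x :: 'a :: field_char_0) = 0"
  shows "algebraic x"
  by (rule algebraicI[of "map_poly of_int q"]) (use assms in \<open>auto simp: coeff_map_poly map_poly_eq_0_iff\<close>)

lemma algebraic_power_reduction:
  assumes "algebraic (x::complex)"
  shows "\<exists>a f. a > 0 \<and> x ^ a = (\<Sum>i<a. of_rat (f i) * x ^ i)"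
proof -
  obtain q :: "int poly" where q: "q \<noteq> 0" "poly (map_poly of_int q) x = 0"
    using algebraicE'[OF assms] by blast
  define n where "n = degree q"
  have "poly (map_poly of_int q) x = (\<Sum>i\<le>n. of_int (coeff q i) * x ^ i)"
    by (simp add: poly_altdef degree_map_poly coeff_map_poly n_def)
  then have eq: "(\<Sum>i<n. of_int (coeff q i) * x ^ i) + of_int (coeff q n) * x ^ n = 0"
    using q(2) by (simp flip: lessThan_Suc_atMost)
  have nz: "coeff q n \<noteq> 0" using q(1) by (simp add: n_def)
  have "x ^ n = (\<Sum>i<n. of_rat (of_int (- coeff q i) / of_int (coeff q n)) * x ^ i)"
  proof -
    have "of_int (coeff q n) * x ^ n = - (\<Sum>i<n. of_int (coeff q i) * x ^ i)"
      using eq by (simp add: eq_neg_iff_add_eq_0 add.commute)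
    then have "x ^ n = (\<Sum>i<n. - (of_int (coeff q i) * x ^ i) / of_int (coeff q n))"
      using nz by (simp add: field_simps sum_negf flip: sum_divide_distrib)
    then show ?thesis by (simp add: of_rat_divide of_rat_minus)
  qed
  moreover have "n > 0"
  proof (rule ccontr)
    assume "\<not> n > 0"
    then show False using eq nz by simp
  qed
  ultimately show ?thesis
    by (intro exI[of _ n] exI[of _ "\<lambda>i. of_int (- coeff q i) / of_int (coeff q n)"] conjI)
qed

text \<open>The three generators map the span \<open>L\<close> of the monomials to itself. So the
  stabilizer \<open>A\<close> of \<open>L\<close> is a ring containing them; it lies in
  \<open>L\<close> because 1 does, which bounds degrees by \<open>card T\<close>, and algebraicity
  provides inverses.\<close>

theorem number_field_generate_field:
  fixes \<alpha> \<beta> \<gamma> :: complex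
  assumes "algebraic \<alpha>" "algebraic \<beta>" "algebraic \<gamma>"
  shows "\<exists>n. number_field (generate_field ring_of_type_algebra {\<alpha>, \<beta>, \<gamma>}) n"
proof -
  obtain a f where a: "a > 0" "\<alpha> ^ a = (\<Sum>i<a. of_rat (f i) * \<alpha> ^ i)"
    using algebraic_power_reduction[OF assms(1)] by blast
  obtain b g where b: "b > 0" "\<beta> ^ b = (\<Sum>i<b. of_rat (g i) * \<beta> ^ i)"
    using algebraic_power_reduction[OF assms(2)] by blast
  obtain c h where c: "c > 0" "\<gamma> ^ c = (\<Sum>i<c. of_rat (h i) * \<gamma> ^ i)"
    using algebraic_power_reduction[OF assms(3)] by blast
  define T where "T = (\<lambda>(i, j, k). \<alpha> ^ i * \<beta> ^ j * \<gamma> ^ k) ` ({..<a} \<times> {..<b} \<times> {..<c})"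
  define L where "L = rat_vs.span T"
  have T: "finite T" by (simp add: T_def)
  have base: "\<alpha> ^ i * \<beta> ^ j * \<gamma> ^ k \<in> L" if "i < a" "j < b" "k < c" for i j k
    unfolding L_def by (rule rat_vs.span_base) (use that in \<open>force simp: T_def\<close>)
  have comb: "(\<Sum>i\<in>S. of_rat (u i) * v i) \<in> L" if "\<And>i. i \<in> S \<Longrightarrow> v i \<in> L" for S :: "nat set" and u v
    using that unfolding L_def by (intro rat_vs.span_sum rat_vs.span_scale)
  have span: "x * y \<in> L" if "\<And>t. t \<in> T \<Longrightarrow> x * t \<in> L" "y \<in> L" for x y
  proof -
    have "x * (of_rat r * y) \<in> L" if "x * y \<in> L" for r y
      using rat_vs.span_scale[of "x * y" T r] that by (simp add: L_def mult.left_commute)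
    then have "rat_vs.subspace {y. x * y \<in> L}"
      unfolding rat_vs.subspace_def by (auto simp: L_def distrib_left rat_vs.span_zero intro: rat_vs.span_add)
    then have "L \<subseteq> {y. x * y \<in> L}"
      unfolding L_def by (intro rat_vs.span_minimal) (use that in \<open>auto simp: L_def\<close>)
    then show ?thesis using that(2) by auto
  qed
  define A where "A = {x. \<forall>y\<in>L. x * y \<in> L}"
  have \<alpha>: "\<alpha> \<in> A"
    unfolding A_def
  proof (rule CollectI, rule ballI, rule span)
    fix t assume "t \<in> T"
    then obtain i j k where t: "t = \<alpha> ^ i * \<beta> ^ j * \<gamma> ^ k" "i < a" "j < b" "k < c" by (auto simp: T_def)
    show "\<alpha> * t \<in> L"
    proof (cases "Suc i < a")
      case True
      then show ?thesis using base[OF True t(3,4)] by (simp add: t(1) mult.assoc)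
    next
      case False
      then have "a = Suc i" using t(2) by simp
      then have "\<alpha> * t = \<alpha> ^ a * (\<beta> ^ j * \<gamma> ^ k)" by (simp add: t(1) mult.assoc)
      also have "\<dots> = (\<Sum>i<a. of_rat (f i) * (\<alpha> ^ i * \<beta> ^ j * \<gamma> ^ k))"
        unfolding a(2) by (simp add: sum_distrib_right mult.assoc)
      also have "\<dots> \<in> L" by (rule comb) (use base t in auto)
      finally show ?thesis .
    qed
  qed auto
  have \<beta>: "\<beta> \<in> A"
    unfolding A_def
  proof (rule CollectI, rule ballI, rule span)
    fix t assume "t \<in> T"
    then obtain i j k where t: "t = \<alpha> ^ i * \<beta> ^ j * \<gamma> ^ k" "i < a" "j < b" "k < c" by (auto simp: T_def)
    show "\<beta> * t \<in> L"
    proof (cases "Suc j < b")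
      case True
      then show ?thesis using base[OF t(2) True t(4)] by (simp add: t(1) mult_ac)
    next
      case False
      then have "b = Suc j" using t(3) by simp
      then have "\<beta> * t = \<beta> ^ b * (\<alpha> ^ i * \<gamma> ^ k)" by (simp add: t(1) mult_ac)
      also have "\<dots> = (\<Sum>j<b. of_rat (g j) * (\<alpha> ^ i * \<beta> ^ j * \<gamma> ^ k))"
        unfolding b(2) by (simp add: sum_distrib_right sum_distrib_left mult_ac)
      also have "\<dots> \<in> L" by (rule comb) (use base t in auto)
      finally show ?thesis .
    qed
  qed auto
  have \<gamma>: "\<gamma> \<in> A"
    unfolding A_def
  proof (rule CollectI, rule ballI, rule span)
    fix t assume "t \<in> T"
    then obtain i j k where t: "t = \<alpha> ^ i * \<beta> ^ j * \<gamma> ^ k" "i < a" "j < b" "k < c" by (auto simp: T_def)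
    show "\<gamma> * t \<in> L"
    proof (cases "Suc k < c")
      case True
      then show ?thesis using base[OF t(2,3) True] by (simp add: t(1) mult_ac)
    next
      case False
      then have "c = Suc k" using t(4) by simp
      then have "\<gamma> * t = \<gamma> ^ c * (\<alpha> ^ i * \<beta> ^ j)" by (simp add: t(1) mult_ac)
      also have "\<dots> = (\<Sum>k<c. of_rat (h k) * (\<alpha> ^ i * \<beta> ^ j * \<gamma> ^ k))"
        unfolding c(2) by (simp add: sum_distrib_right sum_distrib_left mult_ac)
      also have "\<dots> \<in> L" by (rule comb) (use base t in auto)
      finally show ?thesis .
    qed
  qed auto
  have A_one: "1 \<in> A" by (simp add: A_def)
  have A_diff: "x - y \<in> A" if "x \<in> A" "y \<in> A" for x y
    using that unfolding A_def L_def by (simp add: left_diff_distrib rat_vs.span_diff)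
  have A_mult: "x * y \<in> A" if "x \<in> A" "y \<in> A" for x y
    using that unfolding A_def by (simp add: mult.assoc)
  have A_scale: "of_rat r * x \<in> A" if "x \<in> A" for x r
    using that unfolding A_def L_def by (simp add: mult.assoc rat_vs.span_scale)
  have "1 \<in> L" using base[of 0 0 0] a(1) b(1) c(1) by simp
  then have AL: "x \<in> L" if "x \<in> A" for x using that unfolding A_def by force
  have A_power: "x ^ i \<in> A" if "x \<in> A" for x i
    by (induction i) (use that A_one A_mult in auto)
  define N where "N = card T"
  have bounded: "\<exists>q::int poly. q \<noteq> 0 \<and> degree q \<le> N \<and> poly (map_poly of_int q) x = 0" if x: "x \<in> A" for x
  \<comment> \<open>Linear dependence is a property of sets, so coinciding powers of
    \<open>x\<close> are treated apart; they are a relation by themselves.\<close>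
  proof (cases "inj_on (\<lambda>i. x ^ i) {..N}")
    case True
    define S where "S = (\<lambda>i. x ^ i) ` {..N}"
    have S: "finite S" "card S = N + 1" using True by (simp_all add: S_def card_image)
    have "S \<subseteq> rat_vs.span T" using AL[OF A_power[OF x]] by (auto simp: S_def L_def)
    then have "rat_vs.dependent S"
      using rat_vs.independent_span_bound[OF T, of S] S by (auto simp: N_def)
    then obtain u v where u: "v \<in> S" "u v \<noteq> 0" "(\<Sum>v\<in>S. of_rat (u v) * v) = 0"
      using rat_vs.dependent_finite[OF S(1)] by auto
    then obtain i where i: "i \<le> N" "v = x ^ i" by (auto simp: S_def)
    have "(\<Sum>i\<le>N. of_rat (u (x ^ i)) * x ^ i) = 0"
      using u(3) True by (simp add: S_def sum.reindex)
    then show ?thesis using u i by (intro int_poly_of_relation[of i N "\<lambda>i. u (x ^ i)"]) auto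
  next
    case False
    then obtain i j where ij: "i \<le> N" "j \<le> N" "i \<noteq> j" "x ^ i = x ^ j" by (auto simp: inj_on_def)
    define u :: "nat \<Rightarrow> rat" where "u k = (if k = i then 1 else if k = j then -1 else 0)" for k
    have "(\<Sum>k\<le>N. of_rat (u k) * x ^ k) = (\<Sum>k\<in>{i, j}. of_rat (u k) * x ^ k)"
      by (rule sum.mono_neutral_right) (use ij in \<open>auto simp: u_def\<close>)
    also have "\<dots> = 0" using ij by (simp add: u_def of_rat_minus)
    finally show ?thesis using ij by (intro int_poly_of_relation[of i N u]) (auto simp: u_def)
  qed
  have A_inverse: "inverse x \<in> A" if x: "x \<in> A" "x \<noteq> 0" for x
  proof -
    have "algebraic x" using bounded[OF x(1)] by (metis algebraic_of_int_poly_root)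
    \<comment> \<open>With a nonzero constant term the equation can be solved for
      \<open>inverse x\<close> as a polynomial in \<open>x\<close>.\<close>
    then obtain q :: "int poly" where q: "coeff q 0 \<noteq> 0" "poly (map_poly of_int q) x = 0"
      using algebraicE'_nonzero[OF _ x(2)] by blast
    define C where "C = (map_poly of_int q :: complex poly)"
    have "0 = coeff C 0 + x * poly (poly_shift (Suc 0) C) x"
      using poly_poly_shift_Suc[of 0 C x] q(2) by (simp add: C_def)
    then have "inverse x = - inverse (of_int (coeff q 0)) * poly (poly_shift (Suc 0) C) x"
      using q(1) x(2) by (simp add: C_def coeff_map_poly field_simps add_eq_0_iff)
    then have inv: "inverse x = of_rat (- inverse (of_int (coeff q 0))) * poly (poly_shift (Suc 0) C) x"
      by (simp add: of_rat_minus of_rat_inverse)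
    have A_add: "u + v \<in> A" if "u \<in> A" "v \<in> A" for u v
      using A_diff[OF that(1) A_scale[OF that(2), of "-1"]] by (simp add: of_rat_minus)
    have A_sum: "sum v S \<in> A" if "\<And>i. i \<in> S \<Longrightarrow> v i \<in> A" for S :: "nat set" and v
      using that A_scale[OF A_one, of 0]
      by (induction S rule: infinite_finite_induct) (auto intro: A_add)
    have "poly (poly_shift (Suc 0) C) x \<in> A"
      unfolding poly_altdef
    proof (rule A_sum)
      fix i
      have "of_rat (of_int (coeff q (i + 1))) * x ^ i \<in> A" using A_scale A_power x by blast
      then show "coeff (poly_shift (Suc 0) C) i * x ^ i \<in> A"
        by (simp add: coeff_poly_shift C_def coeff_map_poly)
    qed
    then have "of_rat (- inverse (of_int (coeff q 0))) * poly (poly_shift (Suc 0) C) x \<in> A" by (rule A_scale)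
    then show ?thesis using inv by (simp only:)
  qed
  have sub: "generate_field ring_of_type_algebra {\<alpha>, \<beta>, \<gamma>} \<subseteq> A"
    by (rule generate_field_subset) (use \<alpha> \<beta> \<gamma> in \<open>auto intro: A_one A_diff A_mult A_inverse\<close>)
  have "number_field (generate_field ring_of_type_algebra {\<alpha>, \<beta>, \<gamma>}) N"
    by (intro number_field.intro complex_subfield_generate_field number_field_axioms.intro)
      (fact bounded[OF subsetD[OF sub]])
  then show ?thesis by blast
qed

section \<open>Polynomials over a valuation ring\<close>

definition root_poly :: "'a::comm_ring_1 set \<Rightarrow> 'a poly" where
  "root_poly S = (\<Prod>\<rho>\<in>S. [:- \<rho>, 1:])"

lemma poly_root_poly: "poly (root_poly S) x = (\<Prod>\<rho>\<in>S. x - \<rho>)"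
  by (simp add: root_poly_def poly_prod)

lemma poly_root_poly_eq_0: "finite S \<Longrightarrow> poly (root_poly S) x = 0 \<longleftrightarrow> x \<in> S"
  for x :: "'a::field"
  by (auto simp: poly_root_poly prod_zero_iff)

lemma root_poly_monic: "lead_coeff (root_poly S) = (1 :: 'a::field)"
  unfolding root_poly_def by (simp add: lead_coeff_prod)

lemma root_poly_nonzero: "root_poly S \<noteq> (0 :: 'a::field poly)"
  using root_poly_monic[of S] by auto

lemma degree_root_poly: "finite S \<Longrightarrow> degree (root_poly S) = card S" for S :: "'a::field set"
  unfolding root_poly_def by (subst degree_prod_eq_sum_degree) auto

lemma poly_pderiv_root_poly:
  assumes "finite S" "x \<in> S"
  shows "poly (pderiv (root_poly S)) x = (\<Prod>\<rho>\<in>S - {x}. x - (\<rho> :: 'a::field))"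
proof -
  have "root_poly S = [:- x, 1:] * root_poly (S - {x})"
    unfolding root_poly_def using assms by (simp add: prod.remove)
  then show ?thesis
    by (simp add: pderiv_mult pderiv_pCons poly_root_poly del: mult_pCons_left)
qed

context valuation_ring
begin

definition vpoly :: "'a poly \<Rightarrow> bool" where "vpoly q \<longleftrightarrow> (\<forall>i. coeff q i \<in> V)"

text \<open>The reduction modulo \<open>M\<close> is a nonzero constant. This is what a factor
  becomes after rescaling when its roots are far from the centre compared with the scale.\<close>

definition near_const :: "'a poly \<Rightarrow> bool" where
  "near_const q \<longleftrightarrow> vunit (coeff q 0) \<and> (\<forall>i>0. coeff q i \<in> M)"

text \<open>After the substitution \<open>x = \<alpha> + \<mu> y\<close> and division by a power of \<open>\<mu>\<close>, the polynomial becomes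
  monic with coefficients in \<open>V\<close>: its roots have distance at most that of \<open>\<mu>\<close> from \<open>\<alpha>\<close>.\<close>

definition scaled :: "'a \<Rightarrow> 'a \<Rightarrow> nat \<Rightarrow> 'a poly \<Rightarrow> bool" where
  "scaled \<alpha> \<mu> r q \<longleftrightarrow>
     (\<exists>q'. pcompose q [:\<alpha>, \<mu>:] = smult (\<mu> ^ r) q' \<and> vpoly q' \<and> degree q' = r \<and> lead_coeff q' = 1)"

lemma vpoly_mult: "vpoly q \<Longrightarrow> vpoly r \<Longrightarrow> vpoly (q * r)"
  by (auto simp: vpoly_def coeff_mult intro!: sum_V mult_V)

lemma near_const_vpoly: "near_const q \<Longrightarrow> vpoly q"
  by (auto simp: near_const_def vpoly_def) (metis M_V gr0I vunit_V)

lemma near_const_1: "near_const 1"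
  by (auto simp: near_const_def vunit_one zero_M)

lemma near_const_mult: "near_const q \<Longrightarrow> near_const r \<Longrightarrow> near_const (q * r)"
  unfolding near_const_def
proof (intro conjI allI impI)
  assume q: "vunit (coeff q 0) \<and> (\<forall>i>0. coeff q i \<in> M)" and r: "vunit (coeff r 0) \<and> (\<forall>i>0. coeff r i \<in> M)"
  show "vunit (coeff (q * r) 0)" using q r by (simp add: coeff_mult vunit_mult)
  have V: "coeff q i \<in> V" "coeff r i \<in> V" for i using q r vunit_V M_V by (cases "i = 0"; auto)+
  fix i :: nat assume "i > 0"
  have "coeff q j * coeff r (i - j) \<in> M" if "j \<le> i" for j
    using q r V \<open>i > 0\<close> by (cases "j = 0") (auto intro: mult_M mult_M')
  then show "coeff (q * r) i \<in> M" unfolding coeff_mult by (intro sum_M) auto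
qed

lemma near_const_prod: "(\<And>i. i \<in> S \<Longrightarrow> near_const (f i)) \<Longrightarrow> near_const (prod f S)"
  by (induction S rule: infinite_finite_induct) (auto intro: near_const_1 near_const_mult)

lemma near_const_linear: "vunit a \<Longrightarrow> b \<in> M \<Longrightarrow> near_const [:a, b:]"
  by (auto simp: near_const_def coeff_pCons zero_M split: nat.split)

lemma near_const_root_poly:
  assumes "\<And>\<rho>. \<rho> \<in> S \<Longrightarrow> vunit (\<alpha> - \<rho>)" "\<mu> \<in> M"
  shows "near_const (pcompose (root_poly S) [:\<alpha>, \<mu>:])"
  unfolding root_poly_def pcompose_prod
  by (intro near_const_prod) (use assms in \<open>auto simp: pcompose_pCons intro: near_const_linear\<close>)

lemma scaled_1: "scaled \<alpha> \<mu> 0 1"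
  unfolding scaled_def by (intro exI[of _ 1]) (auto simp: pcompose_1 vpoly_def one_V zero_V)

lemma scaled_mult:
  assumes "scaled \<alpha> \<mu> r q" "scaled \<alpha> \<mu> r' q'"
  shows "scaled \<alpha> \<mu> (r + r') (q * q')"
proof -
  obtain s where s: "pcompose q [:\<alpha>, \<mu>:] = smult (\<mu> ^ r) s" "vpoly s" "degree s = r" "lead_coeff s = 1"
    using assms(1) by (auto simp: scaled_def)
  obtain s' where s': "pcompose q' [:\<alpha>, \<mu>:] = smult (\<mu> ^ r') s'" "vpoly s'" "degree s' = r'" "lead_coeff s' = 1"
    using assms(2) by (auto simp: scaled_def)
  have "s \<noteq> 0" "s' \<noteq> 0" using s(4) s'(4) by auto
  then have "degree (s * s') = r + r'" using s(3) s'(3) by (simp add: degree_mult_eq)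
  moreover have "lead_coeff (s * s') = 1" unfolding lead_coeff_mult s(4) s'(4) by simp
  moreover have "pcompose (q * q') [:\<alpha>, \<mu>:] = smult (\<mu> ^ (r + r')) (s * s')"
    by (simp add: pcompose_mult s(1) s'(1) power_add mult.commute)
  ultimately show ?thesis
    unfolding scaled_def using vpoly_mult[OF s(2) s'(2)] by blast
qed

lemma scaled_power: "scaled \<alpha> \<mu> r q \<Longrightarrow> scaled \<alpha> \<mu> (k * r) (q ^ k)"
  by (induction k) (auto intro: scaled_1 scaled_mult)

lemma scaled_linear:
  assumes "(\<rho> - \<alpha>) / \<mu> \<in> V" "\<mu> \<noteq> 0"
  shows "scaled \<alpha> \<mu> 1 [:- \<rho>, 1:]"
  unfolding scaled_def
  using assms uminus_V[OF assms(1)]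
  by (intro exI[of _ "[:- ((\<rho> - \<alpha>) / \<mu>), 1:]"])
    (auto simp: pcompose_pCons vpoly_def coeff_pCons one_V zero_V split: nat.split)

lemma scaled_root_poly:
  assumes "finite S" "\<And>\<rho>. \<rho> \<in> S \<Longrightarrow> (\<rho> - \<alpha>) / \<mu> \<in> V" "\<mu> \<noteq> 0"
  shows "scaled \<alpha> \<mu> (card S) (root_poly S)"
  using assms
proof (induction S rule: finite_induct)
  case empty
  then show ?case by (simp add: root_poly_def scaled_1)
next
  case (insert x F)
  have "root_poly (insert x F) = [:- x, 1:] * root_poly F" using insert by (simp add: root_poly_def)
  moreover have "scaled \<alpha> \<mu> (1 + card F) ([:- x, 1:] * root_poly F)"
    using insert by (intro scaled_mult scaled_linear) auto
  ultimately show ?case using insert by simp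
qed

end

section \<open>Reduction of polynomials of degree \<open>p\<close> and local scales\<close>

lemma (in residue_char) poly_mod_M:
  assumes G: "vpoly G" "degree G = p" "lead_coeff G = 1" and d: "\<And>i. coeff (pderiv G) i \<in> M" and y: "y \<in> V"
  shows "poly G y - y ^ p - coeff G 0 \<in> M"
proof -
  \<comment> \<open>The derivative controls \<open>of_nat i * coeff G i\<close>, and
    \<open>of_nat i\<close> is a unit in this range. So only the leading and the constant term
    survive modulo \<open>M\<close>.\<close>
  have c: "coeff G i \<in> M" if "0 < i" "i < p" for i
  proof -
    have "\<not> p dvd i" using that by (auto dest: dvd_imp_le)
    then have u: "vunit (of_nat i)" by (rule vunit_of_nat)
    obtain j where j: "i = Suc j" using \<open>0 < i\<close> by (cases i) auto
    have "of_nat i * coeff G i \<in> M" using d[of j] by (simp add: coeff_pderiv j)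
    then have "inverse (of_nat i) * (of_nat i * coeff G i) \<in> M"
      by (rule mult_M[OF vunit_V[OF vunit_inverse[OF u]]])
    then show ?thesis using vunit_nonzero[OF u] by (simp add: mult.assoc[symmetric])
  qed
  have p: "p > 0" using prime_p prime_gt_0_nat by auto
  have "poly G y = (\<Sum>i\<le>p. coeff G i * y ^ i)" by (simp add: poly_altdef G(2))
  also have "{..p} = insert 0 (insert p {0<..<p})" using p by auto
  also have "(\<Sum>i\<in>\<dots>. coeff G i * y ^ i) = coeff G 0 + (y ^ p + (\<Sum>i\<in>{0<..<p}. coeff G i * y ^ i))"
    using p G by (subst sum.insert; simp)
  finally have "poly G y - y ^ p - coeff G 0 = (\<Sum>i\<in>{0<..<p}. coeff G i * y ^ i)" by simp
  also have "\<dots> \<in> M" using c y by (intro sum_M mult_M' power_V) auto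
  finally show ?thesis .
qed

text \<open>If \<open>\<kappa>\<close> were in \<open>M\<close>, then \<open>G\<close> would reduce
  to a \<open>p\<close>-th power plus a constant, which cannot vanish at both 0 and 1. If it were
  outside \<open>V\<close>, then \<open>N * H\<close> would vanish modulo \<open>M\<close>, although
  \<open>N\<close> is monic and \<open>H\<close> reduces to a nonzero constant.\<close>

lemma (in residue_char) vunit_derivative_factor:
  assumes G: "vpoly G" "degree G = p" "lead_coeff G = 1" and roots: "poly G 0 = 0" "poly G 1 = 0"
    and d: "pderiv G = smult \<kappa> (N * H)" and N: "vpoly N" "lead_coeff N = 1" and H: "near_const H"
  shows "vunit \<kappa>"
proof -
  have NH: "coeff (N * H) i \<in> V" for i
    using vpoly_mult[OF N(1) near_const_vpoly[OF H]] by (simp add: vpoly_def)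
  have "\<kappa> \<notin> M"
  proof
    assume "\<kappa> \<in> M"
    then have "coeff (pderiv G) i \<in> M" for i using NH by (simp add: d mult_M')
    then have "poly G 1 - 1 ^ p - coeff G 0 \<in> M" using poly_mod_M[OF G _ one_V] by blast
    then have "- 1 \<in> M" using roots by (simp add: poly_0_coeff_0)
    then show False using uminus_M[of "- 1"] one_notin_M by simp
  qed
  moreover have "\<kappa> \<in> V"
  proof (rule ccontr)
    assume "\<kappa> \<notin> V"
    then have k: "inverse \<kappa> \<in> M" "\<kappa> \<noteq> 0" using notin_V zero_V by auto
    have "coeff (pderiv G) i \<in> V" for i
      using G(1) by (auto simp: coeff_pderiv vpoly_def intro!: mult_V of_nat_V simp del: of_nat_Suc)
    then have "inverse \<kappa> * coeff (pderiv G) i \<in> M" for i using mult_M'[OF k(1)] by blast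
    then have M: "coeff (N * H) i \<in> M" for i using k(2) by (simp add: d mult.assoc[symmetric])
    \<comment> \<open>The coefficient of \<open>N * H\<close> at the degree of \<open>N\<close> is
      congruent to the unit \<open>coeff H 0\<close>.\<close>
    define r where "r = degree N"
    have "coeff (N * H) r = (\<Sum>i\<le>r. coeff N i * coeff H (r - i))" by (rule coeff_mult)
    also have "\<dots> = coeff H 0 + (\<Sum>i<r. coeff N i * coeff H (r - i))"
      using N(2) by (simp add: r_def flip: lessThan_Suc_atMost)
    finally have "coeff H 0 = coeff (N * H) r - (\<Sum>i<r. coeff N i * coeff H (r - i))" by simp
    also have "\<dots> \<in> M"
      using N(1) H by (intro diff_M M sum_M mult_M) (auto simp: vpoly_def near_const_def)
    finally show False using H by (simp add: near_const_def vunit_def)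
  qed
  ultimately show ?thesis by (simp add: vunit_def)
qed

lemma pderiv_rescaled:
  fixes G :: "'a::field_char_0 poly"
  assumes "pcompose G [:\<alpha>, \<mu>:] = smult (\<mu> ^ k) G'" "pderiv G = smult c N"
    "pcompose N [:\<alpha>, \<mu>:] = smult (\<mu> ^ r) N'" "\<mu> \<noteq> 0"
  shows "pderiv G' = smult (c * \<mu> ^ (r + 1) / \<mu> ^ k) N'"
proof -
  have "smult (\<mu> ^ k) (pderiv G') = pderiv (pcompose G [:\<alpha>, \<mu>:])"
    unfolding assms(1) by (simp add: pderiv_smult)
  also have "\<dots> = smult (c * \<mu> ^ (r + 1)) N'"
    unfolding pderiv_pcompose assms(2) pcompose_smult assms(3) by (simp add: pderiv_pCons mult_ac)
  finally have "smult (inverse (\<mu> ^ k)) (smult (\<mu> ^ k) (pderiv G')) = smult (inverse (\<mu> ^ k)) (smult (c * \<mu> ^ (r + 1)) N')"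
    by simp
  then show ?thesis using assms(4) by (simp add: divide_inverse mult.commute)
qed

text \<open>Rescaling moves two roots of \<open>G\<close> to 0 and 1, so
  \<open>vunit_derivative_factor\<close> applies. Read additively, the valuation of \<open>p\<close>
  is \<open>p - (r + 1)\<close> times that of \<open>\<mu>\<close>.\<close>

lemma (in residue_char) local_scale:
  assumes G: "scaled \<alpha> \<mu> p G" "poly G \<alpha> = 0" "poly G (\<alpha> + \<mu>) = 0"
    and d: "pderiv G = smult (of_nat p) (N * H)"
    and N: "scaled \<alpha> \<mu> r N" and H: "near_const (pcompose H [:\<alpha>, \<mu>:])" and l: "\<mu> \<noteq> 0"
  shows "vunit (of_nat p * \<mu> ^ (r + 1) / \<mu> ^ p)"
proof -
  obtain G' where G': "pcompose G [:\<alpha>, \<mu>:] = smult (\<mu> ^ p) G'" "vpoly G'" "degree G' = p" "lead_coeff G' = 1"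
    using G(1) by (auto simp: scaled_def)
  obtain N' where N': "pcompose N [:\<alpha>, \<mu>:] = smult (\<mu> ^ r) N'" "vpoly N'" "lead_coeff N' = 1"
    using N by (auto simp: scaled_def)
  have ev: "poly G (\<alpha> + \<mu> * y) = \<mu> ^ p * poly G' y" for y
    using arg_cong[OF G'(1), of "\<lambda>q. poly q y"] by (simp add: poly_pcompose mult.commute)
  show ?thesis
  proof (rule vunit_derivative_factor[OF G'(2-4)])
    show "poly G' 0 = 0" "poly G' 1 = 0" using ev[of 0] ev[of 1] G(2,3) l by auto
    show "pderiv G' = smult (of_nat p * \<mu> ^ (r + 1) / \<mu> ^ p) (N' * pcompose H [:\<alpha>, \<mu>:])"
      by (rule pderiv_rescaled[OF G'(1) d _ l]) (simp add: pcompose_mult N'(1))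
  qed (use N' H in auto)
qed

section \<open>The polynomial model of the tree\<close>

lemma pderiv_cube_mult_square:
  fixes X0 :: "'a::field_char_0 poly"
  assumes "pderiv X0 = 1"
  shows "pderiv (X0 ^ 3 * A * Q ^ 2) = X0 ^ 2 * Q * (3 * A * Q + X0 * pderiv A * Q + 2 * X0 * A * pderiv Q)"
  by (simp add: pderiv_mult power2_eq_square power3_eq_cube assms algebra_simps)

text \<open>\<open>A\<close> and \<open>W\<close> are the black and white ends, \<open>Q\<close> and
  \<open>R\<close> the black and white vertices of valency 2, in a coordinate with the centre at
  0.\<close>

locale tree_poly =
  fixes p :: nat and A Q W R :: "complex set"
  assumes prime_p: "Factorial_Ring.prime p" and p_gt_3: "p > 3"
    and fin: "finite A" "finite Q" "finite W" "finite R"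
    and zero_notin: "0 \<notin> A" "0 \<notin> Q"
    and disjoint: "A \<inter> Q = {}" "W \<inter> R = {}"
    and white: "[:0, 1:] ^ 3 * root_poly A * root_poly Q ^ 2 - 1 = root_poly W * root_poly R ^ 2"
    and deriv: "pderiv ([:0, 1:] ^ 3 * root_poly A * root_poly Q ^ 2) =
      smult (of_nat p) ([:0, 1:] ^ 2 * root_poly Q * root_poly R)"
    and card_black: "3 + card A + 2 * card Q = p"
    and card_white: "card W + 2 * card R = p"
    and card_odd: "card A + card W = 3"
begin

definition F :: "complex poly" where "F = [:0, 1:] ^ 3 * root_poly A * root_poly Q ^ 2"

lemma white': "F - 1 = root_poly W * root_poly R ^ 2" using white by (simp add: F_def)

lemma deriv': "pderiv F = smult (of_nat p) ([:0, 1:] ^ 2 * root_poly Q * root_poly R)"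
  using deriv by (simp add: F_def)

lemma pderiv_white: "pderiv (F - 1) = smult (of_nat p) ([:0, 1:] ^ 2 * root_poly Q * root_poly R)"
  using deriv' by (simp add: pderiv_diff)

lemma poly_F_0: "poly F 0 = 0" by (simp add: F_def)

lemma poly_F_black: "\<rho> \<in> A \<union> Q \<Longrightarrow> poly F \<rho> = 0"
  using fin by (auto simp: F_def poly_root_poly_eq_0)

lemma poly_F_white: "\<rho> \<in> W \<union> R \<Longrightarrow> poly F \<rho> = 1"
  using fin arg_cong[OF white', of "\<lambda>q. poly q \<rho>"] poly_root_poly_eq_0[of W \<rho>] poly_root_poly_eq_0[of R \<rho>]
  by auto

lemma zero_notin_white: "0 \<notin> W \<union> R" using poly_F_white[of 0] poly_F_0 by auto

text \<open>Cancelling the common factors of \<open>F\<close> and its derivative.\<close>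

lemma deriv_at_black:
  assumes "poly ([:0, 1:] * root_poly A) x = 0"
  shows "x * poly (pderiv (root_poly A)) x * poly (root_poly Q) x + 3 * poly (root_poly A) x * poly (root_poly Q) x
    = of_nat p * poly (root_poly R) x"
proof -
  let ?X = "[:0, 1 :: complex:]" and ?A = "root_poly A" and ?Q = "root_poly Q" and ?R = "root_poly R"
  let ?D = "3 * ?A * ?Q + ?X * pderiv ?A * ?Q + 2 * ?X * ?A * pderiv ?Q"
  have "pderiv F = ?X ^ 2 * ?Q * ?D"
    unfolding F_def by (rule pderiv_cube_mult_square) (simp add: pderiv_pCons)
  then have "?X ^ 2 * ?Q * ?D = ?X ^ 2 * ?Q * smult (of_nat p) ?R"
    using deriv' by simp
  moreover have "?X ^ 2 * ?Q \<noteq> 0" using root_poly_nonzero[of Q] by simp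
  ultimately have "?D = smult (of_nat p) ?R"
    using mult_left_cancel by blast
  then have "poly ?D x = poly (smult (of_nat p) ?R) x" by simp
  then have "3 * poly ?A x * poly ?Q x + x * poly (pderiv ?A) x * poly ?Q x
      + 2 * (x * poly ?A x) * poly (pderiv ?Q) x = of_nat p * poly ?R x"
    by (simp only: poly_add poly_mult poly_smult poly_pCons poly_0 poly_numeral) (simp add: mult.assoc)
  moreover have "x * poly ?A x = 0" using assms by simp
  ultimately show ?thesis by (simp only: mult_zero_right mult_zero_left add_0_right add_0_left add.commute)
qed

lemma deriv_at_white:
  assumes "x \<in> W"
  shows "poly (pderiv (root_poly W)) x * poly (root_poly R) x = of_nat p * x ^ 2 * poly (root_poly Q) x"
proof -
  let ?X = "[:0, 1 :: complex:]" and ?W = "root_poly W" and ?Q = "root_poly Q" and ?R = "root_poly R"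
  have "pderiv (F - 1) = ?R * (pderiv ?W * ?R + 2 * ?W * pderiv ?R)"
    unfolding white' by (simp add: pderiv_mult power2_eq_square algebra_simps)
  then have "?R * (pderiv ?W * ?R + 2 * ?W * pderiv ?R) = ?R * smult (of_nat p) (?X ^ 2 * ?Q)"
    unfolding pderiv_white by (simp only: mult_smult_right mult_ac)
  then have "pderiv ?W * ?R + 2 * ?W * pderiv ?R = smult (of_nat p) (?X ^ 2 * ?Q)"
    using mult_left_cancel[OF root_poly_nonzero[of R]] by blast
  then have "poly (pderiv ?W * ?R + 2 * ?W * pderiv ?R) x = poly (smult (of_nat p) (?X ^ 2 * ?Q)) x"
    by simp
  moreover have "poly ?W x = 0" using assms fin by (simp add: poly_root_poly_eq_0)
  ultimately show ?thesis by (simp add: mult.assoc)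
qed

end

section \<open>Valuations of the vertices and of their differences\<close>

locale tree_poly_valuation = tree_poly p A Q W R + residue_char V M p for p A Q W R and V M :: "complex set"
begin

lemma linear_scaled: "\<mu> \<noteq> 0 \<Longrightarrow> scaled 0 \<mu> 1 [:0, 1:]"
  using scaled_linear[of 0 0 \<mu>] zero_V by simp

lemma scaled_F:
  assumes "\<mu> \<noteq> 0" "\<And>\<rho>. \<rho> \<in> A \<union> Q \<Longrightarrow> \<rho> / \<mu> \<in> V"
  shows "scaled 0 \<mu> p F"
proof -
  have "scaled 0 \<mu> (3 * 1 + card A + 2 * card Q) F"
    unfolding F_def by (intro scaled_mult scaled_power scaled_root_poly linear_scaled) (use assms fin in auto)
  then show ?thesis using card_black by simp
qed

text \<open>Rescale by the largest vertex \<open>\<mu>\<close>. As the derivative has exactly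
  \<open>p - 1\<close> zeros, all powers of \<open>\<mu>\<close> cancel in it and the factor
  \<open>p\<close> remains, so the rescaled polynomial reduces to the \<open>p\<close>-th power of
  the variable. Black vertices then vanish modulo \<open>M\<close>; hence \<open>\<mu>\<close> is
  white, and \<open>poly F \<mu> = 1\<close> makes it a unit.\<close>

lemma roots_reduction:
  shows "\<rho> \<in> A \<union> Q \<Longrightarrow> \<rho> \<in> M" and "\<rho> \<in> W \<union> R \<Longrightarrow> \<rho> - 1 \<in> M"
proof -
  define S where "S = A \<union> Q \<union> W \<union> R"
  have "finite S" "0 \<notin> S" using fin zero_notin zero_notin_white by (auto simp: S_def)
  moreover have "S \<noteq> {}" using card_odd fin by (auto simp: S_def)
  ultimately obtain \<mu> where \<mu>: "\<mu> \<in> S" "\<And>r. r \<in> S \<Longrightarrow> r / \<mu> \<in> V" "\<mu> \<noteq> 0"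
    using exists_max[of S] by metis
  have F: "scaled 0 \<mu> p F" by (rule scaled_F) (use \<mu> in \<open>auto simp: S_def\<close>)
  have "scaled 0 \<mu> (2 * 1 + card Q + card R) ([:0, 1:] ^ 2 * root_poly Q * root_poly R)"
    by (intro scaled_mult scaled_power scaled_root_poly linear_scaled) (use \<mu> fin in \<open>auto simp: S_def\<close>)
  moreover have "2 * 1 + card Q + card R = p - 1"
    using card_black card_white card_odd p_gt_3 by linarith
  ultimately have N: "scaled 0 \<mu> (p - 1) ([:0, 1:] ^ 2 * root_poly Q * root_poly R)" by simp
  obtain F' where F': "pcompose F [:0, \<mu>:] = smult (\<mu> ^ p) F'" "vpoly F'" "degree F' = p" "lead_coeff F' = 1"
    using F by (auto simp: scaled_def)
  obtain N' where N': "pcompose ([:0, 1:] ^ 2 * root_poly Q * root_poly R) [:0, \<mu>:] = smult (\<mu> ^ (p - 1)) N'" "vpoly N'"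
    using N by (auto simp: scaled_def)
  have "pderiv F' = smult (of_nat p * \<mu> ^ (p - 1 + 1) / \<mu> ^ p) N'"
    by (rule pderiv_rescaled[OF F'(1) deriv' N'(1) \<mu>(3)])
  then have "pderiv F' = smult (of_nat p) N'" using \<mu>(3) p_gt_3 by simp
  then have d: "coeff (pderiv F') i \<in> M" for i
    using p_M N'(2) by (auto simp: vpoly_def intro: mult_M')
  have ev: "poly F (\<mu> * y) = \<mu> ^ p * poly F' y" for y
    using arg_cong[OF F'(1), of "\<lambda>q. poly q y"] by (simp add: poly_pcompose mult.commute)
  have c0: "coeff F' 0 = 0" using ev[of 0] poly_F_0 \<mu>(3) by (simp add: poly_0_coeff_0)
  have red: "poly F' y - y ^ p \<in> M" if "y \<in> V" for y
    using poly_mod_M[OF F'(2-4) d that] c0 by simp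
  have ev': "poly F' (r / \<mu>) = poly F r / \<mu> ^ p" for r
    using ev[of "r / \<mu>"] \<mu>(3) by simp
  have black: "r / \<mu> \<in> M" if "r \<in> A \<union> Q" for r
  proof -
    have "r / \<mu> \<in> V" using \<mu>(2) that by (auto simp: S_def)
    from red[OF this] have "- ((r / \<mu>) ^ p) \<in> M" by (simp add: ev' poly_F_black[OF that])
    then show ?thesis using uminus_M power_in_M by fastforce
  qed
  have "\<mu> \<notin> A \<union> Q" using black[of \<mu>] \<mu>(3) one_notin_M by auto
  then have "poly F \<mu> = 1" using \<mu>(1) poly_F_white by (auto simp: S_def)
  then have m1: "1 / \<mu> ^ p - 1 \<in> M" using red[OF one_V] ev'[of \<mu>] \<mu>(3) by simp
  have "vunit (1 + (1 / \<mu> ^ p - 1))" using vunit_add_M[OF vunit_one m1] .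
  then have "vunit (inverse (\<mu> ^ p))" by (simp add: divide_inverse)
  then have "vunit (\<mu> ^ p)" using vunit_inverse[of "inverse (\<mu> ^ p)"] by simp
  then have u: "vunit \<mu>" using vunit_powerD p_gt_3 by auto
  show "\<rho> \<in> M" if "\<rho> \<in> A \<union> Q"
    using mult_M'[OF black[OF that] vunit_V[OF u]] \<mu>(3) by simp
  show "\<rho> - 1 \<in> M" if \<rho>: "\<rho> \<in> W \<union> R"
  proof -
    have V: "\<rho> / \<mu> \<in> V" using \<mu>(2) \<rho> by (auto simp: S_def)
    from red[OF this] have "(1 / \<mu> ^ p - (\<rho> / \<mu>) ^ p) \<in> M" by (simp add: ev' poly_F_white[OF \<rho>])
    then have "\<mu> ^ p * (1 / \<mu> ^ p - (\<rho> / \<mu>) ^ p) \<in> M"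
      using power_V[OF vunit_V[OF u]] by (intro mult_M)
    moreover have "\<mu> ^ p * (1 / \<mu> ^ p - (\<rho> / \<mu>) ^ p) = 1 - \<rho> ^ p"
      using \<mu>(3) by (simp add: field_simps power_divide)
    ultimately have 1: "1 - \<rho> ^ p \<in> M" by simp
    have "\<rho> \<in> V" using mult_V[OF V vunit_V[OF u]] \<mu>(3) by simp
    \<comment> \<open>Frobenius modulo \<open>M\<close>: \<open>poly_mod_M\<close> for this
      \<open>E\<close> shows that \<open>(\<rho> - 1) ^ p\<close> is congruent to
      \<open>\<rho> ^ p - 1\<close>, the sign coming from odd \<open>p\<close>.\<close>
    define E where "E = [:- 1, 1 :: complex:] ^ p"
    have "odd p" using prime_p p_gt_3 by (simp add: prime_odd_nat)
    have E: "vpoly E"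
      unfolding E_def
    proof (induction p)
      case (Suc k)
      have "vpoly [:- 1, 1:]" by (auto simp: vpoly_def coeff_pCons one_V uminus_V zero_V split: nat.split)
      then show ?case using Suc by (simp only: power_Suc vpoly_mult)
    qed (auto simp: vpoly_def one_V zero_V)
    have "lead_coeff E = 1" unfolding E_def lead_coeff_power by simp
    moreover have "degree E = p" unfolding E_def by (simp add: degree_power_eq)
    moreover have "coeff (pderiv E) i \<in> M" for i
    proof -
      have "vpoly ([:- 1, 1 :: complex:] ^ k)" for k
      proof (induction k)
        case (Suc k)
        have "vpoly [:- 1, 1:]" by (auto simp: vpoly_def coeff_pCons one_V uminus_V zero_V split: nat.split)
        then show ?case using Suc by (simp only: power_Suc vpoly_mult)
      qed (auto simp: vpoly_def one_V zero_V)
      then have "coeff ([:- 1, 1 :: complex:] ^ (p - 1)) i \<in> V" by (simp add: vpoly_def)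
      moreover have "pderiv E = smult (of_nat p) ([:- 1, 1:] ^ (p - 1))"
        unfolding E_def using p_gt_3 by (simp add: pderiv_power pderiv_pCons of_nat_poly)
      ultimately show ?thesis using mult_M'[OF p_M] by simp
    qed
    ultimately have "poly E \<rho> - \<rho> ^ p - coeff E 0 \<in> M"
      using poly_mod_M[OF E] \<open>\<rho> \<in> V\<close> by blast
    moreover have "coeff E 0 = - 1"
      unfolding poly_0_coeff_0[symmetric] E_def using \<open>odd p\<close> by (simp add: poly_power)
    ultimately have "(\<rho> - 1) ^ p + (1 - \<rho> ^ p) \<in> M" by (simp add: E_def poly_power algebra_simps)
    from diff_M[OF this 1] show ?thesis using power_in_M[of "\<rho> - 1" p] by simp
  qed
qed

lemma black_M: "\<rho> \<in> A \<union> Q \<Longrightarrow> \<rho> \<in> M" by (rule roots_reduction(1))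

lemma white_vunit: "\<rho> \<in> W \<union> R \<Longrightarrow> vunit \<rho>"
  using vunit_add_M[OF vunit_one roots_reduction(2)[of \<rho>]] by simp

lemma white_diff_M: "\<rho> \<in> W \<union> R \<Longrightarrow> \<rho>' \<in> W \<union> R \<Longrightarrow> \<rho> - \<rho>' \<in> M"
  using diff_M[OF roots_reduction(2)[of \<rho>] roots_reduction(2)[of \<rho>']] by simp

lemma white_minus_black: "\<rho> \<in> W \<union> R \<Longrightarrow> \<rho>' \<in> A \<union> Q \<Longrightarrow> vunit (\<rho> - \<rho>')"
  by (intro vunit_diff_M white_vunit black_M)

text \<open>The derivative at a white end \<open>w\<close> is, up to a unit, the product of the differences of \<open>w\<close> with
  the other white vertices and equals \<open>p\<close>; comparing with the largest difference, all have the
  same absolute value.\<close>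

lemma white_differences:
  assumes w: "w \<in> W" "w' \<in> W" "w \<noteq> w'"
  shows "vunit ((w - w') ^ (card W + card R - 1) / of_nat p)"
proof -
  define S where "S = (W \<union> R) - {w}"
  define D where "D = (\<lambda>\<rho>. \<rho> - w) ` S"
  have finS: "finite S" using fin by (simp add: S_def)
  have "finite D" "D \<noteq> {}" "0 \<notin> D" using finS w by (auto simp: D_def S_def)
  then obtain \<mu> where \<mu>: "\<mu> \<in> D" "\<And>r. r \<in> D \<Longrightarrow> r / \<mu> \<in> V" "\<mu> \<noteq> 0"
    using exists_max[of D] by metis
  then obtain \<rho>0 where \<rho>0: "\<rho>0 \<in> S" "\<mu> = \<rho>0 - w" by (auto simp: D_def)
  have V: "(\<rho> - w) / \<mu> \<in> V" if "\<rho> \<in> W \<union> R" for \<rho>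
    using \<mu>(2)[of "\<rho> - w"] that zero_V by (cases "\<rho> = w") (auto simp: D_def S_def)
  have p0: "of_nat p \<noteq> (0::complex)" using p_gt_3 by simp
  have "scaled w \<mu> (card W + 2 * card R) (root_poly W * root_poly R ^ 2)"
    by (intro scaled_mult scaled_power scaled_root_poly) (use V fin \<mu> in auto)
  then have sc: "scaled w \<mu> p (F - 1)" using card_white by (simp add: white')
  have "vunit (of_nat p * \<mu> ^ (card R + 1) / \<mu> ^ p)"
  proof (rule local_scale[OF sc])
    show "poly (F - 1) w = 0" using poly_F_white[of w] w by simp
    show "poly (F - 1) (w + \<mu>) = 0" using poly_F_white[of \<rho>0] \<rho>0 by (simp add: S_def)
    show "pderiv (F - 1) = smult (of_nat p) (root_poly R * ([:0, 1:] ^ 2 * root_poly Q))"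
      unfolding pderiv_white by (simp add: mult_ac)
    show "scaled w \<mu> (card R) (root_poly R)" by (intro scaled_root_poly) (use V fin \<mu> in auto)
    have "\<mu> \<in> M" using white_diff_M[of \<rho>0 w] \<rho>0 w by (simp add: S_def)
    moreover have "vunit (w - \<rho>)" if "\<rho> \<in> Q" for \<rho> using white_minus_black[of w \<rho>] w that by simp
    ultimately show "near_const (pcompose ([:0, 1:] ^ 2 * root_poly Q) [:w, \<mu>:])"
      unfolding pcompose_mult power2_eq_square
      using white_vunit[of w] w
      by (intro near_const_mult near_const_root_poly)
        (auto simp: pcompose_pCons intro: near_const_linear)
  qed fact
  \<comment> \<open>The exponent left after cancellation is the number of white vertices other than
    \<open>w\<close>. That match makes the product of all \<open>(w - \<rho>) / \<mu>\<close> a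
    unit, and hence each factor.\<close>
  moreover have e: "p = (card R + 1) + (card W + card R - 1)"
    using card_white w fin by (cases "card W") auto
  ultimately have pu0: "vunit (of_nat p / \<mu> ^ (card W + card R - 1))"
    using \<mu>(3) by (subst (asm) (2) e) (simp add: power_add)
  then have pu: "vunit (\<mu> ^ (card W + card R - 1) / of_nat p)"
    using vunit_inverse by fastforce
  have "card S = card W + card R - 1"
    using w fin disjoint by (simp add: S_def card_Un_disjoint)
  have "(\<Prod>\<rho>\<in>S. w - \<rho>) = (\<Prod>\<rho>\<in>W - {w}. w - \<rho>) * (\<Prod>\<rho>\<in>R. w - \<rho>)"
  proof -
    have "S = (W - {w}) \<union> R" "(W - {w}) \<inter> R = {}" using w disjoint by (auto simp: S_def)
    then show ?thesis using fin by (simp add: prod.union_disjoint)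
  qed
  also have "\<dots> = of_nat p * (w ^ 2 * (\<Prod>\<rho>\<in>Q. w - \<rho>))"
    using deriv_at_white[OF w(1)] fin w by (simp add: poly_pderiv_root_poly poly_root_poly mult.assoc)
  finally have prod: "(\<Prod>\<rho>\<in>S. w - \<rho>) = of_nat p * (w ^ 2 * (\<Prod>\<rho>\<in>Q. w - \<rho>))" .
  have "(\<Prod>\<rho>\<in>S. (w - \<rho>) / \<mu>) = (\<Prod>\<rho>\<in>S. w - \<rho>) / \<mu> ^ card S"
    by (simp add: prod_dividef)
  also have "\<dots> = (w ^ 2 * (\<Prod>\<rho>\<in>Q. w - \<rho>)) * (of_nat p / \<mu> ^ (card W + card R - 1))"
    unfolding prod by (simp add: \<open>card S = _\<close>)
  finally have eq: "(\<Prod>\<rho>\<in>S. (w - \<rho>) / \<mu>) = (w ^ 2 * (\<Prod>\<rho>\<in>Q. w - \<rho>)) * (of_nat p / \<mu> ^ (card W + card R - 1))" .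
  have "vunit (\<Prod>\<rho>\<in>S. (w - \<rho>) / \<mu>)"
    unfolding eq
  proof (intro vunit_mult vunit_power pu0)
    show "vunit w" using white_vunit w by auto
    show "vunit (\<Prod>\<rho>\<in>Q. w - \<rho>)" by (rule vunit_prod) (use white_minus_black w in auto)
  qed
  then have "vunit ((w - w') / \<mu>)"
  proof (rule vunit_prodD[OF finS])
    show "(w - \<rho>) / \<mu> \<in> V" if "\<rho> \<in> S" for \<rho>
      using uminus_V[OF V[of \<rho>]] that by (simp add: S_def minus_divide_left)
  qed (use w in \<open>auto simp: S_def\<close>)
  then have "vunit (((w - w') / \<mu>) ^ (card W + card R - 1) * (\<mu> ^ (card W + card R - 1) / of_nat p))"
    by (intro vunit_mult vunit_power pu)
  then show ?thesis using \<mu>(3) by (simp add: power_divide)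
qed

text \<open>The centre 0 is the base point here. There the derivative identity carries the factor 3,
  a unit because \<open>p > 3\<close>, and gives the size of each end; distances between ends follow
  from the identity at \<open>a\<close>.\<close>

lemma black_differences:
  assumes a: "a \<in> A"
  shows "vunit (a ^ (card A + card Q) / of_nat p)"
    and "a' \<in> A \<Longrightarrow> a \<noteq> a' \<Longrightarrow> vunit ((a - a') ^ (card A + card Q) / of_nat p)"
proof -
  define S where "S = A \<union> Q"
  have finS: "finite S" using fin by (simp add: S_def)
  have "finite S" "S \<noteq> {}" "0 \<notin> S" using finS a zero_notin by (auto simp: S_def)
  then obtain \<mu> where \<mu>: "\<mu> \<in> S" "\<And>r. r \<in> S \<Longrightarrow> r / \<mu> \<in> V" "\<mu> \<noteq> 0"
    using exists_max[of S] by metis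
  have p0: "of_nat p \<noteq> (0::complex)" using p_gt_3 by simp
  have sc: "scaled 0 \<mu> p F" by (rule scaled_F) (use \<mu> in \<open>auto simp: S_def\<close>)
  have "vunit (of_nat p * \<mu> ^ ((2 + card Q) + 1) / \<mu> ^ p)"
  proof (rule local_scale[OF sc])
    show "poly F (0 + \<mu>) = 0" using poly_F_black[of \<mu>] \<mu> by (simp add: S_def)
    show "pderiv F = smult (of_nat p) (([:0, 1:] ^ 2 * root_poly Q) * root_poly R)"
      by (rule deriv')
    have "scaled 0 \<mu> (2 * 1 + card Q) ([:0, 1:] ^ 2 * root_poly Q)"
      by (intro scaled_mult scaled_power scaled_root_poly linear_scaled) (use \<mu> fin in \<open>auto simp: S_def\<close>)
    then show "scaled 0 \<mu> (2 + card Q) ([:0, 1:] ^ 2 * root_poly Q)" by simp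
    have "\<mu> \<in> M" using black_M \<mu> by (simp add: S_def)
    then show "near_const (pcompose (root_poly R) [:0, \<mu>:])"
      using vunit_uminus[OF white_vunit] by (intro near_const_root_poly) auto
  qed (fact poly_F_0 \<mu>)+
  moreover have e: "p = ((2 + card Q) + 1) + (card A + card Q)" using card_black by simp
  ultimately have u: "vunit (of_nat p / \<mu> ^ (card A + card Q))"
    using \<mu>(3) by (subst (asm) (2) e) (simp add: power_add)
  then have pu: "vunit (\<mu> ^ (card A + card Q) / of_nat p)"
    using vunit_inverse by fastforce
  have cS: "card S = card A + card Q"
    using fin disjoint by (simp add: S_def card_Un_disjoint)
  have split: "(\<Prod>\<rho>\<in>S. f \<rho>) = (\<Prod>\<rho>\<in>A. f \<rho>) * (\<Prod>\<rho>\<in>Q. f \<rho>)" for f :: "complex \<Rightarrow> complex"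
    unfolding S_def using fin disjoint by (simp add: prod.union_disjoint)
  have unit_R: "vunit (poly (root_poly R) x)" if "x \<in> M" for x
    unfolding poly_root_poly
  proof (rule vunit_prod)
    fix \<rho> assume "\<rho> \<in> R"
    then show "vunit (x - \<rho>)"
      using vunit_uminus[OF vunit_diff_M[OF white_vunit[of \<rho>] that]] by simp
  qed
  have "vunit (of_nat 3)"
    using prime_p p_gt_3 by (intro vunit_of_nat) (auto dest: dvd_imp_le)
  then have u3: "vunit 3" by simp
  have "3 * (\<Prod>\<rho>\<in>S. 0 - \<rho>) = of_nat p * poly (root_poly R) 0"
    using deriv_at_black[of 0] by (simp add: split poly_root_poly mult.assoc)
  then have prod: "(\<Prod>\<rho>\<in>S. 0 - \<rho>) = poly (root_poly R) 0 / 3 * of_nat p" by (simp add: field_simps)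
  have "(\<Prod>\<rho>\<in>S. (0 - \<rho>) / \<mu>) = (\<Prod>\<rho>\<in>S. 0 - \<rho>) / \<mu> ^ card S"
    by (simp only: prod_dividef prod_constant)
  also have "\<dots> = poly (root_poly R) 0 / 3 * (of_nat p / \<mu> ^ (card A + card Q))"
    unfolding prod cS by simp
  finally have "(\<Prod>\<rho>\<in>S. (0 - \<rho>) / \<mu>) = poly (root_poly R) 0 / 3 * (of_nat p / \<mu> ^ (card A + card Q))" .
  then have "vunit (\<Prod>\<rho>\<in>S. (0 - \<rho>) / \<mu>)"
    using vunit_mult[OF vunit_divide[OF unit_R[OF zero_M] u3] u] by simp
  then have "vunit ((0 - a) / \<mu>)"
  proof (rule vunit_prodD[OF finS])
    show "(0 - \<rho>) / \<mu> \<in> V" if "\<rho> \<in> S" for \<rho> using uminus_V[OF \<mu>(2)[OF that]] by simp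
  qed (use a in \<open>auto simp: S_def\<close>)
  then have a\<mu>: "vunit (a / \<mu>)" using vunit_uminus by fastforce
  then have "vunit ((a / \<mu>) ^ (card A + card Q) * (\<mu> ^ (card A + card Q) / of_nat p))"
    by (intro vunit_mult vunit_power pu)
  then show "vunit (a ^ (card A + card Q) / of_nat p)" using \<mu>(3) by (simp add: power_divide)
  assume a': "a' \<in> A" "a \<noteq> a'"
  have aS: "a \<in> S" using a by (simp add: S_def)
  have "a * (\<Prod>\<rho>\<in>S - {a}. a - \<rho>) = a * (\<Prod>\<rho>\<in>A - {a}. a - \<rho>) * (\<Prod>\<rho>\<in>Q. a - \<rho>)"
  proof -
    have "S - {a} = (A - {a}) \<union> Q" "(A - {a}) \<inter> Q = {}" using a disjoint by (auto simp: S_def)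
    then show ?thesis using fin by (simp add: prod.union_disjoint)
  qed
  also have "\<dots> = of_nat p * poly (root_poly R) a"
    using deriv_at_black[of a] a fin poly_root_poly_eq_0[of A a]
    by (simp add: poly_pderiv_root_poly poly_root_poly[of Q])
  finally have "a * (\<Prod>\<rho>\<in>S - {a}. a - \<rho>) = of_nat p * poly (root_poly R) a" .
  \<comment> \<open>Omitting \<open>a\<close> leaves one factor too few; the factor \<open>a\<close>
    itself, its distance to the centre, fills the gap.\<close>
  moreover have "\<mu> ^ (card A + card Q) = \<mu> * \<mu> ^ card (S - {a})"
    using aS finS cS card_Suc_Diff1[OF finS aS] by (metis power_Suc)
  ultimately have eq: "(a / \<mu>) * (\<Prod>\<rho>\<in>S - {a}. (a - \<rho>) / \<mu>) = poly (root_poly R) a * (of_nat p / \<mu> ^ (card A + card Q))"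
    by (simp add: prod_dividef mult.commute)
  have V: "(a - \<rho>) / \<mu> \<in> V" if "\<rho> \<in> S" for \<rho>
    using diff_V[OF \<mu>(2)[OF aS] \<mu>(2)[OF that]] by (simp add: diff_divide_distrib)
  have "vunit ((\<Prod>\<rho>\<in>S - {a}. (a - \<rho>) / \<mu>) * (a / \<mu>))"
    using vunit_mult[OF unit_R[OF black_M[of a]] u] a unfolding eq[symmetric] by (simp only: mult.commute UnCI)
  then have "vunit (\<Prod>\<rho>\<in>S - {a}. (a - \<rho>) / \<mu>)"
    by (rule vunit_multD[rotated 2]) (use V \<mu>(2)[OF aS] in \<open>auto intro: prod_V\<close>)
  then have "vunit ((a - a') / \<mu>)"
    by (rule vunit_prodD[rotated]) (use finS V a' in \<open>auto simp: S_def\<close>)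
  then have "vunit (((a - a') / \<mu>) ^ (card A + card Q) * (\<mu> ^ (card A + card Q) / of_nat p))"
    by (intro vunit_mult vunit_power pu)
  then show "vunit ((a - a') ^ (card A + card Q) / of_nat p)" using \<mu>(3) by (simp add: power_divide)
qed

end

section \<open>The valuation of the invariant\<close>

context tree_poly_valuation
begin

lemma odd_vertex_V: "x \<in> A \<union> W \<Longrightarrow> x \<in> V"
  using black_M[of x] white_vunit[of x] M_V vunit_V by auto

text \<open>Each of the three differences has valuation \<open>1 / h\<close> and the vertices are
  units. A square raised to the power \<open>2 * h\<close> counts every difference four times,
  whence 12.\<close>

lemma discriminant_white:
  assumes A: "A = {}" and W: "W = {x1, x2, x3}" "x1 \<noteq> x2" "x1 \<noteq> x3" "x2 \<noteq> x3"
  shows "vunit ((((x1 - x2) * (x1 - x3) * (x2 - x3) / (x1 * x2 * x3)) ^ 2) ^ (p + 1) / of_nat p powi 12)"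
proof -
  define h where "h = card W + card R - 1"
  have h: "p + 1 = 2 * h" using W card_white by (simp add: h_def)
  have p0: "of_nat p \<noteq> (0::complex)" using p_gt_3 by simp
  define u where "u x y = (x - y) ^ h / of_nat p" for x y :: complex
  have u: "vunit (u x y)" if "x \<in> W" "y \<in> W" "x \<noteq> y" for x y
    using white_differences[OF that] by (simp add: u_def h_def)
  have "(((x1 - x2) * (x1 - x3) * (x2 - x3) / (x1 * x2 * x3)) ^ 2) ^ (p + 1) / of_nat p powi 12
    = ((u x1 x2 * u x1 x3 * u x2 x3) / (x1 * x2 * x3) ^ h) ^ 4"
    unfolding h u_def by (simp add: power_divide power_mult_distrib flip: power_mult) (simp add: mult.commute)
  moreover have "vunit (((u x1 x2 * u x1 x3 * u x2 x3) / (x1 * x2 * x3) ^ h) ^ 4)"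
    by (intro vunit_power vunit_divide vunit_mult u white_vunit) (use W in auto)
  ultimately show ?thesis by simp
qed

text \<open>The difference \<open>a1 - a2\<close> and both \<open>a1\<close> and \<open>a2\<close>
  have valuation \<open>1 / h\<close>; the remaining factors are units. One factor above and two
  below, each counted four times, give \<open>4 - 8 = - 4\<close>.\<close>

lemma discriminant_black:
  assumes A: "A = {a1, a2}" "a1 \<noteq> a2" and W: "W = {w}"
  shows "vunit ((((a1 - a2) * (a1 - w) * (a2 - w) / (a1 * a2 * w)) ^ 2) ^ (p - 1) / of_nat p powi (- 4))"
proof -
  define h where "h = card A + card Q"
  have h: "p - 1 = 2 * h" using A card_black by (simp add: h_def)
  have p0: "of_nat p \<noteq> (0::complex)" using p_gt_3 by simp
  define t where "t = (a1 - w) * (a2 - w) / w"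
  have t: "vunit t"
    using vunit_uminus[OF white_minus_black[of w a1]] vunit_uminus[OF white_minus_black[of w a2]] white_vunit[of w] A W
    unfolding t_def by (intro vunit_mult vunit_divide) auto
  define u v1 v2 where "u = (a1 - a2) ^ h / of_nat p" and "v1 = a1 ^ h / of_nat p" and "v2 = a2 ^ h / of_nat p"
  have u: "vunit u" "vunit v1" "vunit v2"
    using black_differences[of a1] black_differences[of a2] A by (auto simp: u_def v1_def v2_def h_def)
  have nz: "a1 \<noteq> 0" "a2 \<noteq> 0" using A zero_notin by auto
  have e: "(a1 - a2) ^ h = u * of_nat p" "a1 ^ h = v1 * of_nat p" "a2 ^ h = v2 * of_nat p"
    using p0 by (simp_all add: u_def v1_def v2_def)
  have "(((a1 - a2) * (a1 - w) * (a2 - w) / (a1 * a2 * w)) ^ 2) ^ (p - 1) = ((((a1 - a2) / (a1 * a2)) * t) ^ h) ^ 4"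
  proof -
    have "(a1 - a2) * (a1 - w) * (a2 - w) / (a1 * a2 * w) = ((a1 - a2) / (a1 * a2)) * t"
      by (simp add: t_def)
    moreover have "(y ^ 2) ^ (2 * h) = (y ^ h) ^ 4" for y :: complex
      by (simp add: mult.commute flip: power_mult)
    ultimately show ?thesis unfolding h by (simp only:)
  qed
  also have "(((a1 - a2) / (a1 * a2)) * t) ^ h = (u * of_nat p) / ((v1 * of_nat p) * (v2 * of_nat p)) * t ^ h"
    unfolding power_mult_distrib power_divide e ..
  also have "\<dots> = (u / (v1 * v2) * t ^ h) / of_nat p" using p0 by simp
  finally have eq: "(((a1 - a2) * (a1 - w) * (a2 - w) / (a1 * a2 * w)) ^ 2) ^ (p - 1)
     = ((u / (v1 * v2) * t ^ h) / of_nat p) ^ 4" .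
  have "(y / of_nat p) ^ 4 / of_nat p powi (- 4) = y ^ 4" for y :: complex
    using p0 by (simp add: power_divide power_int_minus)
  then show ?thesis
    unfolding eq by (simp only:) (intro vunit_power vunit_divide vunit_mult u t)
qed

end

section \<open>Ramification data of the tree\<close>

lemma degree_eq_sum_order:
  fixes q :: "complex poly"
  assumes "q \<noteq> 0"
  shows "degree q = (\<Sum>z | poly q z = 0. order z q)"
proof -
  have "degree q = degree (smult (lead_coeff q) (\<Prod>z | poly q z = 0. [:- z, 1:] ^ order z q))"
    by (simp only: complex_poly_decompose)
  also have "\<dots> = (\<Sum>z | poly q z = 0. degree ([:- z, 1:] ^ order z q))"
    using assms by (simp add: degree_prod_eq_sum_degree)
  finally show ?thesis by (simp add: degree_power_eq)
qed

context
  fixes \<beta> :: "complex poly"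
  assumes belyi: "belyi_poly \<beta>"
begin

lemma degree_pos: "degree \<beta> > 0" using belyi by (simp add: belyi_poly_def)

lemma beta_nonzero: "\<beta> \<noteq> 0" using degree_pos by auto

lemma shift_nonzero: "\<beta> - [:c:] \<noteq> 0"
proof
  assume "\<beta> - [:c:] = 0"
  then have "\<beta> = [:c:]" by simp
  then show False using degree_pos by simp
qed

lemma pderiv_nonzero: "pderiv \<beta> \<noteq> 0" using degree_pos by (simp add: pderiv_eq_0_iff)

lemma finite_black: "finite (black \<beta>)" and finite_white: "finite (white \<beta>)"
proof -
  show "finite (black \<beta>)" using poly_roots_finite[OF beta_nonzero] by (simp add: black_def)
  have "white \<beta> = {z. poly (\<beta> - [:1:]) z = 0}" by (auto simp: white_def)
  then show "finite (white \<beta>)" using poly_roots_finite[OF shift_nonzero[of 1]] by simp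
qed

lemma black_white_disjoint: "black \<beta> \<inter> white \<beta> = {}" by (auto simp: black_def white_def)

lemma valency_pderiv: "valency \<beta> z = Suc (order z (pderiv \<beta>))"
proof -
  have "pderiv (\<beta> - [:poly \<beta> z:]) = pderiv \<beta>" by (simp add: pderiv_diff pderiv_pCons)
  then show ?thesis
    unfolding valency_def using order_pderiv[OF shift_nonzero[of "poly \<beta> z"], of z] by simp
qed

lemma valency_black: "z \<in> black \<beta> \<Longrightarrow> valency \<beta> z = order z \<beta>"
  and valency_white: "z \<in> white \<beta> \<Longrightarrow> valency \<beta> z = order z (\<beta> - 1)"
  by (simp_all add: valency_def black_def white_def flip: one_pCons)

lemma sum_valency_black: "(\<Sum>z\<in>black \<beta>. valency \<beta> z) = degree \<beta>"
proof -
  show ?thesis using degree_eq_sum_order[OF beta_nonzero] valency_black by (simp add: black_def)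
qed

lemma sum_valency_white: "(\<Sum>z\<in>white \<beta>. valency \<beta> z) = degree \<beta>"
proof -
  have "\<beta> - 1 \<noteq> 0" using shift_nonzero[of 1] by (simp flip: one_pCons)
  moreover have "degree (\<beta> - 1) = degree \<beta>"
    using degree_add_eq_left[of "- 1" \<beta>] degree_pos by simp
  moreover have "{z. poly (\<beta> - 1) z = 0} = white \<beta>" by (auto simp: white_def)
  ultimately show ?thesis using degree_eq_sum_order[of "\<beta> - 1"] valency_white by simp
qed

text \<open>By the Belyi condition every critical point is a vertex, and its multiplicity is one
  less than the valency.\<close>

lemma pderiv_decompose:
  "pderiv \<beta> = smult (of_nat (degree \<beta>) * lead_coeff \<beta>) (\<Prod>z\<in>black \<beta> \<union> white \<beta>. [:- z, 1:] ^ (valency \<beta> z - 1))"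
proof -
  have sub: "{z. poly (pderiv \<beta>) z = 0} \<subseteq> black \<beta> \<union> white \<beta>"
    using belyi by (auto simp: belyi_poly_def black_def white_def)
  have "pderiv \<beta> = smult (lead_coeff (pderiv \<beta>)) (\<Prod>z | poly (pderiv \<beta>) z = 0. [:- z, 1:] ^ order z (pderiv \<beta>))"
    by (simp only: complex_poly_decompose)
  also have "(\<Prod>z | poly (pderiv \<beta>) z = 0. [:- z, 1:] ^ order z (pderiv \<beta>))
    = (\<Prod>z\<in>black \<beta> \<union> white \<beta>. [:- z, 1:] ^ order z (pderiv \<beta>))"
    by (rule prod.mono_neutral_left) (use sub finite_black finite_white in \<open>auto simp: order_root pderiv_nonzero\<close>)
  also have "\<dots> = (\<Prod>z\<in>black \<beta> \<union> white \<beta>. [:- z, 1:] ^ (valency \<beta> z - 1))"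
    by (simp add: valency_pderiv)
  also have "lead_coeff (pderiv \<beta>) = of_nat (degree \<beta>) * lead_coeff \<beta>"
    using degree_pos by (simp add: degree_pderiv coeff_pderiv Suc_pred')
  finally show ?thesis .
qed

text \<open>The Riemann--Hurwitz formula for \<open>\<beta>\<close>.\<close>

lemma card_vertices: "card (black \<beta> \<union> white \<beta>) = degree \<beta> + 1"
proof -
  have fin: "finite (black \<beta> \<union> white \<beta>)" using finite_black finite_white by simp
  have "pderiv \<beta> = smult (of_nat (degree \<beta>) * lead_coeff \<beta>) (\<Prod>z\<in>black \<beta> \<union> white \<beta>. [:- z, 1:] ^ (valency \<beta> z - 1))"
    by (rule pderiv_decompose)
  then have "degree (pderiv \<beta>) = (\<Sum>z\<in>black \<beta> \<union> white \<beta>. valency \<beta> z - 1)"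
    using degree_pos beta_nonzero by (simp add: degree_prod_eq_sum_degree degree_power_eq)
  then have "degree \<beta> - 1 = (\<Sum>z\<in>black \<beta> \<union> white \<beta>. valency \<beta> z - 1)"
    by (simp add: degree_pderiv)
  moreover have "(\<Sum>z\<in>black \<beta> \<union> white \<beta>. valency \<beta> z) = (\<Sum>z\<in>black \<beta> \<union> white \<beta>. (valency \<beta> z - 1) + 1)"
    by (simp add: valency_pderiv)
  moreover have "(\<Sum>z\<in>black \<beta> \<union> white \<beta>. valency \<beta> z) = 2 * degree \<beta>"
    using sum.union_disjoint[OF finite_black finite_white black_white_disjoint, of "valency \<beta>"]
      sum_valency_black sum_valency_white by simp
  ultimately have "2 * degree \<beta> = (degree \<beta> - 1) + card (black \<beta> \<union> white \<beta>)"
    unfolding sum.distrib by simp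
  then show ?thesis using degree_pos by linarith
qed

end

text \<open>The branches meet only in the centre, so their vertices can be counted separately.
  Comparison with \<open>card_vertices\<close> identifies the degree of \<open>\<beta>\<close> with
  the number of edges.\<close>

lemma tree_model_card_vertices:
  assumes "tree_model \<beta> z0 a b c"
  shows "card (black \<beta> \<union> white \<beta>) = a + b + c + 1"
proof -
  have belyi: "belyi_poly \<beta>" and z0: "z0 \<in> black \<beta>" using assms by (auto simp: tree_model_def)
  obtain d \<gamma>1 \<gamma>2 \<gamma>3 where br: "is_branch \<beta> z0 d a \<gamma>1"
    "is_branch \<beta> z0 (cis (2 * pi / 3) * d) b \<gamma>2" "is_branch \<beta> z0 (cis (4 * pi / 3) * d) c \<gamma>3"
    and int: "path_image \<gamma>1 \<inter> path_image \<gamma>2 = {z0}" "path_image \<gamma>1 \<inter> path_image \<gamma>3 = {z0}"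
      "path_image \<gamma>2 \<inter> path_image \<gamma>3 = {z0}"
    and un: "path_image \<gamma>1 \<union> path_image \<gamma>2 \<union> path_image \<gamma>3 = dessin \<beta>"
    using assms unfolding tree_model_def by blast
  define U where "U = black \<beta> \<union> white \<beta>"
  have fin: "finite U" using finite_black[OF belyi] finite_white[OF belyi] by (simp add: U_def)
  have z0X: "z0 \<in> U" using z0 by (simp add: U_def)
  have sub: "U \<subseteq> dessin \<beta>" by (auto simp: U_def black_def white_def dessin_def)
  \<comment> \<open>The count \<open>k + 1\<close> in \<open>is_branch\<close> includes the centre,
    so \<open>k\<close> vertices remain without it.\<close>
  have card1: "card (path_image \<gamma> \<inter> U - {z0}) = k" if "is_branch \<beta> z0 d' k \<gamma>" "z0 \<in> path_image \<gamma>" for d' k \<gamma>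
    using that z0X fin by (simp add: is_branch_def U_def)
  have U: "U = insert z0 ((path_image \<gamma>1 \<inter> U - {z0}) \<union> ((path_image \<gamma>2 \<inter> U - {z0}) \<union> (path_image \<gamma>3 \<inter> U - {z0})))"
    using sub un z0X by blast
  have "card U = Suc (card ((path_image \<gamma>1 \<inter> U - {z0}) \<union> ((path_image \<gamma>2 \<inter> U - {z0}) \<union> (path_image \<gamma>3 \<inter> U - {z0}))))"
    by (subst U, subst card_insert_disjoint) (use fin in auto)
  also have "\<dots> = Suc (a + (b + c))"
  proof -
    have "card ((path_image \<gamma>2 \<inter> U - {z0}) \<union> (path_image \<gamma>3 \<inter> U - {z0})) = b + c"
      by (subst card_Un_disjoint) (use fin int card1[OF br(2)] card1[OF br(3)] in auto)
    then show ?thesis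
      by (subst card_Un_disjoint) (use fin int card1[OF br(1)] in auto)
  qed
  finally show ?thesis by (simp add: U_def)
qed

section \<open>The branch points\<close>

text \<open>At a double root \<open>a\<close> one would have \<open>g2 = 12 * a ^ 2\<close> and
  \<open>g3 = - 8 * a ^ 3\<close>, which makes the discriminant vanish.\<close>

lemma lame_poly_roots:
  assumes "g2 ^ 3 - 27 * g3 ^ 2 \<noteq> 0"
  shows "card {x. poly (lame_poly g2 g3) x = 0} = 3"
    and "lame_poly g2 g3 = smult 4 (root_poly {x. poly (lame_poly g2 g3) x = 0})"
proof -
  let ?f = "lame_poly g2 g3"
  have deg: "degree ?f = 3" and lc: "lead_coeff ?f = 4" by (simp_all add: lame_poly_def numeral_3_eq_3)
  have "rsquarefree ?f"
    unfolding rsquarefree_roots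
  proof (intro allI notI)
    fix a assume "poly ?f a = 0 \<and> poly (pderiv ?f) a = 0"
    then have "g3 = 4 * a ^ 3 - g2 * a" "g2 = 12 * a ^ 2"
      by (simp_all add: lame_poly_def pderiv_pCons power2_eq_square power3_eq_cube algebra_simps)
    then have "g2 ^ 3 - 27 * g3 ^ 2 = (12 * a ^ 2) ^ 3 - 27 * (4 * a ^ 3 - 12 * a ^ 2 * a) ^ 2" by simp
    also have "\<dots> = 0" by (simp add: power2_eq_square power3_eq_cube algebra_simps)
    finally show False using assms by simp
  qed
  then have eq: "smult (lead_coeff ?f) (\<Prod>z | poly ?f z = 0. [:- z, 1:]) = ?f"
    by (rule complex_poly_decompose_rsquarefree)
  then show f: "?f = smult 4 (root_poly {x. poly ?f x = 0})" by (simp add: root_poly_def lc)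
  have "?f \<noteq> 0" using deg by auto
  then have "finite {x. poly ?f x = 0}" by (rule poly_roots_finite)
  then have "degree (smult 4 (root_poly {x. poly ?f x = 0})) = card {x. poly ?f x = 0}"
    by (simp add: degree_root_poly)
  then show "card {x. poly ?f x = 0} = 3" using deg f by simp
qed

lemma moebius_inj:
  assumes "a * d - b * c \<noteq> 0" "moebius a b c d z = moebius a b c d w"
  shows "z = w"
proof -
  have *: "x = y" if "c * x + d \<noteq> 0" "c * y + d \<noteq> 0" "(a * x + b) / (c * x + d) = (a * y + b) / (c * y + d)" for x y
  proof -
    have "(a * x + b) * (c * y + d) = (a * y + b) * (c * x + d)" using that by (simp add: field_simps)
    then have "(a * d - b * c) * (x - y) = 0" by (simp add: algebra_simps)
    then show ?thesis using assms(1) by simp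
  qed
  have **: False if "c \<noteq> 0" "c * x + d \<noteq> 0" "(a * x + b) / (c * x + d) = a / c" for x
  proof -
    have "(a * x + b) * c = a * (c * x + d)" using that by (simp add: field_simps)
    then show False using assms(1) by (simp add: algebra_simps)
  qed
  have ***: "x = y" if "c * x + d = 0" "c * y + d = 0" for x y
  proof -
    have "c \<noteq> 0" using that assms(1) by auto
    moreover have "c * x = c * y" using that by (metis add_right_cancel)
    ultimately show ?thesis by simp
  qed
  have N: "moebius a b c d None \<noteq> moebius a b c d (Some y)" for y
  proof
    assume "moebius a b c d None = moebius a b c d (Some y)"
    then consider "c = 0" "c * y + d = 0" | "c \<noteq> 0" "c * y + d \<noteq> 0" "(a * y + b) / (c * y + d) = a / c"
      by (fastforce simp: moebius_def split: if_splits)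
    then show False
    proof cases
      case 1
      then show ?thesis using assms(1) by simp
    next
      case 2
      then show ?thesis by (rule **)
    qed
  qed
  have S: "x = y" if "moebius a b c d (Some x) = moebius a b c d (Some y)" for x y
  proof -
    from that consider "c * x + d = 0" "c * y + d = 0"
      | "c * x + d \<noteq> 0" "c * y + d \<noteq> 0" "(a * x + b) / (c * x + d) = (a * y + b) / (c * y + d)"
      by (fastforce simp: moebius_def split: if_splits)
    then show ?thesis by cases (fact ***, fact *)
  qed
  show ?thesis
    using assms(2) N S N[symmetric] by (cases z; cases w) blast+
qed

lemma branch_points_moebius:
  assumes "a * d - b * c \<noteq> 0"
  shows "branch_points (weierstrass_curve g2 g3) (moebius a b c d \<circ> x_coord)
    = moebius a b c d ` insert None (Some ` {x. poly (lame_poly g2 g3) x = 0})"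
proof -
  let ?m = "moebius a b c d" and ?E = "weierstrass_curve g2 g3"
  have inj: "?m z = ?m w \<longleftrightarrow> z = w" for z w using moebius_inj[OF assms] by auto
  have "(\<exists>!P. P \<in> ?E \<and> ?m (x_coord P) = q)
    \<longleftrightarrow> q \<in> ?m ` insert None (Some ` {x. poly (lame_poly g2 g3) x = 0})" for q
  proof
    assume ex: "\<exists>!P. P \<in> ?E \<and> ?m (x_coord P) = q"
    then obtain P where P: "P \<in> ?E" "?m (x_coord P) = q"
      and uniq: "\<And>P'. P' \<in> ?E \<Longrightarrow> ?m (x_coord P') = q \<Longrightarrow> P' = P" by blast
    show "q \<in> ?m ` insert None (Some ` {x. poly (lame_poly g2 g3) x = 0})"
    proof (cases P)
      case None
      then show ?thesis using P by (auto simp: x_coord_def)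
    next
      case (Some xy)
      obtain x y where xy: "P = Some (x, y)" using Some by (cases xy) auto
      have "y ^ 2 = poly (lame_poly g2 g3) x" using P(1) by (auto simp: xy weierstrass_curve_def)
      \<comment> \<open>The elliptic involution preserves the fibre, so uniqueness forces
        \<open>y = - y\<close>.\<close>
      moreover have "Some (x, - y) = P"
        by (rule uniq) (use P calculation in \<open>auto simp: xy weierstrass_curve_def x_coord_def\<close>)
      ultimately have "poly (lame_poly g2 g3) x = 0" by (simp add: xy)
      then show ?thesis using P(2) by (auto simp: xy x_coord_def)
    qed
  next
    assume "q \<in> ?m ` insert None (Some ` {x. poly (lame_poly g2 g3) x = 0})"
    then consider "q = ?m None" | x where "q = ?m (Some x)" "poly (lame_poly g2 g3) x = 0" by auto
    then show "\<exists>!P. P \<in> ?E \<and> ?m (x_coord P) = q"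
    proof cases
      case 1
      then show ?thesis
        by (intro ex1I[of _ None]) (auto simp: inj x_coord_def weierstrass_curve_def)
    next
      case 2
      then show ?thesis
        by (intro ex1I[of _ "Some (x, 0)"]) (auto simp: inj x_coord_def weierstrass_curve_def)
    qed
  qed
  then show ?thesis by (auto simp: branch_points_def)
qed

text \<open>The \<open>x\<close>-coordinate with pole at the centre is \<open>B + \<kappa> / (z - z0)\<close>, since the point above infinity
  has \<open>x\<close>-coordinate \<open>B\<close>.\<close>

lemma odd_vertices_lame_roots:
  assumes disc: "g2 ^ 3 - 27 * g3 ^ 2 \<noteq> 0" and \<phi>: "double_cover \<phi>"
    and br: "branch_points (weierstrass_curve g2 g3) \<phi> = Some ` S"
    and o: "\<phi> None = Some z0" and P: "x_coord P = Some B" "\<phi> P = None"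
  obtains \<kappa> where "\<kappa> \<noteq> 0" "z0 \<in> S" "finite S" "card S = 4"
    "{x. poly (lame_poly g2 g3) x = 0} = (\<lambda>q. B + \<kappa> / (q - z0)) ` (S - {z0})"
proof -
  obtain a b c d where m: "a * d - b * c \<noteq> 0" "\<phi> = moebius a b c d \<circ> x_coord"
    using \<phi> by (auto simp: double_cover_def)
  let ?m = "moebius a b c d"
  define Z where "Z = {x. poly (lame_poly g2 g3) x = 0}"
  have Z: "card Z = 3" unfolding Z_def by (rule lame_poly_roots[OF disc])
  then have finZ: "finite Z" by (metis card.infinite zero_neq_numeral)
  have inj: "inj_on ?m T" for T using moebius_inj[OF m(1)] by (auto simp: inj_on_def)
  have S: "Some ` S = ?m ` insert None (Some ` Z)"
    using br branch_points_moebius[OF m(1)] by (simp add: m(2) Z_def)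
  have m0: "?m None = Some z0" using o by (simp add: m(2) x_coord_def)
  then have c: "c \<noteq> 0" "z0 = a / c" by (auto simp: moebius_def split: if_splits)
  have "?m (Some B) = None" using P by (simp add: m(2))
  then have cB: "c * B + d = 0" by (simp add: moebius_def split: if_splits)
  \<comment> \<open>With \<open>c * B + d = 0\<close>, the partial fraction of the Moebius map is
    \<open>z0 + \<kappa> / (e - B)\<close>; its inverse has the same form with \<open>z0\<close> and
    \<open>B\<close> exchanged.\<close>
  define \<kappa> where "\<kappa> = (a * B + b) / c"
  have "c * (a * B + b) = a * (c * B) + b * c" by (simp add: algebra_simps)
  also have "c * B = - d" using cB by (simp add: eq_neg_iff_add_eq_0)
  finally have "c * (a * B + b) = - (a * d - b * c)" by simp
  then have k0: "\<kappa> \<noteq> 0" using m(1) c by (auto simp: \<kappa>_def)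
  have d: "d = - (c * B)" using cB by (simp add: eq_neg_iff_add_eq_0 add.commute)
  have val: "?m (Some e) = Some (z0 + \<kappa> / (e - B))" if "e \<noteq> B" for e
  proof -
    have "c * e + d = c * (e - B)" by (simp add: d algebra_simps)
    moreover have "(a * e + b) / (c * (e - B)) = a / c + ((a * B + b) / c) / (e - B)"
      using c that by (simp add: field_simps)
    ultimately show ?thesis using c that by (simp add: moebius_def \<kappa>_def)
  qed
  have "card (Some ` S) = 4"
    unfolding S by (subst card_image[OF inj]) (use finZ Z in \<open>auto simp: card_image\<close>)
  then have cS: "card S = 4" by (simp add: card_image)
  then have finS: "finite S" by (metis card.infinite zero_neq_numeral)
  have "?m None \<in> Some ` S" unfolding S by simp
  then have z0S: "z0 \<in> S" by (auto simp: m0)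
  have notB: "e \<noteq> B" if "e \<in> Z" for e
  proof
    assume "e = B"
    then have "?m (Some B) \<in> Some ` S" unfolding S using that by blast
    then show False using \<open>?m (Some B) = None\<close> by auto
  qed
  have "Z = (\<lambda>q. B + \<kappa> / (q - z0)) ` (S - {z0})"
  proof (intro equalityI subsetI)
    fix e assume e: "e \<in> Z"
    have "Some (z0 + \<kappa> / (e - B)) \<in> Some ` S"
      unfolding S val[OF notB[OF e], symmetric] using e by auto
    then have "z0 + \<kappa> / (e - B) \<in> S - {z0}" using k0 notB[OF e] by auto
    moreover have "e = B + \<kappa> / ((z0 + \<kappa> / (e - B)) - z0)" using k0 notB[OF e] by simp
    ultimately show "e \<in> (\<lambda>q. B + \<kappa> / (q - z0)) ` (S - {z0})" by blast
  next
    fix e assume "e \<in> (\<lambda>q. B + \<kappa> / (q - z0)) ` (S - {z0})"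
    then obtain q where q: "q \<in> S" "q \<noteq> z0" "e = B + \<kappa> / (q - z0)" by auto
    then have "Some q \<in> ?m ` insert None (Some ` Z)" using S by auto
    then obtain e' where "e' \<in> Z" "Some q = ?m (Some e')" using m0 q(2) by auto
    then have "q = z0 + \<kappa> / (e' - B)" "e' \<in> Z" "e' \<noteq> B" using val notB by auto
    then show "e \<in> Z" using q k0 by simp
  qed
  then show ?thesis using that[of \<kappa>] k0 z0S finS cS by (simp add: Z_def)
qed

section \<open>Normal form of the tree polynomial\<close>

text \<open>Parity gives the lower bound \<open>l\<close> for the valencies. Its sum is
  \<open>3 + 3 + 2 * (p - 3) = 2 * p\<close>, which is also the sum of the valencies, so equality
  holds at every vertex.\<close>

lemma tree_valencies:
  assumes belyi: "belyi_poly \<beta>" and card: "card (black \<beta> \<union> white \<beta>) = p + 1" and p: "p > 3"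
    and odd: "card (odd_vertices \<beta>) = 4" and z0: "z0 \<in> black \<beta>" "valency \<beta> z0 = 3"
  shows "degree \<beta> = p"
    and "z \<in> black \<beta> \<union> white \<beta> \<Longrightarrow>
      valency \<beta> z = (if z = z0 then 3 else if z \<in> odd_vertices \<beta> then 1 else 2)"
proof -
  show deg: "degree \<beta> = p" using card_vertices[OF belyi] card by simp
  define U where "U = black \<beta> \<union> white \<beta>"
  have fin: "finite U" using finite_black[OF belyi] finite_white[OF belyi] by (simp add: U_def)
  have O: "odd_vertices \<beta> \<subseteq> U" "z0 \<in> odd_vertices \<beta>" using z0 by (auto simp: odd_vertices_def U_def)
  have finO: "finite (odd_vertices \<beta>)" using finite_subset[OF O(1) fin] .
  define l where "l z = (if z = z0 then 3 else if z \<in> odd_vertices \<beta> then 1 else 2 :: nat)" for z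
  have le: "l z \<le> valency \<beta> z" if "z \<in> U" for z
  proof -
    have "even (valency \<beta> z)" if "z \<notin> odd_vertices \<beta>" using that \<open>z \<in> U\<close> by (auto simp: odd_vertices_def U_def)
    then have "2 \<le> valency \<beta> z" if "z \<notin> odd_vertices \<beta>"
      using that valency_pderiv[OF belyi, of z] by (cases "valency \<beta> z = 1") auto
    then show ?thesis using z0 valency_pderiv[OF belyi, of z] by (auto simp: l_def)
  qed
  have "sum l U = sum l (odd_vertices \<beta>) + sum l (U - odd_vertices \<beta>)"
    using sum.subset_diff[OF O(1) fin, of l] by simp
  also have "sum l (odd_vertices \<beta>) = l z0 + sum l (odd_vertices \<beta> - {z0})"
    by (rule sum.remove[OF finO O(2)])
  also have "sum l (odd_vertices \<beta> - {z0}) = card (odd_vertices \<beta> - {z0})"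
    unfolding card_eq_sum by (rule sum.cong) (auto simp: l_def)
  also have "sum l (U - odd_vertices \<beta>) = (\<Sum>z\<in>U - odd_vertices \<beta>. 2)"
    by (rule sum.cong) (use O in \<open>auto simp: l_def\<close>)
  also have "\<dots> = 2 * card (U - odd_vertices \<beta>)" by simp
  finally have "sum l U = 2 * p"
    using O odd card p fin finO by (simp add: l_def U_def card_Diff_subset)
  moreover have "(\<Sum>z\<in>U. valency \<beta> z) = 2 * p"
    unfolding U_def
    using sum.union_disjoint[OF finite_black[OF belyi] finite_white[OF belyi] black_white_disjoint[OF belyi], of "valency \<beta>"]
      sum_valency_black[OF belyi] sum_valency_white[OF belyi] deg by simp
  ultimately have "sum l U = sum (valency \<beta>) U" by simp
  then have "l z = valency \<beta> z" if "z \<in> U" for z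
    using sum_mono_inv[of l U "valency \<beta>" z] le that fin by auto
  then show "z \<in> black \<beta> \<union> white \<beta> \<Longrightarrow>
      valency \<beta> z = (if z = z0 then 3 else if z \<in> odd_vertices \<beta> then 1 else 2)"
    by (simp add: l_def U_def)
qed

lemma pcompose_root_poly:
  fixes S :: "'a::field set"
  assumes "finite S" "\<nu> \<noteq> 0"
  shows "pcompose (root_poly S) [:z0, 1 / \<nu>:] = smult ((1 / \<nu>) ^ card S) (root_poly ((\<lambda>z. (z - z0) * \<nu>) ` S))"
  using assms(1)
proof (induction S rule: finite_induct)
  case empty
  then show ?case by (simp add: root_poly_def pcompose_1)
next
  case (insert x F)
  have notin: "(x - z0) * \<nu> \<notin> (\<lambda>z. (z - z0) * \<nu>) ` F" using insert(2) assms(2) by auto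
  have 1: "root_poly (insert x F) = [:- x, 1:] * root_poly F"
    using insert(1,2) unfolding root_poly_def by (rule prod.insert)
  have 2: "root_poly ((\<lambda>z. (z - z0) * \<nu>) ` insert x F)
      = [:- ((x - z0) * \<nu>), 1:] * root_poly ((\<lambda>z. (z - z0) * \<nu>) ` F)"
    unfolding root_poly_def image_insert by (rule prod.insert) (use notin insert(1) in auto)
  have 3: "pcompose [:- x, 1:] [:z0, 1 / \<nu>:] = smult (1 / \<nu>) [:- ((x - z0) * \<nu>), 1:]"
    using assms(2) by (simp add: pcompose_pCons field_simps)
  show ?case
    unfolding 1 2 pcompose_mult 3 insert.IH card_insert_disjoint[OF insert(1,2)]
    by (simp only: mult_smult_left mult_smult_right smult_smult power_Suc mult.commute[of "1 / \<nu>"])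
qed

lemma tree_poly_normal_form:
  assumes belyi: "belyi_poly \<beta>" and card: "card (black \<beta> \<union> white \<beta>) = p + 1"
    and p: "Factorial_Ring.prime p" "p > 3"
    and odd: "card (odd_vertices \<beta>) = 4" and z0: "z0 \<in> black \<beta>" "valency \<beta> z0 = 3"
  obtains A Q W R \<nu> where "\<nu> \<noteq> 0" "tree_poly p A Q W R" "card A = signature \<beta>"
    "A \<union> W = (\<lambda>z. (z - z0) * \<nu>) ` (odd_vertices \<beta> - {z0})"
proof -
  note val = tree_valencies[OF belyi card p(2) odd z0]
  note deg = val(1)
  define A0 Q0 W0 R0 where "A0 = {z \<in> black \<beta>. valency \<beta> z = 1}" and "Q0 = {z \<in> black \<beta>. valency \<beta> z = 2}"
    and "W0 = {z \<in> white \<beta>. valency \<beta> z = 1}" and "R0 = {z \<in> white \<beta>. valency \<beta> z = 2}"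
  note defs = A0_def Q0_def W0_def R0_def
  have finb: "finite (black \<beta>)" and finw: "finite (white \<beta>)" using finite_black[OF belyi] finite_white[OF belyi] .
  have fin: "finite A0" "finite Q0" "finite W0" "finite R0" using finb finw by (simp_all add: defs)
  have z0w: "z0 \<notin> white \<beta>" using z0 black_white_disjoint[OF belyi] by auto
  have black: "black \<beta> = insert z0 (A0 \<union> Q0)" using val(2) z0 by (auto simp: defs split: if_splits)
  have white: "white \<beta> = W0 \<union> R0" using val(2) z0w by (auto simp: defs split: if_splits)
  have z0n: "z0 \<notin> A0" "z0 \<notin> Q0" using z0(2) by (auto simp: defs)
  have dis: "A0 \<inter> Q0 = {}" "W0 \<inter> R0 = {}" "A0 \<inter> W0 = {}" "Q0 \<inter> R0 = {}" by (auto simp: defs black_def white_def)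
  have odd_eq: "A0 \<union> W0 = odd_vertices \<beta> - {z0}"
  proof (intro equalityI subsetI)
    fix z assume "z \<in> A0 \<union> W0"
    then show "z \<in> odd_vertices \<beta> - {z0}" using z0(2) by (auto simp: defs odd_vertices_def)
  next
    fix z assume z: "z \<in> odd_vertices \<beta> - {z0}"
    then have "z \<in> black \<beta> \<union> white \<beta>" by (simp add: odd_vertices_def)
    moreover from val(2)[OF this] z have "valency \<beta> z = 1" by simp
    ultimately show "z \<in> A0 \<union> W0" by (simp add: defs)
  qed
  have O: "z0 \<in> odd_vertices \<beta>" using z0 by (auto simp: odd_vertices_def)
  have "finite (odd_vertices \<beta>)" using odd by (metis card.infinite zero_neq_numeral)
  then have "card (A0 \<union> W0) = 3" using odd O by (simp add: odd_eq)
  then have c3: "card A0 + card W0 = 3" using card_Un_disjoint[OF fin(1,3) dis(3)] by simp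
  have prod_b: "(\<Prod>z\<in>black \<beta>. f z) = f z0 * ((\<Prod>z\<in>A0. f z) * (\<Prod>z\<in>Q0. f z))" for f :: "complex \<Rightarrow> complex poly"
    unfolding black using fin z0n dis by (simp add: prod.union_disjoint)
  have prod_w: "(\<Prod>z\<in>white \<beta>. f z) = (\<Prod>z\<in>W0. f z) * (\<Prod>z\<in>R0. f z)" for f :: "complex \<Rightarrow> complex poly"
    unfolding white using fin dis by (simp add: prod.union_disjoint)
  have pA: "(\<Prod>z\<in>A0. [:- z, 1:] ^ valency \<beta> z) = root_poly A0" "(\<Prod>z\<in>W0. [:- z, 1:] ^ valency \<beta> z) = root_poly W0"
    unfolding root_poly_def by (auto simp: defs intro!: prod.cong)
  have pQ: "(\<Prod>z\<in>Q0. [:- z, 1:] ^ valency \<beta> z) = root_poly Q0 ^ 2" "(\<Prod>z\<in>R0. [:- z, 1:] ^ valency \<beta> z) = root_poly R0 ^ 2"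
    unfolding root_poly_def prod_power_distrib by (auto simp: defs intro!: prod.cong)
  have pA1: "(\<Prod>z\<in>A0. [:- z, 1:] ^ (valency \<beta> z - 1)) = 1" "(\<Prod>z\<in>W0. [:- z, 1:] ^ (valency \<beta> z - 1)) = (1 :: complex poly)"
    by (auto simp: defs intro!: prod.neutral)
  have pQ1: "(\<Prod>z\<in>Q0. [:- z, 1:] ^ (valency \<beta> z - 1)) = root_poly Q0" "(\<Prod>z\<in>R0. [:- z, 1:] ^ (valency \<beta> z - 1)) = root_poly R0"
    unfolding root_poly_def by (auto simp: defs intro!: prod.cong)
  define c where "c = lead_coeff \<beta>"
  have c0: "c \<noteq> 0" using beta_nonzero[OF belyi] by (simp add: c_def)
  have "\<beta> = smult c (\<Prod>z\<in>black \<beta>. [:- z, 1:] ^ order z \<beta>)"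
    using complex_poly_decompose[of \<beta>] by (simp add: c_def black_def)
  also have "(\<Prod>z\<in>black \<beta>. [:- z, 1:] ^ order z \<beta>) = (\<Prod>z\<in>black \<beta>. [:- z, 1:] ^ valency \<beta> z)"
    by (rule prod.cong) (simp_all add: valency_black[OF belyi])
  also have "\<dots> = [:- z0, 1:] ^ 3 * (root_poly A0 * root_poly Q0 ^ 2)" unfolding prod_b pA pQ z0(2) ..
  finally have b1: "\<beta> = smult c ([:- z0, 1:] ^ 3 * (root_poly A0 * root_poly Q0 ^ 2))" .
  have degw: "degree (\<beta> - 1) = degree \<beta>"
    using degree_add_eq_left[of "- 1" \<beta>] degree_pos[OF belyi] by simp
  then have "lead_coeff (\<beta> - 1) = c" using degree_pos[OF belyi] by (simp add: c_def coeff_eq_0)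
  moreover have "{z. poly (\<beta> - 1) z = 0} = white \<beta>" by (auto simp: white_def)
  ultimately have "\<beta> - 1 = smult c (\<Prod>z\<in>white \<beta>. [:- z, 1:] ^ order z (\<beta> - 1))"
    using complex_poly_decompose[of "\<beta> - 1"] by simp
  also have "(\<Prod>z\<in>white \<beta>. [:- z, 1:] ^ order z (\<beta> - 1)) = (\<Prod>z\<in>white \<beta>. [:- z, 1:] ^ valency \<beta> z)"
    by (rule prod.cong) (simp_all add: valency_white[OF belyi])
  also have "\<dots> = root_poly W0 * root_poly R0 ^ 2" unfolding prod_w pA pQ ..
  finally have w1: "\<beta> - 1 = smult c (root_poly W0 * root_poly R0 ^ 2)" .
  have "(\<Prod>z\<in>black \<beta> \<union> white \<beta>. [:- z, 1:] ^ (valency \<beta> z - 1))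
    = ([:- z0, 1:] ^ 2 * root_poly Q0) * root_poly R0"
    using prod.union_disjoint[OF finb finw black_white_disjoint[OF belyi], of "\<lambda>z. [:- z, 1:] ^ (valency \<beta> z - 1)"]
    unfolding prod_b prod_w pA1 pQ1 z0(2) by simp
  then have d1: "pderiv \<beta> = smult (of_nat p * c) ([:- z0, 1:] ^ 2 * root_poly Q0 * root_poly R0)"
    using pderiv_decompose[OF belyi] deg by (simp add: c_def)
  have degb: "3 + card A0 + 2 * card Q0 = p"
  proof -
    have "p = degree (smult c ([:- z0, 1:] ^ 3 * (root_poly A0 * root_poly Q0 ^ 2)))" using b1 deg by simp
    also have "\<dots> = 3 + card A0 + 2 * card Q0"
      using c0 root_poly_nonzero[of A0] root_poly_nonzero[of Q0] fin
      by (simp add: degree_mult_eq degree_power_eq degree_root_poly)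
    finally show ?thesis by simp
  qed
  have degww: "card W0 + 2 * card R0 = p"
  proof -
    have "p = degree (smult c (root_poly W0 * root_poly R0 ^ 2))" using w1 degw deg by simp
    also have "\<dots> = card W0 + 2 * card R0"
      using c0 root_poly_nonzero[of W0] root_poly_nonzero[of R0] fin
      by (simp add: degree_mult_eq degree_power_eq degree_root_poly)
    finally show ?thesis by simp
  qed
  \<comment> \<open>Scaling by a \<open>p\<close>-th root of the leading coefficient makes the
    polynomial monic.\<close>
  have "card {z. z ^ p = c} = p" using c0 p by (intro card_nth_roots) auto
  then have "{z. z ^ p = c} \<noteq> {}" using p(2) by (intro notI) simp
  then obtain \<nu> where \<nu>: "\<nu> ^ p = c" by auto
  have \<nu>0: "\<nu> \<noteq> 0" using \<nu> c0 p(2) by (auto simp: zero_power)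
  define T where "T = (\<lambda>z. (z - z0) * \<nu>)"
  have injT: "inj_on T S" for S using \<nu>0 by (auto simp: T_def inj_on_def)
  let ?L = "[:z0, 1 / \<nu>:]"
  have comp: "pcompose (root_poly S) ?L = smult ((1 / \<nu>) ^ card S) (root_poly (T ` S))" if "finite S" for S
    unfolding T_def by (rule pcompose_root_poly[OF that \<nu>0])
  have comp0: "pcompose [:- z0, 1:] ?L = smult (1 / \<nu>) [:0, 1:]" by (simp add: pcompose_pCons)
  define A Q W R where "A = T ` A0" and "Q = T ` Q0" and "W = T ` W0" and "R = T ` R0"
  note defs' = A_def Q_def W_def R_def
  have crd: "card A = card A0" "card Q = card Q0" "card W = card W0" "card R = card R0"
    using card_image[OF injT] by (simp_all add: defs')
  have cp: "c * (1 / \<nu>) ^ p = 1" using \<nu> \<nu>0 c0 by (simp add: power_divide)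
  have Lb: "pcompose \<beta> ?L = [:0, 1:] ^ 3 * root_poly A * root_poly Q ^ 2"
  proof -
    have "pcompose \<beta> ?L = smult (c * (1 / \<nu>) ^ (3 + card A0 + (card Q0 + card Q0))) ([:0, 1:] ^ 3 * root_poly A * root_poly Q ^ 2)"
      by (subst b1)
        (simp only: pcompose_smult pcompose_mult power2_eq_square power3_eq_cube comp comp0 fin mult_smult_left
          mult_smult_right smult_smult, simp only: power_add power2_eq_square power3_eq_cube mult_ac defs')
    then show ?thesis unfolding mult_2[symmetric] degb cp by simp
  qed
  have Lw: "pcompose (\<beta> - 1) ?L = root_poly W * root_poly R ^ 2"
  proof -
    have "pcompose (\<beta> - 1) ?L = smult (c * (1 / \<nu>) ^ (card W0 + (card R0 + card R0))) (root_poly W * root_poly R ^ 2)"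
      by (subst w1)
        (simp only: pcompose_smult pcompose_mult power2_eq_square comp fin mult_smult_left
          mult_smult_right smult_smult, simp add: power_add power2_eq_square mult_ac defs')
    then show ?thesis unfolding mult_2[symmetric] degww cp by simp
  qed
  have Ld: "pderiv (pcompose \<beta> ?L) = smult (of_nat p) ([:0, 1:] ^ 2 * root_poly Q * root_poly R)"
  proof -
    have "pderiv (pcompose \<beta> ?L) = smult (1 / \<nu>) (pcompose (pderiv \<beta>) ?L)"
      by (simp add: pderiv_pcompose pderiv_pCons)
    also have "pcompose (pderiv \<beta>) ?L
      = smult (of_nat p * c * (1 / \<nu>) ^ (2 + card Q0 + card R0)) ([:0, 1:] ^ 2 * root_poly Q * root_poly R)"
      by (subst d1)
        (simp only: pcompose_smult pcompose_mult power2_eq_square comp comp0 fin mult_smult_left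
          mult_smult_right smult_smult, simp add: power_add power2_eq_square mult_ac defs')
    \<comment> \<open>The chain rule adds one factor \<open>1 / \<nu>\<close> to the
      \<open>p - 1\<close> from the zeros of the derivative, so that \<open>cp\<close> applies
      again.\<close>
    also have "smult (1 / \<nu>) \<dots> = smult (of_nat p * (c * (1 / \<nu>) ^ (3 + card Q0 + card R0))) ([:0, 1:] ^ 2 * root_poly Q * root_poly R)"
      by (simp add: power_add power2_eq_square power3_eq_cube mult_ac)
    also have "3 + card Q0 + card R0 = p" using degb degww c3 by linarith
    finally show ?thesis using cp by simp
  qed
  have "tree_poly p A Q W R"
  proof
    show "0 \<notin> A" "0 \<notin> Q" using z0n \<nu>0 by (auto simp: defs' T_def)
    show "A \<inter> Q = {}" "W \<inter> R = {}"
      by (simp_all add: defs' dis flip: image_Int[OF injT])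
    show "[:0, 1:] ^ 3 * root_poly A * root_poly Q ^ 2 - 1 = root_poly W * root_poly R ^ 2"
      using Lw by (simp add: pcompose_diff pcompose_1 Lb)
    show "pderiv ([:0, 1:] ^ 3 * root_poly A * root_poly Q ^ 2) = smult (of_nat p) ([:0, 1:] ^ 2 * root_poly Q * root_poly R)"
      using Ld by (simp only: Lb)
  qed (use p fin degb degww c3 crd in \<open>auto simp: defs'\<close>)
  moreover have "A \<union> W = T ` (odd_vertices \<beta> - {z0})"
    unfolding odd_eq[symmetric] by (simp add: defs' image_Un)
  moreover have "card A = signature \<beta>" by (simp add: crd signature_def A0_def)
  ultimately show ?thesis using that[OF \<nu>0] by (simp add: T_def)
qed

section \<open>Invariants of the Lame operator\<close>

lemma lame_coefficients:
  assumes "lame_poly g2 g3 = smult 4 (root_poly {e1, e2, e3})" "e1 \<noteq> e2" "e1 \<noteq> e3" "e2 \<noteq> e3"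
  shows "e3 = - e1 - e2" "g2 = - 4 * (e1 * e2 + e1 * e3 + e2 * e3)" "g3 = 4 * (e1 * e2 * e3)"
proof -
  have "root_poly {e1, e2, e3} = [:- e1, 1:] * [:- e2, 1:] * [:- e3, 1:]"
    using assms(2-4) by (simp add: root_poly_def del: mult_pCons_left mult_pCons_right)
  then have eq: "lame_poly g2 g3 = smult 4 ([:- e1, 1:] * [:- e2, 1:] * [:- e3, 1:])" using assms(1) by simp
  have "coeff (lame_poly g2 g3) 2 = - 4 * (e1 + e2 + e3)"
    unfolding eq by (simp add: numeral_2_eq_2 algebra_simps)
  then have "- 4 * (e1 + e2 + e3) = 0" by (simp add: lame_poly_def numeral_2_eq_2)
  then have "e1 + e2 + e3 = 0" by (metis mult_eq_0_iff neg_equal_0_iff_equal zero_neq_numeral)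
  then show "e3 = - e1 - e2" by (simp add: eq_neg_iff_add_eq_0 algebra_simps)
  have "coeff (lame_poly g2 g3) 1 = 4 * (e1 * e2 + e1 * e3 + e2 * e3)"
    unfolding eq by (simp add: algebra_simps)
  then have "- g2 = 4 * (e1 * e2 + e1 * e3 + e2 * e3)" by (simp add: lame_poly_def)
  then show "g2 = - 4 * (e1 * e2 + e1 * e3 + e2 * e3)" by (metis minus_minus mult_minus_left)
  have "coeff (lame_poly g2 g3) 0 = - 4 * (e1 * e2 * e3)"
    unfolding eq by (simp add: algebra_simps)
  then show "g3 = 4 * (e1 * e2 * e3)" by (simp add: lame_poly_def)
qed

text \<open>The denominator is the square of the cubic at \<open>B\<close> and has weight 6 like the
  discriminant. It brings in the position of the ends relative to the centre, since
  \<open>B - e\<close> is a constant over an end for each root \<open>e\<close>.\<close>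

definition lame_invariant :: "complex \<Rightarrow> complex \<Rightarrow> complex \<Rightarrow> complex" where
  "lame_invariant g2 g3 B = (g2 ^ 3 - 27 * g3 ^ 2) / (4 * B ^ 3 - g2 * B - g3) ^ 2"

lemma lame_invariant_scale:
  assumes "u \<noteq> 0"
  shows "lame_invariant (u ^ 2 * g2) (u ^ 3 * g3) (u * B) = lame_invariant g2 g3 B"
proof -
  have "(u ^ 2 * g2) ^ 3 - 27 * (u ^ 3 * g3) ^ 2 = u ^ 6 * (g2 ^ 3 - 27 * g3 ^ 2)"
    by (simp add: power_mult_distrib right_diff_distrib flip: power_mult)
  moreover have "(4 * (u * B) ^ 3 - u ^ 2 * g2 * (u * B) - u ^ 3 * g3) ^ 2 = u ^ 6 * (4 * B ^ 3 - g2 * B - g3) ^ 2"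
  proof -
    have "4 * (u * B) ^ 3 - u ^ 2 * g2 * (u * B) - u ^ 3 * g3 = u ^ 3 * (4 * B ^ 3 - g2 * B - g3)"
      by (simp add: power2_eq_square power3_eq_cube algebra_simps)
    then show ?thesis by (simp add: power_mult_distrib flip: power_mult)
  qed
  ultimately show ?thesis using assms by (simp add: lame_invariant_def)
qed

lemma lame_invariant_in_subfield:
  assumes "complex_subfield F" "g2 \<in> F" "g3 \<in> F" "B \<in> F"
  shows "lame_invariant g2 g3 B \<in> F"
proof -
  interpret complex_subfield F by fact
  have "27 \<in> F" "4 \<in> F" using of_nat_K[of 27] of_nat_K[of 4] by simp_all
  then show ?thesis
    unfolding lame_invariant_def using assms(2-4) by (intro divide_K diff_K mult_K power_K)
qed

text \<open>Differences of roots are \<open>- k * (x - y) / (x * y)\<close>, and \<open>B\<close>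
  minus a root is \<open>- k / x\<close>. The factor \<open>16 * k ^ 6\<close> occurs in numerator
  and denominator and cancels.\<close>

lemma lame_invariant_eq:
  assumes e: "lame_poly g2 g3 = smult 4 (root_poly {B + k / x1, B + k / x2, B + k / x3})"
    and d: "x1 \<noteq> x2" "x1 \<noteq> x3" "x2 \<noteq> x3" and nz: "k \<noteq> 0" "x1 \<noteq> 0" "x2 \<noteq> 0" "x3 \<noteq> 0"
  shows "lame_invariant g2 g3 B = ((x1 - x2) * (x1 - x3) * (x2 - x3) / (x1 * x2 * x3)) ^ 2"
proof -
  define e1 e2 e3 where "e1 = B + k / x1" and "e2 = B + k / x2" and "e3 = B + k / x3"
  note defs = e1_def e2_def e3_def
  have e': "lame_poly g2 g3 = smult 4 (root_poly {e1, e2, e3})" using e by (simp add: defs)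
  have dist: "e1 \<noteq> e2" "e1 \<noteq> e3" "e2 \<noteq> e3" using d nz by (simp_all add: defs)
  note coeffs = lame_coefficients[OF e' dist]
  have num: "g2 ^ 3 - 27 * g3 ^ 2 = 16 * ((e1 - e2) * (e1 - e3) * (e2 - e3)) ^ 2"
    unfolding coeffs(2,3) coeffs(1) by (simp add: power2_eq_square power3_eq_cube algebra_simps)
  have "root_poly {e1, e2, e3} = [:- e1, 1:] * [:- e2, 1:] * [:- e3, 1:]"
    using dist by (simp add: root_poly_def del: mult_pCons_left mult_pCons_right)
  then have "poly (lame_poly g2 g3) B = 4 * ((B - e1) * (B - e2) * (B - e3))"
    unfolding e' by (simp del: mult_pCons_left mult_pCons_right)
  moreover have "poly (lame_poly g2 g3) B = 4 * B ^ 3 - g2 * B - g3"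
    by (simp add: lame_poly_def power3_eq_cube algebra_simps)
  ultimately have den: "4 * B ^ 3 - g2 * B - g3 = 4 * ((B - e1) * (B - e2) * (B - e3))" by simp
  have kd: "(B + k / x) - (B + k / y) = - k * (x - y) / (x * y)" if "x \<noteq> 0" "y \<noteq> 0" for x y
    using that by (simp add: diff_frac_eq right_diff_distrib mult.commute)
  have diff: "e1 - e2 = - k * (x1 - x2) / (x1 * x2)" "e1 - e3 = - k * (x1 - x3) / (x1 * x3)"
    "e2 - e3 = - k * (x2 - x3) / (x2 * x3)" unfolding defs by (rule kd; fact nz)+
  have B: "B - e1 = - k / x1" "B - e2 = - k / x2" "B - e3 = - k / x3" by (simp_all add: defs)
  have "lame_invariant g2 g3 B = (((e1 - e2) * (e1 - e3) * (e2 - e3)) / ((B - e1) * (B - e2) * (B - e3))) ^ 2"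
    unfolding lame_invariant_def num den by (simp add: power_divide power_mult_distrib)
  also have "((e1 - e2) * (e1 - e3) * (e2 - e3)) / ((B - e1) * (B - e2) * (B - e3))
    = (x1 - x2) * (x1 - x3) * (x2 - x3) / (x1 * x2 * x3)"
    unfolding diff B using nz by (simp add: field_simps)
  finally show ?thesis .
qed

text \<open>Scaling by \<open>u = x1 x2 x3 / k\<close> turns \<open>k / x\<close> into the product of the other two odd vertices.\<close>

lemma lame_coefficients_integral:
  assumes e: "lame_poly g2 g3 = smult 4 (root_poly {B + k / x1, B + k / x2, B + k / x3})"
    and d: "x1 \<noteq> x2" "x1 \<noteq> x3" "x2 \<noteq> x3" and nz: "k \<noteq> 0" "x1 \<noteq> 0" "x2 \<noteq> 0" "x3 \<noteq> 0"
    and V: "valuation_ring V M" "x1 \<in> V" "x2 \<in> V" "x3 \<in> V" "inverse 3 \<in> V"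
  defines "u \<equiv> x1 * x2 * x3 / k"
  shows "u ^ 2 * g2 \<in> V" "u ^ 3 * g3 \<in> V" "u * B \<in> V"
proof -
  interpret valuation_ring V M by fact
  define e1 e2 e3 where "e1 = B + k / x1" and "e2 = B + k / x2" and "e3 = B + k / x3"
  note defs = e1_def e2_def e3_def
  have e': "lame_poly g2 g3 = smult 4 (root_poly {e1, e2, e3})" using e by (simp add: defs)
  have dist: "e1 \<noteq> e2" "e1 \<noteq> e3" "e2 \<noteq> e3" using d nz by (simp_all add: defs)
  note coeffs = lame_coefficients[OF e' dist]
  have ue: "u * e1 = u * B + x2 * x3" "u * e2 = u * B + x1 * x3" "u * e3 = u * B + x1 * x2"
    using nz by (simp_all add: u_def defs distrib_left)
  \<comment> \<open>The roots of the cubic sum to 0, which determines \<open>u * B\<close> from the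
    vertices up to a division by 3.\<close>
  have "u * e1 + u * e2 + u * e3 = 0" unfolding coeffs(1) by (simp add: algebra_simps)
  then have "3 * (u * B) = - (x2 * x3 + x1 * x3 + x1 * x2)"
    unfolding ue by (simp add: eq_neg_iff_add_eq_0 algebra_simps)
  then have "u * B = inverse 3 * - (x2 * x3 + x1 * x3 + x1 * x2)" by (simp add: field_simps)
  moreover have "inverse 3 * - (x2 * x3 + x1 * x3 + x1 * x2) \<in> V" by (intro mult_V uminus_V add_V V)
  ultimately show uB: "u * B \<in> V" by (simp only:)
  have eV: "u * e1 \<in> V" "u * e2 \<in> V" "u * e3 \<in> V" unfolding ue using uB V by (auto intro: add_V mult_V)
  have sym: "of_int (- 4) * (x * y + x * z + y * z) \<in> V" "of_int 4 * (x * y * z) \<in> V"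
    if "x \<in> V" "y \<in> V" "z \<in> V" for x y z
    using that by (intro mult_V add_V of_int_V; simp)+
  have "u ^ 2 * g2 = of_int (- 4) * ((u * e1) * (u * e2) + (u * e1) * (u * e3) + (u * e2) * (u * e3))"
    unfolding coeffs(2) by (simp add: power2_eq_square algebra_simps)
  then show "u ^ 2 * g2 \<in> V" using sym(1)[OF eV] by (simp only:)
  have "u ^ 3 * g3 = of_int 4 * ((u * e1) * (u * e2) * (u * e3))"
    unfolding coeffs(3) by (simp add: power3_eq_cube algebra_simps)
  then show "u ^ 3 * g3 \<in> V" using sym(2)[OF eV] by (simp only:)
qed

text \<open>The field of moduli inherits the degree bound from the field generated by one algebraic
  representative. The invariant has the same value at all representatives, so it lies in every field
  of the intersection.\<close>

lemma number_field_field_of_moduli: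
  assumes "u \<noteq> 0" "algebraic (u ^ 2 * g2)" "algebraic (u ^ 3 * g3)" "algebraic (u * B)"
  obtains n where "number_field (field_of_moduli g2 g3 B) n" "lame_invariant g2 g3 B \<in> field_of_moduli g2 g3 B"
proof -
  let ?G = "\<lambda>g2' g3' B'. generate_field ring_of_type_algebra {g2', g3', B' :: complex}"
  have iff: "x \<in> field_of_moduli g2 g3 B \<longleftrightarrow> (\<forall>g2' g3' B'. lame_equiv (g2, g3, B) (g2', g3', B') \<longrightarrow> x \<in> ?G g2' g3' B')" for x
    unfolding field_of_moduli_def by blast
  have sub: "complex_subfield (field_of_moduli g2 g3 B)"
    unfolding complex_subfield_def iff
    by (blast intro: complex_subfield.one_K complex_subfield.diff_K complex_subfield.mult_K
        complex_subfield.inverse_K complex_subfield_generate_field)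
  have "lame_equiv (g2, g3, B) (u ^ 2 * g2, u ^ 3 * g3, u * B)"
    using assms(1) by (auto simp: lame_equiv_def)
  then have le: "field_of_moduli g2 g3 B \<subseteq> ?G (u ^ 2 * g2) (u ^ 3 * g3) (u * B)"
    using iff by blast
  obtain n where n: "number_field (?G (u ^ 2 * g2) (u ^ 3 * g3) (u * B)) n"
    using number_field_generate_field[OF assms(2-4)] by blast
  have "number_field (field_of_moduli g2 g3 B) n"
    using sub number_field.bounded_degree[OF n subsetD[OF le]]
    by (intro number_field.intro number_field_axioms.intro)
  moreover have "lame_invariant g2 g3 B \<in> field_of_moduli g2 g3 B"
    unfolding iff
  proof (intro allI impI)
    fix g2' g3' B' assume "lame_equiv (g2, g3, B) (g2', g3', B')"
    then obtain v where v: "v \<noteq> 0" "g2' = v ^ 2 * g2" "g3' = v ^ 3 * g3" "B' = v * B"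
      by (auto simp: lame_equiv_def)
    have "lame_invariant g2' g3' B' \<in> ?G g2' g3' B'"
      by (rule lame_invariant_in_subfield[OF complex_subfield_generate_field]) (auto intro: generate_field.incl)
    then show "lame_invariant g2 g3 B \<in> ?G g2' g3' B'"
      using lame_invariant_scale[OF v(1)] by (simp add: v)
  qed
  ultimately show ?thesis using that by blast
qed

section \<open>The divisibility of the ramification index\<close>

lemma div_gcd_dvd:
  fixes a b N :: nat
  assumes "a dvd b * N" "a > 0"
  shows "a div gcd a b dvd N"
proof -
  obtain a' b' where *: "a = a' * gcd a b" "b = b' * gcd a b" "coprime a' b'"
    using gcd_coprime_exists[of a b] assms(2) by auto
  define g where "g = gcd a b"
  have g: "a = a' * g" "b = b' * g" "g > 0" using * assms(2) by (auto simp: g_def)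
  have "a' * g dvd (b' * N) * g" using assms(1) by (simp add: g mult_ac)
  then have "a' dvd b' * N" using g(3) by simp
  then have "a' dvd N" using *(3) by (simp add: coprime_dvd_mult_right_iff)
  moreover have "a div g = a'" by (subst g(1)) (use g(3) in simp)
  ultimately show ?thesis by (simp add: g_def)
qed

theorem theorem2:
  fixes p s e :: nat
    and g2 g3 B x0 :: complex
    and \<beta> :: "complex poly"
    and K \<pp> :: "complex set"
  assumes "Factorial_Ring.prime p" and "p > 3"
    and "g2 ^ 3 - 27 * g3 ^ 2 \<noteq> 0"
    and "poly (lame_poly g2 g3) x0 \<noteq> 0"
    and "projective_monodromy g2 g3 B x0 \<cong> dihedral_group p"
    and "K = field_of_moduli g2 g3 B"
    and "prime_above p K \<pp>"
    and "associated_tree p g2 g3 B \<beta>"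
    and "s = signature \<beta>"
    and "e = (p + 1 - s) div gcd (p + 1 - s) (4 * (3 - s))"
  shows "e dvd ramification_index p K \<pp>"
proof -
  have p: "Factorial_Ring.prime p" "p > 3" and disc: "g2 ^ 3 - 27 * g3 ^ 2 \<noteq> 0"
    and K: "K = field_of_moduli g2 g3 B" and P: "prime_above p K \<pp>" by fact+
  obtain z0 a b c \<phi> Pt where abc: "a + b + c = p" and tm: "tree_model \<beta> z0 a b c"
    and \<phi>: "double_cover \<phi>" "branch_points (weierstrass_curve g2 g3) \<phi> = Some ` odd_vertices \<beta>"
      "\<phi> None = Some z0" "x_coord Pt = Some B" "\<phi> Pt = None"
    using assms(8) unfolding associated_tree_def by blast
  have belyi: "belyi_poly \<beta>" and z0: "z0 \<in> black \<beta>" "valency \<beta> z0 = 3" using tm by (auto simp: tree_model_def)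
  have card: "card (black \<beta> \<union> white \<beta>) = p + 1" using tree_model_card_vertices[OF tm] abc by simp
  obtain \<kappa> where \<kappa>: "\<kappa> \<noteq> 0" "card (odd_vertices \<beta>) = 4"
    "{x. poly (lame_poly g2 g3) x = 0} = (\<lambda>q. B + \<kappa> / (q - z0)) ` (odd_vertices \<beta> - {z0})"
    using odd_vertices_lame_roots[OF disc \<phi>] .
  obtain A Q W R \<nu> where \<nu>: "\<nu> \<noteq> 0" and tree: "tree_poly p A Q W R" and s: "card A = signature \<beta>"
    and AW: "A \<union> W = (\<lambda>z. (z - z0) * \<nu>) ` (odd_vertices \<beta> - {z0})"
    using tree_poly_normal_form[OF belyi card p \<kappa>(2) z0] .
  interpret T: tree_poly p A Q W R by fact
  define k where "k = \<kappa> * \<nu>"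
  have k: "k \<noteq> 0" using \<kappa>(1) \<nu> by (simp add: k_def)
  have "{x. poly (lame_poly g2 g3) x = 0} = (\<lambda>x. B + k / x) ` (A \<union> W)"
    unfolding AW \<kappa>(3) image_image using \<nu> by (simp add: k_def)
  then have lame: "lame_poly g2 g3 = smult 4 (root_poly ((\<lambda>x. B + k / x) ` (A \<union> W)))"
    using lame_poly_roots(2)[OF disc] by simp
  \<comment> \<open>As \<open>p\<close> is odd and equals \<open>3 + card A + 2 * card Q\<close>,
    the number of black ends is even.\<close>
  have s_cases: "card A = 0 \<and> card W = 3 \<or> card A = 2 \<and> card W = 1"
  proof -
    have "odd p" using p by (simp add: prime_odd_nat)
    then have "odd (3 + card A)" using T.card_black by (metis even_add even_mult_iff even_numeral)
    then show ?thesis using T.card_odd by presburger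
  qed
  have AWdis: "A \<inter> W = {}" using T.poly_F_black T.poly_F_white by fastforce
  have nz: "x \<noteq> 0" if "x \<in> A \<union> W" for x using that T.zero_notin T.zero_notin_white by auto
  obtain x1 x2 x3 where x: "A \<union> W = {x1, x2, x3}" "x1 \<noteq> x2" "x1 \<noteq> x3" "x2 \<noteq> x3"
    and x_cases: "A = {} \<and> W = {x1, x2, x3} \<or> A = {x1, x2} \<and> W = {x3}"
  proof (cases "card A = 0")
    case True
    then have "A = {}" "card W = 3" using T.fin s_cases by auto
    then show ?thesis using that unfolding card_3_iff by auto
  next
    case False
    then have "card A = 2" "card W = 1" using s_cases by auto
    then obtain x1 x2 x3 where "A = {x1, x2}" "x1 \<noteq> x2" "W = {x3}"
      by (metis card_2_iff card_1_singletonE)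
    then show ?thesis using that[of x1 x2 x3] AWdis by auto
  qed
  have xnz: "x1 \<noteq> 0" "x2 \<noteq> 0" "x3 \<noteq> 0" using nz x(1) by auto
  have lame': "lame_poly g2 g3 = smult 4 (root_poly {B + k / x1, B + k / x2, B + k / x3})"
    using lame by (simp add: x(1))
  define u where "u = x1 * x2 * x3 / k"
  have u: "u \<noteq> 0" using xnz k by (simp add: u_def)
  have int: "u ^ 2 * g2 \<in> V \<and> u ^ 3 * g3 \<in> V \<and> u * B \<in> V" if V: "valuation_ring V M" "of_nat p \<in> M" for V M
  proof -
    interpret residue_char V M p using V p by (simp add: residue_char_def residue_char_axioms_def)
    interpret TV: tree_poly_valuation p A Q W R V M ..
    have "vunit (of_nat 3)" using p by (intro vunit_of_nat) (auto dest: dvd_imp_le simp: primes_dvd_imp_eq)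
    then have "inverse 3 \<in> V" using vunit_V[OF vunit_inverse] by fastforce
    moreover have "x1 \<in> V" "x2 \<in> V" "x3 \<in> V" using TV.odd_vertex_V x(1) by auto
    ultimately show ?thesis
      using lame_coefficients_integral[OF lame' x(2-4) k xnz V(1)] by (simp add: u_def)
  qed
  have "p > 1" using p by simp
  then have alg: "algebraic (u ^ 2 * g2)" "algebraic (u ^ 3 * g3)" "algebraic (u * B)"
    using int by (auto intro: algebraic_if_integral_above_prime)
  obtain n where "number_field K n" and inv: "lame_invariant g2 g3 B \<in> K"
    using number_field_field_of_moduli[OF u alg] unfolding K .
  then interpret N: number_field K n by simp
  obtain V M where V: "number_field_valuation K n V M p" "\<pp> = number_field_valuation.\<pp> K M"
    using N.prime_above_valuation[OF p(1) P] .
  interpret NV: number_field_valuation K n V M p by fact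
  interpret TV: tree_poly_valuation p A Q W R V M ..
  define \<delta> where "\<delta> = lame_invariant g2 g3 B"
  have \<delta>: "\<delta> = ((x1 - x2) * (x1 - x3) * (x2 - x3) / (x1 * x2 * x3)) ^ 2"
    unfolding \<delta>_def by (rule lame_invariant_eq[OF lame' x(2-4) k xnz])
  have \<delta>0: "\<delta> \<noteq> 0" using x xnz by (simp add: \<delta>)
  have s': "s = card A" using s assms(9) by simp
  \<comment> \<open>For \<open>s = 0\<close> this reads \<open>p + 1\<close> dividing 12 times the
    index, for \<open>s = 2\<close> it reads \<open>p - 1\<close> dividing 4 times the
    index.\<close>
  have "(p + 1 - s) dvd (4 * (3 - s)) * ramification_index p K \<pp>"
    using x_cases
  proof
    assume c: "A = {} \<and> W = {x1, x2, x3}"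
    then have "NV.vunit (\<delta> ^ (p + 1) / of_nat p powi 12)"
      unfolding \<delta> using TV.discriminant_white x by blast
    from NV.dvd_ramification_index[OF _ \<delta>0 this] inv
    have "int (p + 1) dvd 12 * int (ramification_index p K \<pp>)" by (simp add: V(2) \<delta>_def)
    then have "int (p + 1) dvd int (12 * ramification_index p K \<pp>)" by simp
    then have "p + 1 dvd 12 * ramification_index p K \<pp>" by (simp only: int_dvd_int_iff)
    then show ?thesis using c by (simp add: s')
  next
    assume c: "A = {x1, x2} \<and> W = {x3}"
    then have "NV.vunit (\<delta> ^ (p - 1) / of_nat p powi (- 4))"
      unfolding \<delta> using TV.discriminant_black x by blast
    from NV.dvd_ramification_index[OF _ \<delta>0 this] inv
    have "int (p - 1) dvd - 4 * int (ramification_index p K \<pp>)" by (simp add: V(2) \<delta>_def)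
    then have "int (p - 1) dvd int (4 * ramification_index p K \<pp>)" by simp
    then have "p - 1 dvd 4 * ramification_index p K \<pp>" by (simp only: int_dvd_int_iff)
    then show ?thesis using c x(2) by (simp add: s')
  qed
  then show ?thesis
    unfolding assms(10) by (rule div_gcd_dvd) (use p s' s_cases in auto)
qed

end
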